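(* Let $A\#_R B$ be a strong smash product algebra. Then the diagonal $\Delta_\bullet(A\natural B)$ of the cylindrical module $A\natural B$ is isomorphic, as a cyclic module, to the cyclic module $C_\bullet(A\#_R B)$ of the algebra $A\#_R B$.
   Context: Conventions: $k$ is a field containing $\mathbb{Q}$, $\otimes=\otimes_k$, all algebras are unital associative $k$-algebras, and tensors are written with commas or bars. Strong smash product algebras. Let $A,B$ be algebras with multiplications $m_A,m_B$. For a linear map $R:B\otimes A\to A\otimes B$, $R_{i,i+1}$ denotes $R$ applied to tensor factors $i,i+1$. $R$ is quasitriangular if $R\circ(m_B\otimes id)=(id\otimes m_B)R_{12}R_{23}$ on $B\otimes B\otimes A$ and $R\circ(id\otimes m_A)=(m_A\otimes id)R_{23}R_{12}$ on $B\otimes A\otimes A$; it is normal if $R(1\otimes a)=a\otimes 1$ and $R(b\otimes 1)=1\otimes b$ for all $a\in A,b\in B$. For quasitriangular and normal $R$, the smash product algebra $A\#_R B$ is $A\otimes B$ with product $(a\otimes b)(a'\otimes b')=aR(b\otimes a')b'$; it is strong if $R$ is bijective. Cyclic modules. A cyclic module is a simplicial module $(C_n,d_i,s_i)_{n\ge0}$ with invertible maps $t_n:C_n\to C_n$ such that $d_it_n=t_{n-1}d_{i-1}$ and $s_it_n=t_{n+1}s_{i-1}$ for $1\le i\le n$, $d_0t_n=d_n$, $s_0t_n=t_{n+1}^2s_n$, and $t_n^{n+1}=id$. For an algebra $X$, $C_\bullet(X)$ is the cyclic module $C_n(X)=X^{\otimes(n+1)}$ with $d_i(x_0,\ldots,x_n)=(x_0,\ldots,x_ix_{i+1},\ldots,x_n)$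 for $0\le i<n$, $d_n(x_0,\ldots,x_n)=(x_nx_0,x_1,\ldots,x_{n-1})$, $t(x_0,\ldots,x_n)=(x_n,x_0,\ldots,x_{n-1})$, $s_j(x_0,\ldots,x_n)=(x_0,\ldots,x_j,1,x_{j+1},\ldots,x_n)$ for $0\le j\le n$. The module $A\natural B$. $A\natural B(p,q)=B^{\otimes(p+1)}\otimes A^{\otimes(q+1)}$. Put $\Theta_q=R_{q+1,q+2}\cdots R_{23}R_{12}: B\otimes A^{\otimes(q+1)}\to A^{\otimes (q+1)}\otimes B$, $\Gamma_p=R^{-1}_{p+1,p+2}\cdots R^{-1}_{23}R^{-1}_{12}: A\otimes B^{\otimes(p+1)}\to B^{\otimes (p+1)}\otimes A$, and $f^{m,n}(c_1,\ldots,c_m,c_1',\ldots,c_n')=(c_1',\ldots,c_n',c_1,\ldots,c_m)$. Then $t_{p,q}(b_0,\ldots,b_p\,|\,a_0,\ldots,a_q)=f^{p+q+1,1}(b_0,\ldots,b_{p-1},\Theta_q(b_p,a_0,\ldots,a_q))$; $d_i^{p,q}(b_0,\ldots,b_p|a_0,\ldots,a_q)=(b_0,\ldots,b_ib_{i+1},\ldots,b_p|a_0,\ldots,a_q)$ for $0\le i<p$, and $d_p^{p,q}=d_0^{p,q}t_{p,q}$; $s_i^{p,q}(b_0,\ldots,b_p|a_0,\ldots,a_q)=(b_0,\ldots,b_i,1,b_{i+1},\ldots,b_p|a_0,\ldots,a_q)$ for $0\le i\le p$; $\bar t_{p,q}(b_0,\ldots,b_p|a_0,\ldots,a_q)=(\Gamma_p(a_q,b_0,\ldots,b_p),a_0,\ldots,a_{q-1})$;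 $\bar d_j^{p,q}(b_0,\ldots,b_p|a_0,\ldots,a_q)=(b_0,\ldots,b_p|a_0,\ldots,a_ja_{j+1},\ldots,a_q)$ for $0\le j<q$, and $\bar d_q^{p,q}=\bar d_0^{p,q}\bar t_{p,q}$; $\bar s_j^{p,q}(b_0,\ldots,b_p|a_0,\ldots,a_q)=(b_0,\ldots,b_p|a_0,\ldots,a_j,1,a_{j+1},\ldots,a_q)$ for $0\le j\le q$. (This is a cylindrical module: the unbarred operators are paracyclic in $p$, the barred ones paracyclic in $q$, they commute with each other, and $t_{p,q}^{p+1}\bar t_{p,q}^{\,q+1}=id$.) Its diagonal is the cyclic module $\Delta_n(A\natural B)=A\natural B(n,n)$ with face maps $d_i^{n,n}\bar d_i^{n,n}$ (i.e. the composite of the two $i$-th face maps, in the two directions), degeneracy maps $s_i^{n,n}\bar s_i^{n,n}$ (likewise) and cyclic operator $t_{n,n}\bar t_{n,n}$. *)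

theory Defs
  imports Complex_Main "HOL-Algebra.Module" "HOL-Algebra.AbelCoset"
begin

section \<open>Linear maps, algebras, and the ground field\<close>

definition rat_ring :: "rat ring" where
  "rat_ring = \<lparr>carrier = UNIV, monoid.mult = (*), one = 1, ring.zero = 0, ring.add = (+)\<rparr>"

definition contains_rat :: "'k ring \<Rightarrow> bool" where
  "contains_rat K \<longleftrightarrow> (\<exists>\<iota>. \<iota> \<in> ring_hom rat_ring K \<and> inj \<iota>)"

text \<open>The library locale \<^locale>\<open>algebra\<close> requires a commutative product.\<close>

locale assoc_algebra = module K X + X?: ring X
  for K :: "'k ring" and X :: "('k, 'x) module" (structure) +
  assumes smult_mult_left:
      "\<lbrakk>c \<in> carrier K; x \<in> carrier X; y \<in> carrier X\<rbrakk> \<Longrightarrow> (c \<odot> x) \<otimes> y = c \<odot> (x \<otimes> y)"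
    and smult_mult_right:
      "\<lbrakk>c \<in> carrier K; x \<in> carrier X; y \<in> carrier X\<rbrakk> \<Longrightarrow> x \<otimes> (c \<odot> y) = c \<odot> (x \<otimes> y)"

definition lin_maps :: "'k ring \<Rightarrow> ('k, 'x) module \<Rightarrow> ('k, 'y) module \<Rightarrow> ('x \<Rightarrow> 'y) set" where
  "lin_maps K M N =
     {f \<in> carrier M \<rightarrow> carrier N.
        (\<forall>x\<in>carrier M. \<forall>y\<in>carrier M. f (x \<oplus>\<^bsub>M\<^esub> y) = f x \<oplus>\<^bsub>N\<^esub> f y) \<and>
        (\<forall>c\<in>carrier K. \<forall>x\<in>carrier M. f (c \<odot>\<^bsub>M\<^esub> x) = c \<odot>\<^bsub>N\<^esub> f x)}"

text \<open>Tensor products of factors with different element types are formed after moving all factors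
  into a common type; for two algebras on \<^typ>\<open>'a\<close> and \<^typ>\<open>'b\<close> this is \<^typ>\<open>'a + 'b\<close>.\<close>

definition transport :: "('x \<Rightarrow> 'y) \<Rightarrow> ('y \<Rightarrow> 'x) \<Rightarrow> ('k, 'x) module \<Rightarrow> ('k, 'y) module" where
  "transport f g M =
     \<lparr>carrier = f ` carrier M,
      monoid.mult = (\<lambda>x y. f (g x \<otimes>\<^bsub>M\<^esub> g y)),
      one = f \<one>\<^bsub>M\<^esub>,
      ring.zero = f \<zero>\<^bsub>M\<^esub>,
      ring.add = (\<lambda>x y. f (g x \<oplus>\<^bsub>M\<^esub> g y)),
      smult = (\<lambda>c x. f (c \<odot>\<^bsub>M\<^esub> g x))\<rparr>"

definition in_left :: "('k, 'a) module \<Rightarrow> ('k, 'a + 'b) module" where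
  "in_left = transport Inl projl"

definition in_right :: "('k, 'b) module \<Rightarrow> ('k, 'a + 'b) module" where
  "in_right = transport Inr projr"


section \<open>Tensor products of finite lists of modules\<close>

definition tuples :: "('k, 'x) module list \<Rightarrow> 'x list set" where
  "tuples Ms = {xs. list_all2 (\<lambda>x M. x \<in> carrier M) xs Ms}"

definition free_module :: "'k ring \<Rightarrow> 'i set \<Rightarrow> ('k, 'i \<Rightarrow> 'k) module" where
  "free_module K S =
     \<lparr>carrier = {f. (\<forall>i\<in>S. f i \<in> carrier K) \<and> (\<forall>i. i \<notin> S \<longrightarrow> f i = \<zero>\<^bsub>K\<^esub>) \<and> finite {i. f i \<noteq> \<zero>\<^bsub>K\<^esub>}},
      monoid.mult = undefined,
      one = undefined,
      ring.zero = (\<lambda>_. \<zero>\<^bsub>K\<^esub>),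
      ring.add = (\<lambda>f g i. f i \<oplus>\<^bsub>K\<^esub> g i),
      smult = (\<lambda>c f i. c \<otimes>\<^bsub>K\<^esub> f i)\<rparr>"

definition basis_vec :: "'k ring \<Rightarrow> 'i \<Rightarrow> 'i \<Rightarrow> 'k" where
  "basis_vec K i = (\<lambda>j. if j = i then \<one>\<^bsub>K\<^esub> else \<zero>\<^bsub>K\<^esub>)"

definition multilinear_relators :: "'k ring \<Rightarrow> ('k, 'x) module list \<Rightarrow> ('x list \<Rightarrow> 'k) set" where
  "multilinear_relators K Ms =
     (let F = free_module K (tuples Ms); e = basis_vec K in
       {e (xs[i := x \<oplus>\<^bsub>Ms ! i\<^esub> y]) \<ominus>\<^bsub>F\<^esub> (e (xs[i := x]) \<oplus>\<^bsub>F\<^esub> e (xs[i := y])) | xs i x y.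
          xs \<in> tuples Ms \<and> i < length Ms \<and> x \<in> carrier (Ms ! i) \<and> y \<in> carrier (Ms ! i)} \<union>
       {e (xs[i := c \<odot>\<^bsub>Ms ! i\<^esub> x]) \<ominus>\<^bsub>F\<^esub> c \<odot>\<^bsub>F\<^esub> e (xs[i := x]) | xs i c x.
          xs \<in> tuples Ms \<and> i < length Ms \<and> c \<in> carrier K \<and> x \<in> carrier (Ms ! i)})"

definition tensor_null :: "'k ring \<Rightarrow> ('k, 'x) module list \<Rightarrow> ('x list \<Rightarrow> 'k) set" where
  "tensor_null K Ms =
     \<Inter>{H. submodule H K (free_module K (tuples Ms)) \<and> multilinear_relators K Ms \<subseteq> H}"

type_synonym ('x, 'k) tens = "('x list \<Rightarrow> 'k) set"

text \<open>\<open>tensor K [M1, \<dots>, Mn]\<close> is \<open>M1 \<otimes> \<dots> \<otimes> Mn\<close>, the free module on tuples modulo multilinearity; its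
  elements are cosets. Only the module part of the record is meaningful.\<close>

definition tensor :: "'k ring \<Rightarrow> ('k, 'x) module list \<Rightarrow> ('k, ('x, 'k) tens) module" where
  "tensor K Ms =
     (let F = free_module K (tuples Ms); N = tensor_null K Ms in
       \<lparr>carrier = a_rcosets\<^bsub>F\<^esub> N,
        monoid.mult = undefined,
        one = undefined,
        ring.zero = N,
        ring.add = (\<lambda>s t. s <+>\<^bsub>F\<^esub> t),
        smult = (\<lambda>c t. \<Union>f\<in>t. N +>\<^bsub>F\<^esub> (c \<odot>\<^bsub>F\<^esub> f))\<rparr>)"

definition pure :: "'k ring \<Rightarrow> ('k, 'x) module list \<Rightarrow> 'x list \<Rightarrow> ('x, 'k) tens" where
  "pure K Ms xs = tensor_null K Ms +>\<^bsub>free_module K (tuples Ms)\<^esub> basis_vec K xs"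

text \<open>The unique linear map on \<open>tensor K Ms\<close> with the values \<open>g\<close> on pure tensors; meaningful when \<open>g\<close>
  is multilinear on tuples.\<close>

definition tlift ::
  "'k ring \<Rightarrow> ('k, 'x) module list \<Rightarrow> ('k, 'y) module \<Rightarrow> ('x list \<Rightarrow> 'y) \<Rightarrow> ('x, 'k) tens \<Rightarrow> 'y" where
  "tlift K Ms N g =
     (THE F. F \<in> lin_maps K (tensor K Ms) N \<and> F \<in> extensional (carrier (tensor K Ms)) \<and>
             (\<forall>xs\<in>tuples Ms. F (pure K Ms xs) = g xs))"

definition tmap ::
  "'k ring \<Rightarrow> ('k, 'x) module list \<Rightarrow> ('k, 'y) module list \<Rightarrow> ('x list \<Rightarrow> 'y list)
    \<Rightarrow> ('x, 'k) tens \<Rightarrow> ('y, 'k) tens" where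
  "tmap K Ms Ns h = tlift K Ms (tensor K Ns) (\<lambda>xs. pure K Ns (h xs))"

text \<open>\<open>tcat K Ms Ns s t\<close> is \<open>s \<otimes> t\<close> under the identification
  \<open>tensor K Ms \<otimes> tensor K Ns = tensor K (Ms @ Ns)\<close>.\<close>

definition tcat ::
  "'k ring \<Rightarrow> ('k, 'x) module list \<Rightarrow> ('k, 'x) module list
    \<Rightarrow> ('x, 'k) tens \<Rightarrow> ('x, 'k) tens \<Rightarrow> ('x, 'k) tens" where
  "tcat K Ms Ns s t =
     tlift K Ms (tensor K (Ms @ Ns)) (\<lambda>xs. tmap K Ns (Ms @ Ns) (\<lambda>ys. xs @ ys) t) s"

text \<open>\<open>id \<otimes> F \<otimes> id\<close>, where \<open>F\<close> goes from \<open>tensor K Ms\<close> to \<open>tensor K Ns\<close> and the identities are those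
  of \<open>tensor K Us\<close> and \<open>tensor K Vs\<close>.\<close>

definition tinner ::
  "'k ring \<Rightarrow> ('k, 'x) module list \<Rightarrow> ('k, 'x) module list \<Rightarrow> ('k, 'x) module list
    \<Rightarrow> ('k, 'x) module list \<Rightarrow> (('x, 'k) tens \<Rightarrow> ('x, 'k) tens) \<Rightarrow> ('x, 'k) tens \<Rightarrow> ('x, 'k) tens" where
  "tinner K Us Ms Ns Vs F =
     tlift K (Us @ Ms @ Vs) (tensor K (Us @ Ns @ Vs))
       (\<lambda>xs. tcat K Us (Ns @ Vs)
               (pure K Us (take (length Us) xs))
               (tcat K Ns Vs
                 (F (pure K Ms (take (length Ms) (drop (length Us) xs))))
                 (pure K Vs (drop (length Us + length Ms) xs))))"

text \<open>The block exchange \<open>f\<^sup>m\<^sup>,\<^sup>n\<close>, with \<open>m = length Ms\<close> and \<open>n = length Ns\<close>.\<close>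

definition tflip ::
  "'k ring \<Rightarrow> ('k, 'x) module list \<Rightarrow> ('k, 'x) module list \<Rightarrow> ('x, 'k) tens \<Rightarrow> ('x, 'k) tens" where
  "tflip K Ms Ns = tmap K (Ms @ Ns) (Ns @ Ms) (\<lambda>xs. drop (length Ms) xs @ take (length Ms) xs)"

definition contract :: "('k, 'x) module \<Rightarrow> nat \<Rightarrow> 'x list \<Rightarrow> 'x list" where
  "contract X i xs = take i xs @ [xs ! i \<otimes>\<^bsub>X\<^esub> xs ! (i + 1)] @ drop (i + 2) xs"

definition insert_one :: "('k, 'x) module \<Rightarrow> nat \<Rightarrow> 'x list \<Rightarrow> 'x list" where
  "insert_one X i xs = take i xs @ [\<one>\<^bsub>X\<^esub>] @ drop i xs"


section \<open>Strong smash product algebras\<close>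

definition mult_map :: "'k ring \<Rightarrow> ('k, 'x) module \<Rightarrow> ('x, 'k) tens \<Rightarrow> ('x, 'k) tens" where
  "mult_map K X = tmap K [X, X] [X] (contract X 0)"

definition quasitriangular ::
  "'k ring \<Rightarrow> ('k, 'x) module \<Rightarrow> ('k, 'x) module \<Rightarrow> (('x, 'k) tens \<Rightarrow> ('x, 'k) tens) \<Rightarrow> bool" where
  "quasitriangular K A B R \<longleftrightarrow>
     (\<forall>t\<in>carrier (tensor K [B, B, A]).
        R (tinner K [] [B, B] [B] [A] (mult_map K B) t) =
        tinner K [A] [B, B] [B] [] (mult_map K B)
          (tinner K [] [B, A] [A, B] [B] R (tinner K [B] [B, A] [A, B] [] R t))) \<and>
     (\<forall>t\<in>carrier (tensor K [B, A, A]).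
        R (tinner K [B] [A, A] [A] [] (mult_map K A) t) =
        tinner K [] [A, A] [A] [B] (mult_map K A)
          (tinner K [A] [B, A] [A, B] [] R (tinner K [] [B, A] [A, B] [A] R t)))"

definition normal_twist ::
  "'k ring \<Rightarrow> ('k, 'x) module \<Rightarrow> ('k, 'x) module \<Rightarrow> (('x, 'k) tens \<Rightarrow> ('x, 'k) tens) \<Rightarrow> bool" where
  "normal_twist K A B R \<longleftrightarrow>
     (\<forall>a\<in>carrier A. R (pure K [B, A] [\<one>\<^bsub>B\<^esub>, a]) = pure K [A, B] [a, \<one>\<^bsub>B\<^esub>]) \<and>
     (\<forall>b\<in>carrier B. R (pure K [B, A] [b, \<one>\<^bsub>A\<^esub>]) = pure K [A, B] [\<one>\<^bsub>A\<^esub>, b])"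

locale strong_smash =
  A: assoc_algebra K A + B: assoc_algebra K B
  for K :: "'k ring" and A :: "('k, 'x) module" and B :: "('k, 'x) module"
    and R :: "('x, 'k) tens \<Rightarrow> ('x, 'k) tens" +
  assumes R_linear: "R \<in> lin_maps K (tensor K [B, A]) (tensor K [A, B])"
    and R_quasitriangular: "quasitriangular K A B R"
    and R_normal: "normal_twist K A B R"
    and R_bijective: "bij_betw R (carrier (tensor K [B, A])) (carrier (tensor K [A, B]))"

definition smash_product ::
  "'k ring \<Rightarrow> ('k, 'x) module \<Rightarrow> ('k, 'x) module \<Rightarrow> (('x, 'k) tens \<Rightarrow> ('x, 'k) tens)
    \<Rightarrow> ('k, ('x, 'k) tens) module" where
  "smash_product K A B R =
     (tensor K [A, B])
       \<lparr>monoid.mult := (\<lambda>s t.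
          tmap K [A, A, B, B] [A, B] (\<lambda>xs. [xs ! 0 \<otimes>\<^bsub>A\<^esub> xs ! 1, xs ! 2 \<otimes>\<^bsub>B\<^esub> xs ! 3])
            (tinner K [A] [B, A] [A, B] [B] R (tcat K [A, B] [A, B] s t))),
        one := pure K [A, B] [\<one>\<^bsub>A\<^esub>, \<one>\<^bsub>B\<^esub>]\<rparr>"


section \<open>Cyclic modules\<close>

record ('k, 'x) cyclic_data =
  obj :: "nat \<Rightarrow> ('k, 'x) module"
  face :: "nat \<Rightarrow> nat \<Rightarrow> 'x \<Rightarrow> 'x" \<comment> \<open>\<open>face C n i\<close> maps degree \<open>n\<close> to degree \<open>n - 1\<close>\<close>
  degen :: "nat \<Rightarrow> nat \<Rightarrow> 'x \<Rightarrow> 'x" \<comment> \<open>\<open>degen C n i\<close> maps degree \<open>n\<close> to degree \<open>n + 1\<close>\<close>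
  cyc :: "nat \<Rightarrow> 'x \<Rightarrow> 'x"

locale cyclic_module =
  fixes K :: "'k ring" and C :: "('k, 'x) cyclic_data"
  assumes obj_module: "module K (obj C n)"
    and face_linear: "\<lbrakk>1 \<le> n; i \<le> n\<rbrakk> \<Longrightarrow> face C n i \<in> lin_maps K (obj C n) (obj C (n - 1))"
    and degen_linear: "i \<le> n \<Longrightarrow> degen C n i \<in> lin_maps K (obj C n) (obj C (n + 1))"
    and cyc_linear: "cyc C n \<in> lin_maps K (obj C n) (obj C n)"
    and cyc_bij: "bij_betw (cyc C n) (carrier (obj C n)) (carrier (obj C n))"
    and face_face: "\<lbrakk>2 \<le> n; i < j; j \<le> n; x \<in> carrier (obj C n)\<rbrakk> \<Longrightarrow>
          face C (n - 1) i (face C n j x) = face C (n - 1) (j - 1) (face C n i x)"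
    and degen_degen: "\<lbrakk>i \<le> j; j \<le> n; x \<in> carrier (obj C n)\<rbrakk> \<Longrightarrow>
          degen C (n + 1) i (degen C n j x) = degen C (n + 1) (j + 1) (degen C n i x)"
    and face_degen_less: "\<lbrakk>i < j; j \<le> n; x \<in> carrier (obj C n)\<rbrakk> \<Longrightarrow>
          face C (n + 1) i (degen C n j x) = degen C (n - 1) (j - 1) (face C n i x)"
    and face_degen_same: "\<lbrakk>j \<le> n; i = j \<or> i = j + 1; x \<in> carrier (obj C n)\<rbrakk> \<Longrightarrow>
          face C (n + 1) i (degen C n j x) = x"
    and face_degen_greater: "\<lbrakk>j + 1 < i; i \<le> n + 1; x \<in> carrier (obj C n)\<rbrakk> \<Longrightarrow>
          face C (n + 1) i (degen C n j x) = degen C (n - 1) j (face C n (i - 1) x)"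
    and face_cyc: "\<lbrakk>1 \<le> i; i \<le> n; x \<in> carrier (obj C n)\<rbrakk> \<Longrightarrow>
          face C n i (cyc C n x) = cyc C (n - 1) (face C n (i - 1) x)"
    and face_0_cyc: "\<lbrakk>1 \<le> n; x \<in> carrier (obj C n)\<rbrakk> \<Longrightarrow> face C n 0 (cyc C n x) = face C n n x"
    and degen_cyc: "\<lbrakk>1 \<le> i; i \<le> n; x \<in> carrier (obj C n)\<rbrakk> \<Longrightarrow>
          degen C n i (cyc C n x) = cyc C (n + 1) (degen C n (i - 1) x)"
    and degen_0_cyc: "x \<in> carrier (obj C n) \<Longrightarrow>
          degen C n 0 (cyc C n x) = cyc C (n + 1) (cyc C (n + 1) (degen C n n x))"
    and cyc_period: "x \<in> carrier (obj C n) \<Longrightarrow> (cyc C n ^^ (n + 1)) x = x"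

definition cyclic_iso ::
  "'k ring \<Rightarrow> ('k, 'x) cyclic_data \<Rightarrow> ('k, 'y) cyclic_data \<Rightarrow> (nat \<Rightarrow> 'x \<Rightarrow> 'y) \<Rightarrow> bool" where
  "cyclic_iso K C D \<phi> \<longleftrightarrow>
     (\<forall>n. \<phi> n \<in> lin_maps K (obj C n) (obj D n) \<and>
          bij_betw (\<phi> n) (carrier (obj C n)) (carrier (obj D n)) \<and>
          (\<forall>x\<in>carrier (obj C n).
             (\<forall>i\<le>n. 1 \<le> n \<longrightarrow> \<phi> (n - 1) (face C n i x) = face D n i (\<phi> n x)) \<and>
             (\<forall>i\<le>n. \<phi> (n + 1) (degen C n i x) = degen D n i (\<phi> n x)) \<and>
             \<phi> n (cyc C n x) = cyc D n (\<phi> n x)))"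

definition isomorphic_cyclic_modules ::
  "'k ring \<Rightarrow> ('k, 'x) cyclic_data \<Rightarrow> ('k, 'y) cyclic_data \<Rightarrow> bool" where
  "isomorphic_cyclic_modules K C D \<longleftrightarrow>
     cyclic_module K C \<and> cyclic_module K D \<and> (\<exists>\<phi>. cyclic_iso K C D \<phi>)"

definition algebra_cyclic :: "'k ring \<Rightarrow> ('k, 'x) module \<Rightarrow> ('k, ('x, 'k) tens) cyclic_data" where
  "algebra_cyclic K X =
     (let P = (\<lambda>n. replicate (n + 1) X) in
       \<lparr>obj = (\<lambda>n. tensor K (P n)),
        face = (\<lambda>n i. tmap K (P n) (P (n - 1))
                  (\<lambda>xs. if i < n then contract X i xs
                        else (last xs \<otimes>\<^bsub>X\<^esub> hd xs) # butlast (tl xs))),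
        degen = (\<lambda>n j. tmap K (P n) (P (n + 1)) (insert_one X (j + 1))),
        cyc = (\<lambda>n. tmap K (P n) (P n) (\<lambda>xs. last xs # butlast xs))\<rparr>)"


section \<open>The cylindrical module \<open>A \<natural> B\<close> and its diagonal\<close>

text \<open>For \<open>S\<close> from \<open>X \<otimes> Y\<close> to \<open>Y \<otimes> X\<close>, \<open>slide K X Y S n j\<close> is \<open>S\<^bsub>j,j+1\<^esub> \<cdots> S\<^bsub>2,3\<^esub> S\<^bsub>1,2\<^esub>\<close> on
  \<open>X \<otimes> Y \<otimes> \<cdots> \<otimes> Y\<close> (\<open>n\<close> factors \<open>Y\<close>), for \<open>j \<le> n\<close>.\<close>

primrec slide ::
  "'k ring \<Rightarrow> ('k, 'x) module \<Rightarrow> ('k, 'x) module \<Rightarrow> (('x, 'k) tens \<Rightarrow> ('x, 'k) tens)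
    \<Rightarrow> nat \<Rightarrow> nat \<Rightarrow> ('x, 'k) tens \<Rightarrow> ('x, 'k) tens" where
  "slide K X Y S n 0 t = t"
| "slide K X Y S n (Suc j) t =
     tinner K (replicate j Y) [X, Y] [Y, X] (replicate (n - Suc j) Y) S (slide K X Y S n j t)"

locale natural_data =
  fixes K :: "'k ring" and A :: "('k, 'x) module" and B :: "('k, 'x) module"
    and R :: "('x, 'k) tens \<Rightarrow> ('x, 'k) tens"
begin

definition bs :: "nat \<Rightarrow> ('k, 'x) module list" where "bs n = replicate n B"
definition as :: "nat \<Rightarrow> ('k, 'x) module list" where "as n = replicate n A"

definition factors :: "nat \<Rightarrow> nat \<Rightarrow> ('k, 'x) module list" where
  "factors p q = bs (p + 1) @ as (q + 1)"

definition R_inv :: "('x, 'k) tens \<Rightarrow> ('x, 'k) tens" where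
  "R_inv = inv_into (carrier (tensor K [B, A])) R"

definition Theta :: "nat \<Rightarrow> ('x, 'k) tens \<Rightarrow> ('x, 'k) tens" where
  "Theta q = slide K B A R (q + 1) (q + 1)"

definition Gamma :: "nat \<Rightarrow> ('x, 'k) tens \<Rightarrow> ('x, 'k) tens" where
  "Gamma p = slide K A B R_inv (p + 1) (p + 1)"

definition t_op :: "nat \<Rightarrow> nat \<Rightarrow> ('x, 'k) tens \<Rightarrow> ('x, 'k) tens" where
  "t_op p q x =
     tflip K (bs p @ as (q + 1)) [B]
       (tinner K (bs p) (B # as (q + 1)) (as (q + 1) @ [B]) [] (Theta q) x)"

text \<open>\<open>d_op p q i\<close> goes from bidegree \<open>(p, q)\<close> to \<open>(p - 1, q)\<close> and is meaningful only for \<open>p \<ge> 1\<close>;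
  likewise for \<open>dbar_op\<close> and \<open>q\<close>.\<close>

definition d_op :: "nat \<Rightarrow> nat \<Rightarrow> nat \<Rightarrow> ('x, 'k) tens \<Rightarrow> ('x, 'k) tens" where
  "d_op p q i x =
     (let m = (\<lambda>i. tmap K (factors p q) (factors (p - 1) q) (contract B i))
      in if i < p then m i x else m 0 (t_op p q x))"

definition s_op :: "nat \<Rightarrow> nat \<Rightarrow> nat \<Rightarrow> ('x, 'k) tens \<Rightarrow> ('x, 'k) tens" where
  "s_op p q i = tmap K (factors p q) (factors (p + 1) q) (insert_one B (i + 1))"

definition tbar_op :: "nat \<Rightarrow> nat \<Rightarrow> ('x, 'k) tens \<Rightarrow> ('x, 'k) tens" where
  "tbar_op p q x =
     tinner K [] (A # bs (p + 1)) (bs (p + 1) @ [A]) (as q) (Gamma p)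
       (tflip K (bs (p + 1) @ as q) [A] x)"

definition dbar_op :: "nat \<Rightarrow> nat \<Rightarrow> nat \<Rightarrow> ('x, 'k) tens \<Rightarrow> ('x, 'k) tens" where
  "dbar_op p q j x =
     (let m = (\<lambda>j. tmap K (factors p q) (factors p (q - 1)) (contract A (p + 1 + j)))
      in if j < q then m j x else m 0 (tbar_op p q x))"

definition sbar_op :: "nat \<Rightarrow> nat \<Rightarrow> nat \<Rightarrow> ('x, 'k) tens \<Rightarrow> ('x, 'k) tens" where
  "sbar_op p q j = tmap K (factors p q) (factors p (q + 1)) (insert_one A (p + 1 + j + 1))"

text \<open>In each composite the barred operator acts first, so the unbarred face starts in bidegree
  \<open>(n, n - 1)\<close> and the unbarred degeneracy in \<open>(n, n + 1)\<close>.\<close>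

definition diagonal :: "('k, ('x, 'k) tens) cyclic_data" where
  "diagonal =
     \<lparr>obj = (\<lambda>n. tensor K (factors n n)),
      face = (\<lambda>n i x. d_op n (n - 1) i (dbar_op n n i x)),
      degen = (\<lambda>n i x. s_op n (n + 1) i (sbar_op n n i x)),
      cyc = (\<lambda>n x. t_op n n (tbar_op n n x))\<rparr>"

end

end

theory Submission
  imports Defs
begin

text \<open>
  Both cyclic modules can be described by words in two letters: a tensor whose factors are copies of
  \<open>A\<close> and \<open>B\<close> in some order lives on such a word. The twist \<open>R\<close> replaces two neighbouring letters
  \<open>B A\<close> by \<open>A B\<close>, and applying it as long as possible sorts a word, with all \<open>A\<close> in front
  (\<open>srt\<close>). Two neighbouring pairs \<open>B A\<close> never overlap, so the order of the moves is immaterial: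
  sorting gives the same result before and after a single move (\<open>srt_step\<close>). Since \<open>R\<close> is
  bijective, so is sorting, and it follows that any two composites of moves and inverse moves with the
  same source and target word are equal (\<open>rearr_unique\<close>). Quasitriangularity and normality of \<open>R\<close>
  say that sorting commutes with multiplying two neighbouring equal letters and with inserting a unit
  (\<open>srt_natural_A\<close>, \<open>srt_natural_B\<close>).

  In degree \<open>n\<close> the diagonal lives on the word \<open>B \<cdots> B A \<cdots> A\<close>, and the cyclic module of the smash
  product, once its nested tensors are flattened (\<open>flat\<close>), lives on \<open>A B A B \<cdots> A B\<close>, both with
  \<open>n + 1\<close> letters of each kind. Sorting identifies either of them with the space on
  \<open>A \<cdots> A B \<cdots> B\<close>, and comparing the two gives the isomorphism. In the sorted picture the face with
  index \<open>i < n\<close> is, on both sides, the product of the letters \<open>i\<close> and \<open>i + 1\<close> of each kind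
  (\<open>srt_smash_mult\<close>, \<open>srt_diag_face\<close>), and degeneracies insert a unit of each kind. The cyclic
  operators move letters from the end of a word to its front, which is not visible on sorted words.
  Here one compares the words themselves: both operators bring the last \<open>B\<close> and the last \<open>A\<close> to
  the front, and up to rotation they differ by moves of letters only, hence agree by uniqueness of
  rearrangements (\<open>srt_rotation\<close>). The last face is the face with index \<open>0\<close> after the cyclic
  operator.

  The identities of a cyclic module are verified for the cyclic module of an algebra only, where they
  are identities between lists (\<open>algebra_cyclic_module\<close>). The isomorphism carries them over to the
  diagonal (\<open>isomorphic_cyclic_modules_transport\<close>). Associativity of the smash product is again
  seen after sorting, where it becomes associativity of \<open>A\<close> and of \<open>B\<close> (\<open>smash_mult_assoc\<close>).

  The tensor products are quotients of free modules. What is used of them is the universal property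
  (\<open>tlift_spec\<close>) and, derived from it, the calculus of maps \<open>id \<otimes> F \<otimes> id\<close>: composition, nesting,
  and the commutation of maps on disjoint blocks (\<open>whisker_comp\<close>, \<open>whisker_whisker\<close>,
  \<open>whisker_interchange\<close>).
\<close>



section \<open>Tuples and linear maps\<close>

locale tensor_ground = K: cring K for K :: "'k ring" (structure)
begin

definition modules :: "('k, 'x) module list \<Rightarrow> bool" where
  "modules Ms \<longleftrightarrow> (\<forall>M\<in>set Ms. module K M)"

lemma modules_simps [simp]:
  "modules []"
  "modules (M # Ms) \<longleftrightarrow> module K M \<and> modules Ms"
  "modules (Ms @ Ns) \<longleftrightarrow> modules Ms \<and> modules Ns"
  by (auto simp: modules_def)

lemma modules_replicate [simp]: "module K M \<Longrightarrow> modules (replicate n M)"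
  by (auto simp: modules_def)

end

lemma tuples_Nil [simp]: "xs \<in> tuples [] \<longleftrightarrow> xs = []"
  by (simp add: tuples_def)

lemma tuples_Cons: "xs \<in> tuples (M # Ms) \<longleftrightarrow> (\<exists>y ys. xs = y # ys \<and> y \<in> carrier M \<and> ys \<in> tuples Ms)"
  by (auto simp: tuples_def list_all2_Cons2)

lemma tuples_Cons_iff [simp]: "x # xs \<in> tuples (M # Ms) \<longleftrightarrow> x \<in> carrier M \<and> xs \<in> tuples Ms"
  by (auto simp: tuples_Cons)

lemma Nil_in_tuples [simp]: "[] \<in> tuples Ms \<longleftrightarrow> Ms = []"
  by (simp add: tuples_def)

lemma tuples_append:
  "xs \<in> tuples (Ms @ Ns) \<longleftrightarrow> (\<exists>ys zs. xs = ys @ zs \<and> ys \<in> tuples Ms \<and> zs \<in> tuples Ns)"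
  by (simp add: tuples_def list_all2_append2) (metis list_all2_lengthD)

lemma tuples_length: "xs \<in> tuples Ms \<Longrightarrow> length xs = length Ms"
  by (simp add: tuples_def list_all2_lengthD)

lemma tuples_appendI [intro, simp]: "xs \<in> tuples Ms \<Longrightarrow> ys \<in> tuples Ns \<Longrightarrow> xs @ ys \<in> tuples (Ms @ Ns)"
  by (auto simp: tuples_append)

lemma tuples_update:
  "xs \<in> tuples Ms \<Longrightarrow> i < length Ms \<Longrightarrow> x \<in> carrier (Ms ! i) \<Longrightarrow> xs[i := x] \<in> tuples Ms"
  by (auto simp: tuples_def list_all2_conv_all_nth nth_list_update)

lemma tuples_take: "xs \<in> tuples Ms \<Longrightarrow> take i xs \<in> tuples (take i Ms)"
  by (simp add: tuples_def)

lemma tuples_drop: "xs \<in> tuples Ms \<Longrightarrow> drop i xs \<in> tuples (drop i Ms)"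
  by (simp add: tuples_def)

lemma lin_mapsI:
  assumes "\<And>x. x \<in> carrier M \<Longrightarrow> f x \<in> carrier N"
    and "\<And>x y. x \<in> carrier M \<Longrightarrow> y \<in> carrier M \<Longrightarrow> f (x \<oplus>\<^bsub>M\<^esub> y) = f x \<oplus>\<^bsub>N\<^esub> f y"
    and "\<And>c x. c \<in> carrier K \<Longrightarrow> x \<in> carrier M \<Longrightarrow> f (c \<odot>\<^bsub>M\<^esub> x) = c \<odot>\<^bsub>N\<^esub> f x"
  shows "f \<in> lin_maps K M N"
  using assms by (auto simp: lin_maps_def)

lemma lin_maps_closed: "f \<in> lin_maps K M N \<Longrightarrow> x \<in> carrier M \<Longrightarrow> f x \<in> carrier N"
  by (auto simp: lin_maps_def)

lemma lin_maps_add: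
  "f \<in> lin_maps K M N \<Longrightarrow> x \<in> carrier M \<Longrightarrow> y \<in> carrier M \<Longrightarrow> f (x \<oplus>\<^bsub>M\<^esub> y) = f x \<oplus>\<^bsub>N\<^esub> f y"
  by (auto simp: lin_maps_def)

lemma lin_maps_smult:
  "f \<in> lin_maps K M N \<Longrightarrow> c \<in> carrier K \<Longrightarrow> x \<in> carrier M \<Longrightarrow> f (c \<odot>\<^bsub>M\<^esub> x) = c \<odot>\<^bsub>N\<^esub> f x"
  by (auto simp: lin_maps_def)

lemma lin_maps_comp:
  "f \<in> lin_maps K L M \<Longrightarrow> g \<in> lin_maps K M N \<Longrightarrow> (\<lambda>x. g (f x)) \<in> lin_maps K L N"
  by (auto simp: lin_maps_def Pi_iff)

lemma lin_maps_cong: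
  assumes "f \<in> lin_maps K M N" "module K M" "\<And>x. x \<in> carrier M \<Longrightarrow> g x = f x"
  shows "g \<in> lin_maps K M N"
proof -
  interpret M: module K M by fact
  show ?thesis using assms(1,3)
    by (intro lin_mapsI) (auto simp: lin_maps_def)
qed

lemma lin_maps_id: "(\<lambda>x. x) \<in> lin_maps K M M"
  by (auto simp: lin_maps_def)

text \<open>Only the values of \<open>g\<close> on the image matter; a choice function such as \<^const>\<open>inv_into\<close> qualifies.\<close>

lemma lin_maps_inverse:
  assumes f: "f \<in> lin_maps K M N" and b: "bij_betw f (carrier M) (carrier N)"
    and M: "module K M" and N: "module K N"
    and g: "\<And>x. x \<in> carrier M \<Longrightarrow> g (f x) = x"
  shows "g \<in> lin_maps K N M"
proof -
  interpret M: module K M by fact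
  interpret N: module K N by fact
  have s: "\<exists>x\<in>carrier M. y = f x" if "y \<in> carrier N" for y
    using b that by (auto simp: bij_betw_def)
  show ?thesis
  proof (rule lin_mapsI)
    show "g y \<in> carrier M" if "y \<in> carrier N" for y using s[OF that] g by auto
  next
    fix y z assume "y \<in> carrier N" "z \<in> carrier N"
    then obtain u v where "u \<in> carrier M" "v \<in> carrier M" "y = f u" "z = f v" using s by metis
    then show "g (y \<oplus>\<^bsub>N\<^esub> z) = g y \<oplus>\<^bsub>M\<^esub> g z"
      using g by (simp flip: lin_maps_add[OF f])
  next
    fix c y assume "c \<in> carrier K" "y \<in> carrier N"
    moreover from this obtain u where "u \<in> carrier M" "y = f u" using s by metis
    ultimately show "g (c \<odot>\<^bsub>N\<^esub> y) = c \<odot>\<^bsub>M\<^esub> g y"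
      using g by (simp flip: lin_maps_smult[OF f])
  qed
qed

lemma lin_maps_hom:
  assumes "f \<in> lin_maps K M N" "module K M" "module K N"
  shows "abelian_group_hom M N f"
proof -
  interpret M: module K M by fact
  interpret N: module K N by fact
  have "group_hom (add_monoid M) (add_monoid N) f"
    using assms(1) by (auto simp: hom_def lin_maps_def group_hom_def group_hom_axioms_def M.a_group N.a_group)
  then show ?thesis
    by (rule abelian_group_homI[OF M.abelian_group_axioms N.abelian_group_axioms])
qed

section \<open>Free modules\<close>

lemma free_module_simps [simp]:
  "\<zero>\<^bsub>free_module K S\<^esub> = (\<lambda>_. \<zero>\<^bsub>K\<^esub>)"
  "f \<oplus>\<^bsub>free_module K S\<^esub> g = (\<lambda>i. f i \<oplus>\<^bsub>K\<^esub> g i)"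
  "c \<odot>\<^bsub>free_module K S\<^esub> f = (\<lambda>i. c \<otimes>\<^bsub>K\<^esub> f i)"
  by (simp_all add: free_module_def)

context tensor_ground
begin

lemma free_carrier:
  "f \<in> carrier (free_module K S) \<longleftrightarrow>
     (\<forall>i. f i \<in> carrier K) \<and> (\<forall>i. i \<notin> S \<longrightarrow> f i = \<zero>) \<and> finite {i. f i \<noteq> \<zero>}"
  by (auto simp: free_module_def)

lemma free_module_module: "module K (free_module K S)"
proof (rule moduleI)
  show "cring K" by (rule K.is_cring)
  show "abelian_group (free_module K S)"
  proof (rule abelian_groupI)
    fix f g assume "f \<in> carrier (free_module K S)" "g \<in> carrier (free_module K S)"
    then show "f \<oplus>\<^bsub>free_module K S\<^esub> g \<in> carrier (free_module K S)"
      by (auto simp: free_carrier intro!: finite_subset[of "{i. f i \<oplus> g i \<noteq> \<zero>}" "{i. f i \<noteq> \<zero>} \<union> {i. g i \<noteq> \<zero>}"])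
  next
    fix f assume f: "f \<in> carrier (free_module K S)"
    show "\<exists>y\<in>carrier (free_module K S). y \<oplus>\<^bsub>free_module K S\<^esub> f = \<zero>\<^bsub>free_module K S\<^esub>"
      by (rule bexI[of _ "\<lambda>i. \<ominus> f i"])
        (use f in \<open>auto simp: free_carrier K.l_neg intro: finite_subset[of _ "{i. f i \<noteq> \<zero>}"]\<close>)
  qed (auto simp: free_carrier K.a_ac)
  show "c \<odot>\<^bsub>free_module K S\<^esub> f \<in> carrier (free_module K S)"
    if "c \<in> carrier K" "f \<in> carrier (free_module K S)" for c f
    using that by (auto simp: free_carrier intro: finite_subset[of _ "{i. f i \<noteq> \<zero>}"])
qed (auto simp: free_carrier K.l_distr K.r_distr K.m_assoc)

lemma basis_vec_closed [simp]: "i \<in> S \<Longrightarrow> basis_vec K i \<in> carrier (free_module K S)"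
  by (auto simp: free_carrier basis_vec_def intro: finite_subset[of _ "{i}"])

text \<open>Induction on a finite set containing the support: clearing one coefficient splits off a multiple of a
  basis vector.\<close>

lemma free_induct:
  assumes f: "f \<in> carrier (free_module K S)"
    and e: "\<And>i. i \<in> S \<Longrightarrow> P (basis_vec K i)"
    and zero: "P (\<lambda>_. \<zero>)"
    and add: "\<And>f g. f \<in> carrier (free_module K S) \<Longrightarrow> g \<in> carrier (free_module K S) \<Longrightarrow>
        P f \<Longrightarrow> P g \<Longrightarrow> P (\<lambda>i. f i \<oplus> g i)"
    and smult: "\<And>c f. c \<in> carrier K \<Longrightarrow> f \<in> carrier (free_module K S) \<Longrightarrow> P f \<Longrightarrow> P (\<lambda>i. c \<otimes> f i)"
  shows "P f"
proof -
  interpret F: module K "free_module K S" by (rule free_module_module)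
  have "P f" if "finite I" "I \<subseteq> S" "f \<in> carrier (free_module K S)" "{i. f i \<noteq> \<zero>} \<subseteq> I" for I f
    using that
  proof (induction I arbitrary: f rule: finite_induct)
    case empty
    then have "f = (\<lambda>_. \<zero>)" by auto
    with zero show ?case by simp
  next
    case (insert j I)
    let ?g = "f(j := \<zero>)" and ?h = "\<lambda>i. f j \<otimes> basis_vec K j i"
    have g: "?g \<in> carrier (free_module K S)"
      using insert.prems by (auto simp: free_carrier intro: finite_subset[of _ "{i. f i \<noteq> \<zero>}"])
    have fj: "f j \<in> carrier K" using insert.prems by (auto simp: free_carrier)
    have j: "j \<in> S" using insert.prems by auto
    have h: "?h \<in> carrier (free_module K S)"
      using F.smult_closed[OF fj basis_vec_closed[OF j]] by simp
    have "P (\<lambda>i. ?g i \<oplus> ?h i)"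
    proof (rule add[OF g h])
      show "P ?g" using insert.prems by (intro insert.IH[OF _ g]) auto
      show "P ?h" using fj e[OF j] j by (intro smult) auto
    qed
    moreover have "(\<lambda>i. ?g i \<oplus> ?h i) = f"
      using insert.prems by (auto simp: fun_eq_iff basis_vec_def free_carrier)
    ultimately show ?case by simp
  qed
  with f show ?thesis by (auto simp: free_carrier)
qed

text \<open>The linear extension of \<open>g\<close> from the basis to the free module.\<close>

definition free_lift :: "('k, 'y) module \<Rightarrow> ('i \<Rightarrow> 'y) \<Rightarrow> ('i \<Rightarrow> 'k) \<Rightarrow> 'y" where
  "free_lift N g f = (\<Oplus>\<^bsub>N\<^esub>i\<in>{i. f i \<noteq> \<zero>}. f i \<odot>\<^bsub>N\<^esub> g i)"

text \<open>The supports of \<open>f\<close>, \<open>h\<close> and their sum differ. Linearity becomes a computation with finite sums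
  over a common index set.\<close>

lemma free_lift_superset:
  assumes N: "module K N" and g: "\<And>i. i \<in> S \<Longrightarrow> g i \<in> carrier N"
    and f: "f \<in> carrier (free_module K S)" and I: "finite I" "{i. f i \<noteq> \<zero>} \<subseteq> I" "I \<subseteq> S"
  shows "free_lift N g f = (\<Oplus>\<^bsub>N\<^esub>i\<in>I. f i \<odot>\<^bsub>N\<^esub> g i)"
proof -
  interpret N: module K N by fact
  have "\<forall>i\<in>I. f i \<odot>\<^bsub>N\<^esub> g i \<in> carrier N"
    using g f I by (auto simp: free_carrier)
  then show ?thesis
    unfolding free_lift_def using I g f
    by (intro N.add.finprod_mono_neutral_cong_left) (auto simp: free_carrier)
qed

lemma free_lift_lin:
  assumes N: "module K N" and g: "\<And>i. i \<in> S \<Longrightarrow> g i \<in> carrier N"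
  shows "free_lift N g \<in> lin_maps K (free_module K S) N"
proof (rule lin_mapsI)
  interpret N: module K N by fact
  interpret F: module K "free_module K S" by (rule free_module_module)
  have supp: "{i. f i \<noteq> \<zero>} \<subseteq> S" "finite {i. f i \<noteq> \<zero>}" if "f \<in> carrier (free_module K S)" for f
    using that by (auto simp: free_carrier)
  have cl: "f i \<odot>\<^bsub>N\<^esub> g i \<in> carrier N" if "f \<in> carrier (free_module K S)" "i \<in> S" for f i
    using that g by (auto simp: free_carrier)
  show "free_lift N g f \<in> carrier N" if "f \<in> carrier (free_module K S)" for f
    unfolding free_lift_def using supp[OF that] cl[OF that] by (intro N.finsum_closed) auto
  fix f assume f: "f \<in> carrier (free_module K S)"
  {
    fix h assume h: "h \<in> carrier (free_module K S)"
    let ?I = "{i. f i \<noteq> \<zero>} \<union> {i. h i \<noteq> \<zero>}"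
    have I: "finite ?I" "?I \<subseteq> S" "{i. f i \<oplus> h i \<noteq> \<zero>} \<subseteq> ?I"
      using supp[OF f] supp[OF h] f h by (auto simp: free_carrier)
    have "free_lift N g (f \<oplus>\<^bsub>free_module K S\<^esub> h) = (\<Oplus>\<^bsub>N\<^esub>i\<in>?I. (f i \<oplus> h i) \<odot>\<^bsub>N\<^esub> g i)"
      using free_lift_superset[where g=g and S=S and f="f \<oplus>\<^bsub>free_module K S\<^esub> h" and I="?I", OF N g F.a_closed[OF f h]] I
      by auto
    also have "\<dots> = (\<Oplus>\<^bsub>N\<^esub>i\<in>?I. f i \<odot>\<^bsub>N\<^esub> g i \<oplus>\<^bsub>N\<^esub> h i \<odot>\<^bsub>N\<^esub> g i)"
      using f h I g by (intro N.finsum_cong') (auto simp: free_carrier N.smult_l_distr)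
    also have "\<dots> = (\<Oplus>\<^bsub>N\<^esub>i\<in>?I. f i \<odot>\<^bsub>N\<^esub> g i) \<oplus>\<^bsub>N\<^esub> (\<Oplus>\<^bsub>N\<^esub>i\<in>?I. h i \<odot>\<^bsub>N\<^esub> g i)"
      using I cl[OF f] cl[OF h] by (intro N.finsum_addf) auto
    also have "\<dots> = free_lift N g f \<oplus>\<^bsub>N\<^esub> free_lift N g h"
      using I by (simp add: free_lift_superset[OF N g f, where I="?I"] free_lift_superset[OF N g h, where I="?I"])
    finally show "free_lift N g (f \<oplus>\<^bsub>free_module K S\<^esub> h) = free_lift N g f \<oplus>\<^bsub>N\<^esub> free_lift N g h" .
  }
  {
    fix c assume c: "c \<in> carrier K"
    let ?I = "{i. f i \<noteq> \<zero>}"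
    have "{i. c \<otimes> f i \<noteq> \<zero>} \<subseteq> ?I"
      using c by auto
    then have "free_lift N g (c \<odot>\<^bsub>free_module K S\<^esub> f) = (\<Oplus>\<^bsub>N\<^esub>i\<in>?I. (c \<otimes> f i) \<odot>\<^bsub>N\<^esub> g i)"
      using free_lift_superset[where g=g and S=S and f="c \<odot>\<^bsub>free_module K S\<^esub> f" and I="?I", OF N g F.smult_closed[OF c f]]
        supp[OF f] c
      by auto
    also have "\<dots> = (\<Oplus>\<^bsub>N\<^esub>i\<in>?I. c \<odot>\<^bsub>N\<^esub> (f i \<odot>\<^bsub>N\<^esub> g i))"
      using f c g supp[OF f] by (intro N.finsum_cong') (auto simp: free_carrier N.smult_assoc1)
    also have "\<dots> = c \<odot>\<^bsub>N\<^esub> free_lift N g f"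
      unfolding free_lift_def using supp[OF f] cl[OF f] c by (intro N.finsum_smult_ldistr[symmetric]) auto
    finally show "free_lift N g (c \<odot>\<^bsub>free_module K S\<^esub> f) = c \<odot>\<^bsub>N\<^esub> free_lift N g f" .
  }
qed

lemma free_lift_basis:
  assumes "module K N" "\<And>i. i \<in> S \<Longrightarrow> g i \<in> carrier N" "i \<in> S"
  shows "free_lift N g (basis_vec K i) = g i"
proof -
  interpret N: module K N by fact
  have "free_lift N g (basis_vec K i) = (\<Oplus>\<^bsub>N\<^esub>j\<in>{i}. basis_vec K i j \<odot>\<^bsub>N\<^esub> g j)"
    using assms basis_vec_closed[of i S]
    by (intro free_lift_superset[where S=S]) (auto simp: basis_vec_def)
  then show ?thesis using assms by (simp add: basis_vec_def N.finsum_insert)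
qed

section \<open>The universal property of the tensor product\<close>

text \<open>The slot is singled out by splitting the argument list instead of by list update, because splittings
  behave well under concatenation and exchange of argument lists.\<close>

definition multilin :: "('k, 'x) module list \<Rightarrow> ('k, 'y) module \<Rightarrow> ('x list \<Rightarrow> 'y) \<Rightarrow> bool" where
  "multilin Ms N g \<longleftrightarrow>
     (\<forall>xs\<in>tuples Ms. g xs \<in> carrier N) \<and>
     (\<forall>Us M Vs us vs. Ms = Us @ M # Vs \<longrightarrow> us \<in> tuples Us \<longrightarrow> vs \<in> tuples Vs \<longrightarrow>
        (\<lambda>x. g (us @ x # vs)) \<in> lin_maps K M N)"

lemma multilinI:
  assumes "\<And>xs. xs \<in> tuples Ms \<Longrightarrow> g xs \<in> carrier N"
    and "\<And>Us M Vs us vs. \<lbrakk>Ms = Us @ M # Vs; us \<in> tuples Us; vs \<in> tuples Vs\<rbrakk> \<Longrightarrow>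
      (\<lambda>x. g (us @ x # vs)) \<in> lin_maps K M N"
  shows "multilin Ms N g"
  using assms unfolding multilin_def by blast

lemma multilin_closed: "multilin Ms N g \<Longrightarrow> xs \<in> tuples Ms \<Longrightarrow> g xs \<in> carrier N"
  by (simp add: multilin_def)

lemma multilin_slot:
  "multilin (Us @ M # Vs) N g \<Longrightarrow> us \<in> tuples Us \<Longrightarrow> vs \<in> tuples Vs \<Longrightarrow> (\<lambda>x. g (us @ x # vs)) \<in> lin_maps K M N"
  unfolding multilin_def by blast

lemmas multilin_add = lin_maps_add[OF multilin_slot]
lemmas multilin_smult = lin_maps_smult[OF multilin_slot]

text \<open>Links the list updates in the defining relators with the splittings used for multilinearity.\<close>

lemma slot_update:
  assumes "xs \<in> tuples Ms" "i < length Ms"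
  obtains us vs where "us \<in> tuples (take i Ms)" "vs \<in> tuples (drop (Suc i) Ms)" "\<And>z. xs[i := z] = us @ z # vs"
    "Ms = take i Ms @ Ms ! i # drop (Suc i) Ms"
proof
  show "take i xs \<in> tuples (take i Ms)" "drop (Suc i) xs \<in> tuples (drop (Suc i) Ms)"
    using assms by (simp_all add: tuples_take tuples_drop)
  show "xs[i := z] = take i xs @ z # drop (Suc i) xs" for z
    using assms by (simp add: upd_conv_take_nth_drop tuples_length)
  show "Ms = take i Ms @ Ms ! i # drop (Suc i) Ms"
    using assms by (simp add: id_take_nth_drop)
qed

abbreviation FM :: "('k, 'x) module list \<Rightarrow> ('k, 'x list \<Rightarrow> 'k) module" where
  "FM Ms \<equiv> free_module K (tuples Ms)"

lemma relators_subset: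
  assumes "modules Ms"
  shows "multilinear_relators K Ms \<subseteq> carrier (FM Ms)"
proof -
  interpret F: module K "FM Ms" by (rule free_module_module)
  have M: "module K (Ms ! i)" if "i < length Ms" for i
    using assms that by (auto simp: modules_def)
  have add: "x \<oplus>\<^bsub>Ms ! i\<^esub> y \<in> carrier (Ms ! i)" if "i < length Ms" "x \<in> carrier (Ms ! i)" "y \<in> carrier (Ms ! i)" for i x y
  proof -
    interpret M: module K "Ms ! i" by (rule M) fact
    show ?thesis using that by simp
  qed
  have smult: "c \<odot>\<^bsub>Ms ! i\<^esub> x \<in> carrier (Ms ! i)" if "i < length Ms" "c \<in> carrier K" "x \<in> carrier (Ms ! i)" for i c x
  proof -
    interpret M: module K "Ms ! i" by (rule M) fact
    show ?thesis using that by simp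
  qed
  show ?thesis
    unfolding multilinear_relators_def Let_def
    by (auto simp del: free_module_simps
        intro!: F.minus_closed F.a_closed F.smult_closed basis_vec_closed tuples_update add smult)
qed

lemma relator_add:
  "xs \<in> tuples Ms \<Longrightarrow> i < length Ms \<Longrightarrow> x \<in> carrier (Ms ! i) \<Longrightarrow> y \<in> carrier (Ms ! i) \<Longrightarrow>
    basis_vec K (xs[i := x \<oplus>\<^bsub>Ms ! i\<^esub> y]) \<ominus>\<^bsub>FM Ms\<^esub>
      (basis_vec K (xs[i := x]) \<oplus>\<^bsub>FM Ms\<^esub> basis_vec K (xs[i := y])) \<in> multilinear_relators K Ms"
  unfolding multilinear_relators_def Let_def
  by (rule UnI1, rule CollectI, rule exI[of _ xs], rule exI[of _ i], rule exI[of _ x], rule exI[of _ y]) simp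

lemma relator_smult:
  "xs \<in> tuples Ms \<Longrightarrow> i < length Ms \<Longrightarrow> c \<in> carrier K \<Longrightarrow> x \<in> carrier (Ms ! i) \<Longrightarrow>
    basis_vec K (xs[i := c \<odot>\<^bsub>Ms ! i\<^esub> x]) \<ominus>\<^bsub>FM Ms\<^esub>
      c \<odot>\<^bsub>FM Ms\<^esub> basis_vec K (xs[i := x]) \<in> multilinear_relators K Ms"
  unfolding multilinear_relators_def Let_def
  by (rule UnI2, rule CollectI, rule exI[of _ xs], rule exI[of _ i], rule exI[of _ c], rule exI[of _ x]) simp

lemma tensor_null_submodule:
  assumes "modules Ms"
  shows "submodule (tensor_null K Ms) K (FM Ms)"
proof -
  interpret F: module K "FM Ms" by (rule free_module_module)
  note E = F.submoduleE
  have c: "submodule (carrier (FM Ms)) K (FM Ms)"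
    by (rule F.carrier_is_submodule)
  have z: "\<zero>\<^bsub>FM Ms\<^esub> \<in> H" if "submodule H K (FM Ms)" for H
    using subgroup.one_closed[OF submodule.axioms(1)[OF that]] by simp
  show ?thesis
    unfolding tensor_null_def
  proof (rule F.submoduleI)
    show "\<Inter>{H. submodule H K (FM Ms) \<and> multilinear_relators K Ms \<subseteq> H}
        \<subseteq> carrier (FM Ms)"
      using c relators_subset[OF assms] by blast
    show "\<zero>\<^bsub>FM Ms\<^esub> \<in> \<Inter>{H. submodule H K (FM Ms) \<and> multilinear_relators K Ms \<subseteq> H}"
      using z by blast
  qed (simp_all add: E del: free_module_simps)
qed

lemma relators_null: "multilinear_relators K Ms \<subseteq> tensor_null K Ms"
  by (auto simp: tensor_null_def)

lemma tensor_null_least: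
  "submodule H K (FM Ms) \<Longrightarrow> multilinear_relators K Ms \<subseteq> H \<Longrightarrow> tensor_null K Ms \<subseteq> H"
  by (auto simp: tensor_null_def)

abbreviation coset :: "('k, 'x) module list \<Rightarrow> ('x list \<Rightarrow> 'k) \<Rightarrow> ('x, 'k) tens" where
  "coset Ms f \<equiv> tensor_null K Ms +>\<^bsub>FM Ms\<^esub> f"

lemma tensor_null_subgroup:
  assumes "modules Ms"
  shows "abelian_subgroup (tensor_null K Ms) (FM Ms)"
proof -
  interpret F: module K "FM Ms" by (rule free_module_module)
  show ?thesis
    using submodule.axioms(1)[OF tensor_null_submodule[OF assms]]
    by (intro abelian_subgroupI3 additive_subgroupI F.abelian_group_axioms)
qed

lemma coset_eq_iff:
  assumes "modules Ms" "f \<in> carrier (FM Ms)" "g \<in> carrier (FM Ms)"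
  shows "coset Ms f = coset Ms g \<longleftrightarrow> f \<ominus>\<^bsub>FM Ms\<^esub> g \<in> tensor_null K Ms"
proof -
  interpret N: abelian_subgroup "tensor_null K Ms" "FM Ms"
    by (rule tensor_null_subgroup[OF assms(1)])
  have "coset Ms f = coset Ms g \<longleftrightarrow> f \<in> coset Ms g"
    using N.a_rcos_self[OF assms(2)] N.a_repr_independence'[of f, OF _ assms(3)] by auto
  also have "\<dots> \<longleftrightarrow> f \<oplus>\<^bsub>FM Ms\<^esub> (\<ominus>\<^bsub>FM Ms\<^esub> g) \<in> tensor_null K Ms"
    by (rule N.a_rcos_module[OF assms(3,2)])
  finally show ?thesis unfolding a_minus_def .
qed

lemma carrier_tensor:
  "t \<in> carrier (tensor K Ms) \<longleftrightarrow> (\<exists>f\<in>carrier (FM Ms). t = coset Ms f)"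
  unfolding tensor_def Let_def A_RCOSETS_def RCOSETS_def a_r_coset_def by simp

lemma coset_closed [simp]: "f \<in> carrier (FM Ms) \<Longrightarrow> coset Ms f \<in> carrier (tensor K Ms)"
  by (auto simp: carrier_tensor)

lemma coset_add:
  assumes "modules Ms" "f \<in> carrier (FM Ms)" "g \<in> carrier (FM Ms)"
  shows "coset Ms f \<oplus>\<^bsub>tensor K Ms\<^esub> coset Ms g = coset Ms (f \<oplus>\<^bsub>FM Ms\<^esub> g)"
proof -
  interpret N: abelian_subgroup "tensor_null K Ms" "FM Ms"
    by (rule tensor_null_subgroup[OF assms(1)])
  show ?thesis using N.a_rcos_sum[OF assms(2,3)] by (simp add: tensor_def Let_def)
qed

text \<open>The union that defines scalar multiplication runs over representatives of one coset. They all give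
  the same coset, since the null submodule is closed under scalars.\<close>

lemma coset_smult:
  assumes "modules Ms" "c \<in> carrier K" "f \<in> carrier (FM Ms)"
  shows "c \<odot>\<^bsub>tensor K Ms\<^esub> coset Ms f = coset Ms (c \<odot>\<^bsub>FM Ms\<^esub> f)"
proof -
  let ?F = "FM Ms"
  interpret F: module K ?F by (rule free_module_module)
  interpret N: abelian_subgroup "tensor_null K Ms" ?F
    by (rule tensor_null_subgroup[OF assms(1)])
  have eq: "coset Ms (c \<odot>\<^bsub>?F\<^esub> g) = coset Ms (c \<odot>\<^bsub>?F\<^esub> f)" if "g \<in> coset Ms f" for g
  proof -
    have g: "g \<in> carrier ?F"
      using N.a_elemrcos_carrier[OF assms(3) that] .
    have "g \<ominus>\<^bsub>?F\<^esub> f \<in> tensor_null K Ms"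
      by (rule iffD1[OF coset_eq_iff[OF assms(1) g assms(3)] N.a_repr_independence'[OF that assms(3), symmetric]])
    then have "c \<odot>\<^bsub>?F\<^esub> (g \<ominus>\<^bsub>?F\<^esub> f) \<in> tensor_null K Ms"
      using F.submoduleE(4)[OF tensor_null_submodule[OF assms(1)]] assms(2) by blast
    moreover have "c \<odot>\<^bsub>?F\<^esub> (g \<ominus>\<^bsub>?F\<^esub> f) = c \<odot>\<^bsub>?F\<^esub> g \<ominus>\<^bsub>?F\<^esub> c \<odot>\<^bsub>?F\<^esub> f"
      unfolding a_minus_def F.smult_r_distr[OF assms(2) g F.a_inv_closed[OF assms(3)]]
      by (simp only: F.smult_r_minus[OF assms(2,3)])
    ultimately have "c \<odot>\<^bsub>?F\<^esub> g \<ominus>\<^bsub>?F\<^esub> c \<odot>\<^bsub>?F\<^esub> f \<in> tensor_null K Ms" by (simp only:)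
    then show ?thesis
      by (rule iffD2[OF coset_eq_iff[OF assms(1) F.smult_closed[OF assms(2) g] F.smult_closed[OF assms(2,3)]]])
  qed
  have ne: "coset Ms f \<noteq> {}" using N.a_rcos_self[OF assms(3)] by blast
  have "(\<Union>g\<in>coset Ms f. coset Ms (c \<odot>\<^bsub>?F\<^esub> g)) = coset Ms (c \<odot>\<^bsub>?F\<^esub> f)"
    by (rule SUP_eq_const[OF ne eq])
  then show ?thesis
    unfolding tensor_def Let_def by (simp only: module.select_convs)
qed

lemma tensor_zero: "modules Ms \<Longrightarrow> \<zero>\<^bsub>tensor K Ms\<^esub> = coset Ms \<zero>\<^bsub>FM Ms\<^esub>"
proof -
  assume "modules Ms"
  then interpret N: abelian_subgroup "tensor_null K Ms" "FM Ms"
    by (rule tensor_null_subgroup)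
  show ?thesis
    using N.a_coset_add_zero[OF N.a_subset] by (simp add: tensor_def Let_def del: free_module_simps)
qed

lemma tensor_module:
  assumes Ms: "modules Ms"
  shows "module K (tensor K Ms)"
proof -
  let ?F = "FM Ms"
  interpret F: module K ?F by (rule free_module_module)
  note [simp] = coset_add[OF Ms] coset_smult[OF Ms] tensor_zero[OF Ms]
  note [simp del] = free_module_simps
  show ?thesis
  proof (rule moduleI)
    show "cring K" by (rule K.is_cring)
    show "abelian_group (tensor K Ms)"
    proof (rule abelian_groupI)
      fix t assume "t \<in> carrier (tensor K Ms)"
      then obtain f where f: "f \<in> carrier ?F" "t = coset Ms f" by (auto simp: carrier_tensor)
      show "\<exists>s\<in>carrier (tensor K Ms). s \<oplus>\<^bsub>tensor K Ms\<^esub> t = \<zero>\<^bsub>tensor K Ms\<^esub>"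
        by (rule bexI[of _ "coset Ms (\<ominus>\<^bsub>?F\<^esub> f)"]) (use f in \<open>auto simp: F.l_neg\<close>)
    qed (auto simp: carrier_tensor F.a_ac intro!: bexI)
  qed (auto simp: carrier_tensor F.smult_l_distr F.smult_r_distr F.smult_assoc1 intro!: bexI)
qed

lemma pure_closed [simp]: "xs \<in> tuples Ms \<Longrightarrow> pure K Ms xs \<in> carrier (tensor K Ms)"
  by (simp add: pure_def)

text \<open>Pure tensors are the cosets of basis vectors, so they generate the quotient.\<close>

lemma tensor_induct [consumes 2, case_names pure add smult zero]:
  assumes Ms: "modules Ms" and t: "t \<in> carrier (tensor K Ms)"
    and pure: "\<And>xs. xs \<in> tuples Ms \<Longrightarrow> P (pure K Ms xs)"
    and add: "\<And>s t. s \<in> carrier (tensor K Ms) \<Longrightarrow> t \<in> carrier (tensor K Ms) \<Longrightarrow> P s \<Longrightarrow> P t \<Longrightarrow> P (s \<oplus>\<^bsub>tensor K Ms\<^esub> t)"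
    and smult: "\<And>c t. c \<in> carrier K \<Longrightarrow> t \<in> carrier (tensor K Ms) \<Longrightarrow> P t \<Longrightarrow> P (c \<odot>\<^bsub>tensor K Ms\<^esub> t)"
    and zero: "P \<zero>\<^bsub>tensor K Ms\<^esub>"
  shows "P t"
proof -
  obtain f where f: "f \<in> carrier (FM Ms)" "t = coset Ms f"
    using t by (auto simp: carrier_tensor)
  from f(1) have "P (coset Ms f)"
  proof (rule free_induct)
    show "P (coset Ms (basis_vec K xs))" if "xs \<in> tuples Ms" for xs
      using pure[OF that] by (simp add: pure_def)
    show "P (coset Ms (\<lambda>_. \<zero>))" using zero by (simp add: tensor_zero[OF Ms])
    show "P (coset Ms (\<lambda>i. f i \<oplus> g i))" if "f \<in> carrier (FM Ms)"
      "g \<in> carrier (FM Ms)" "P (coset Ms f)" "P (coset Ms g)" for f g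
      using add[OF coset_closed[OF that(1)] coset_closed[OF that(2)] that(3,4)] coset_add[OF Ms that(1,2)] by simp
    show "P (coset Ms (\<lambda>i. c \<otimes> f i))" if "c \<in> carrier K" "f \<in> carrier (FM Ms)"
      "P (coset Ms f)" for c f
      using smult[OF that(1) coset_closed[OF that(2)] that(3)] coset_smult[OF Ms that(1,2)] by simp
  qed
  with f show ?thesis by simp
qed

lemma lin_maps_zero:
  assumes "f \<in> lin_maps K M N" "module K M" "module K N" shows "f \<zero>\<^bsub>M\<^esub> = \<zero>\<^bsub>N\<^esub>"
proof -
  interpret abelian_group_hom M N f using lin_maps_hom[OF assms] .
  show ?thesis by simp
qed

lemma lin_maps_eqI:
  assumes Ms: "modules Ms" and N: "module K N"
    and f: "f \<in> lin_maps K (tensor K Ms) N" and g: "g \<in> lin_maps K (tensor K Ms) N"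
    and eq: "\<And>xs. xs \<in> tuples Ms \<Longrightarrow> f (pure K Ms xs) = g (pure K Ms xs)"
    and t: "t \<in> carrier (tensor K Ms)"
  shows "f t = g t"
  using Ms t
proof (induction rule: tensor_induct)
  case zero
  then show ?case using lin_maps_zero[OF f tensor_module[OF Ms] N] lin_maps_zero[OF g tensor_module[OF Ms] N] by simp
qed (use eq f g in \<open>simp_all add: lin_maps_add lin_maps_smult\<close>)

text \<open>Multilinearity is what the relators impose.\<close>

lemma pure_multilin:
  assumes Ms: "modules Ms"
  shows "multilin Ms (tensor K Ms) (pure K Ms)"
proof (rule multilinI)
  let ?F = "FM Ms"
  interpret F: module K ?F by (rule free_module_module)
  fix Us M Vs us vs
  assume *: "Ms = Us @ M # Vs" "us \<in> tuples Us" "vs \<in> tuples Vs"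
  then interpret M: module K M using Ms by simp
  have t: "us @ z # vs \<in> tuples Ms" if "z \<in> carrier M" for z using * that by simp
  show "(\<lambda>x. pure K Ms (us @ x # vs)) \<in> lin_maps K M (tensor K Ms)"
  proof (rule lin_mapsI)
    show "pure K Ms (us @ x # vs) \<in> carrier (tensor K Ms)" if "x \<in> carrier M" for x using t[OF that] by simp
  next
    fix x y assume xy: "x \<in> carrier M" "y \<in> carrier M"
    let ?xs = "us @ x # vs" and ?i = "length us"
    have upd: "?xs[?i := z] = us @ z # vs" for z by simp
    have "basis_vec K (?xs[?i := x \<oplus>\<^bsub>Ms ! ?i\<^esub> y]) \<ominus>\<^bsub>?F\<^esub> (basis_vec K (?xs[?i := x]) \<oplus>\<^bsub>?F\<^esub> basis_vec K (?xs[?i := y]))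
        \<in> multilinear_relators K Ms"
      using * xy t[of x] tuples_length[OF *(2)] by (intro relator_add) (auto simp: nth_append)
    then have "basis_vec K (us @ (x \<oplus>\<^bsub>M\<^esub> y) # vs) \<ominus>\<^bsub>?F\<^esub> (basis_vec K (us @ x # vs) \<oplus>\<^bsub>?F\<^esub> basis_vec K (us @ y # vs)) \<in> tensor_null K Ms"
      unfolding upd using relators_null[of Ms] tuples_length[OF *(2)] *(1) by (auto simp: nth_append)
    then have "pure K Ms (us @ (x \<oplus>\<^bsub>M\<^esub> y) # vs) = coset Ms (basis_vec K (us @ x # vs) \<oplus>\<^bsub>?F\<^esub> basis_vec K (us @ y # vs))"
      unfolding pure_def
      by (subst coset_eq_iff[OF Ms]) (intro F.a_closed F.smult_closed basis_vec_closed t M.a_closed M.smult_closed xy, assumption?)+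
    also have "\<dots> = pure K Ms (us @ x # vs) \<oplus>\<^bsub>tensor K Ms\<^esub> pure K Ms (us @ y # vs)"
      unfolding pure_def using xy t by (subst coset_add[OF Ms]) auto
    finally show "pure K Ms (us @ (x \<oplus>\<^bsub>M\<^esub> y) # vs) = pure K Ms (us @ x # vs) \<oplus>\<^bsub>tensor K Ms\<^esub> pure K Ms (us @ y # vs)" .
  next
    fix c x assume xy: "c \<in> carrier K" "x \<in> carrier M"
    let ?xs = "us @ x # vs" and ?i = "length us"
    have upd: "?xs[?i := z] = us @ z # vs" for z by simp
    have "basis_vec K (?xs[?i := c \<odot>\<^bsub>Ms ! ?i\<^esub> x]) \<ominus>\<^bsub>?F\<^esub> c \<odot>\<^bsub>?F\<^esub> basis_vec K (?xs[?i := x])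
        \<in> multilinear_relators K Ms"
      using * xy t[of x] tuples_length[OF *(2)] by (intro relator_smult) (auto simp: nth_append)
    then have "basis_vec K (us @ (c \<odot>\<^bsub>M\<^esub> x) # vs) \<ominus>\<^bsub>?F\<^esub> c \<odot>\<^bsub>?F\<^esub> basis_vec K (us @ x # vs) \<in> tensor_null K Ms"
      unfolding upd using relators_null[of Ms] tuples_length[OF *(2)] *(1) by (auto simp: nth_append)
    then have "pure K Ms (us @ (c \<odot>\<^bsub>M\<^esub> x) # vs) = coset Ms (c \<odot>\<^bsub>?F\<^esub> basis_vec K (us @ x # vs))"
      unfolding pure_def
      by (subst coset_eq_iff[OF Ms]) (intro F.a_closed F.smult_closed basis_vec_closed t M.a_closed M.smult_closed xy, assumption?)+
    also have "\<dots> = c \<odot>\<^bsub>tensor K Ms\<^esub> pure K Ms (us @ x # vs)"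
      unfolding pure_def using xy t by (subst coset_smult[OF Ms]) auto
    finally show "pure K Ms (us @ (c \<odot>\<^bsub>M\<^esub> x) # vs) = c \<odot>\<^bsub>tensor K Ms\<^esub> pure K Ms (us @ x # vs)" .
  qed
qed simp

text \<open>The linear extension of a multilinear map to the free module kills the relators, hence the submodule
  they generate, and so it is constant on cosets.\<close>

lemma ex_tensor_lift:
  assumes Ms: "modules Ms" and N: "module K N" and g: "multilin Ms N g"
  obtains F where "F \<in> lin_maps K (tensor K Ms) N" "\<And>xs. xs \<in> tuples Ms \<Longrightarrow> F (pure K Ms xs) = g xs"
proof -
  let ?F = "FM Ms" and ?L = "free_lift N g"
  interpret F: module K ?F by (rule free_module_module)
  interpret N: module K N by fact
  have gc: "\<And>xs. xs \<in> tuples Ms \<Longrightarrow> g xs \<in> carrier N" using multilin_closed[OF g] .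
  have L: "?L \<in> lin_maps K ?F N" by (rule free_lift_lin[OF N gc])
  have Lb: "?L (basis_vec K xs) = g xs" if "xs \<in> tuples Ms" for xs
    using free_lift_basis[OF N gc that] .
  interpret L: abelian_group_hom ?F N ?L
    using lin_maps_hom[OF L free_module_module N] .
  have Lm: "?L (f \<ominus>\<^bsub>?F\<^esub> h) = ?L f \<ominus>\<^bsub>N\<^esub> ?L h" if "f \<in> carrier ?F" "h \<in> carrier ?F" for f h
    unfolding a_minus_def using that by (simp only: L.hom_add L.hom_a_inv F.a_inv_closed)
  define H where "H = {f \<in> carrier ?F. ?L f = \<zero>\<^bsub>N\<^esub>}"
  have "submodule H K ?F"
  proof (rule F.submoduleI)
    show "\<zero>\<^bsub>?F\<^esub> \<in> H" using L.hom_zero F.zero_closed by (simp only: H_def mem_Collect_eq)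
    show "\<ominus>\<^bsub>?F\<^esub> f \<in> H" if "f \<in> H" for f
      using that by (simp add: H_def del: free_module_simps)
    show "f \<oplus>\<^bsub>?F\<^esub> h \<in> H" if "f \<in> H" "h \<in> H" for f h
      using that by (simp only: H_def mem_Collect_eq L.hom_add F.a_closed N.l_zero N.zero_closed)
    show "c \<odot>\<^bsub>?F\<^esub> f \<in> H" if "c \<in> carrier K" "f \<in> H" for c f
      using that by (simp only: H_def mem_Collect_eq lin_maps_smult[OF L] F.smult_closed N.smult_r_null)
  qed (auto simp: H_def)
  moreover have "multilinear_relators K Ms \<subseteq> H"
  proof
    fix r assume r: "r \<in> multilinear_relators K Ms"
    then have rF: "r \<in> carrier ?F" using relators_subset[OF Ms] by blast
    have mod: "module K (Ms ! i)" if "i < length Ms" for i using Ms that by (auto simp: modules_def)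
    from r consider (add) xs i x y where "xs \<in> tuples Ms" "i < length Ms" "x \<in> carrier (Ms ! i)" "y \<in> carrier (Ms ! i)"
        "r = basis_vec K (xs[i := x \<oplus>\<^bsub>Ms ! i\<^esub> y]) \<ominus>\<^bsub>?F\<^esub> (basis_vec K (xs[i := x]) \<oplus>\<^bsub>?F\<^esub> basis_vec K (xs[i := y]))"
      | (smult) xs i c x where "xs \<in> tuples Ms" "i < length Ms" "c \<in> carrier K" "x \<in> carrier (Ms ! i)"
        "r = basis_vec K (xs[i := c \<odot>\<^bsub>Ms ! i\<^esub> x]) \<ominus>\<^bsub>?F\<^esub> c \<odot>\<^bsub>?F\<^esub> basis_vec K (xs[i := x])"
      unfolding multilinear_relators_def Let_def by blast
    then have "?L r = \<zero>\<^bsub>N\<^esub>"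
    proof cases
      case add
      interpret M: module K "Ms ! i" using mod add by simp
      have t: "xs[i := z] \<in> tuples Ms" if "z \<in> carrier (Ms ! i)" for z
        using tuples_update[OF add(1,2) that] .
      obtain us vs where uv: "us \<in> tuples (take i Ms)" "vs \<in> tuples (drop (Suc i) Ms)" "\<And>z. xs[i := z] = us @ z # vs"
        "Ms = take i Ms @ Ms ! i # drop (Suc i) Ms"
        using slot_update[OF add(1,2)] by metis
      have "multilin (take i Ms @ Ms ! i # drop (Suc i) Ms) N g" using g uv(4) by simp
      from multilin_add[OF this uv(1,2) add(3,4)]
      have "g (xs[i := x \<oplus>\<^bsub>Ms ! i\<^esub> y]) = g (xs[i := x]) \<oplus>\<^bsub>N\<^esub> g (xs[i := y])" by (simp only: uv(3))
      moreover have "?L r = g (xs[i := x \<oplus>\<^bsub>Ms ! i\<^esub> y]) \<ominus>\<^bsub>N\<^esub> (g (xs[i := x]) \<oplus>\<^bsub>N\<^esub> g (xs[i := y]))"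
        unfolding add(5) by (subst Lm) (simp_all only: F.a_closed basis_vec_closed t M.a_closed add(3,4) L.hom_add Lb)
      ultimately show ?thesis
        using gc[OF t[OF add(3)]] gc[OF t[OF add(4)]] by (simp add: a_minus_def N.r_neg)
    next
      case smult
      interpret M: module K "Ms ! i" using mod smult by simp
      have t: "xs[i := z] \<in> tuples Ms" if "z \<in> carrier (Ms ! i)" for z
        using tuples_update[OF smult(1,2) that] .
      obtain us vs where uv: "us \<in> tuples (take i Ms)" "vs \<in> tuples (drop (Suc i) Ms)" "\<And>z. xs[i := z] = us @ z # vs"
        "Ms = take i Ms @ Ms ! i # drop (Suc i) Ms"
        using slot_update[OF smult(1,2)] by metis
      have "multilin (take i Ms @ Ms ! i # drop (Suc i) Ms) N g" using g uv(4) by simp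
      from multilin_smult[OF this uv(1,2) smult(3,4)]
      have "g (xs[i := c \<odot>\<^bsub>Ms ! i\<^esub> x]) = c \<odot>\<^bsub>N\<^esub> g (xs[i := x])" by (simp only: uv(3))
      moreover have "?L r = g (xs[i := c \<odot>\<^bsub>Ms ! i\<^esub> x]) \<ominus>\<^bsub>N\<^esub> c \<odot>\<^bsub>N\<^esub> g (xs[i := x])"
        unfolding smult(5)
        by (subst Lm) (simp_all only: F.smult_closed basis_vec_closed t M.smult_closed smult(3,4) lin_maps_smult[OF L] Lb)
      ultimately show ?thesis
        using gc[OF t[OF smult(4)]] smult(3) by (simp add: a_minus_def N.r_neg)
    qed
    with rF show "r \<in> H" by (simp add: H_def)
  qed
  ultimately have null: "tensor_null K Ms \<subseteq> H" by (rule tensor_null_least)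
  have wd: "?L f = ?L h" if "f \<in> carrier ?F" "h \<in> carrier ?F" "coset Ms f = coset Ms h" for f h
  proof -
    have "?L f \<ominus>\<^bsub>N\<^esub> ?L h = \<zero>\<^bsub>N\<^esub>"
      using null that coset_eq_iff[OF Ms that(1,2)] Lm[OF that(1,2)] by (auto simp: H_def)
    then show ?thesis using that by (metis N.minus_equality N.add.inv_closed N.add.inv_inv L.hom_closed a_minus_def)
  qed
  define G where "G t = ?L (SOME f. f \<in> carrier ?F \<and> t = coset Ms f)" for t
  have G: "G (coset Ms f) = ?L f" if "f \<in> carrier ?F" for f
  proof -
    let ?h = "SOME h. h \<in> carrier ?F \<and> coset Ms f = coset Ms h"
    have "\<exists>h. h \<in> carrier ?F \<and> coset Ms f = coset Ms h" using that by blast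
    then have h: "?h \<in> carrier ?F \<and> coset Ms f = coset Ms ?h" by (rule someI_ex)
    show ?thesis unfolding G_def by (rule wd[OF that conjunct1[OF h] conjunct2[OF h], symmetric])
  qed
  have "G \<in> lin_maps K (tensor K Ms) N"
  proof (rule lin_mapsI)
    fix t assume t: "t \<in> carrier (tensor K Ms)"
    then obtain f where f: "f \<in> carrier ?F" "t = coset Ms f" by (auto simp: carrier_tensor)
    show "G t \<in> carrier N" using f G lin_maps_closed[OF L] by simp
    show "G (c \<odot>\<^bsub>tensor K Ms\<^esub> t) = c \<odot>\<^bsub>N\<^esub> G t" if "c \<in> carrier K" for c
      using f G that F.smult_closed lin_maps_smult[OF L] coset_smult[OF Ms] by simp
    fix s assume "s \<in> carrier (tensor K Ms)"
    then obtain h where h: "h \<in> carrier ?F" "s = coset Ms h" by (auto simp: carrier_tensor)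
    show "G (t \<oplus>\<^bsub>tensor K Ms\<^esub> s) = G t \<oplus>\<^bsub>N\<^esub> G s"
      using f h G F.a_closed lin_maps_add[OF L] coset_add[OF Ms] by simp
  qed
  moreover have "G (pure K Ms xs) = g xs" if "xs \<in> tuples Ms" for xs
    unfolding pure_def using that G Lb by simp
  ultimately show thesis using that by blast
qed

text \<open>Existence is the factorisation above. Uniqueness holds since pure tensors generate, and since the
  value outside the carrier is prescribed.\<close>

lemma tlift_spec:
  assumes Ms: "modules Ms" and N: "module K N" and g: "multilin Ms N g"
  shows "tlift K Ms N g \<in> lin_maps K (tensor K Ms) N \<and> tlift K Ms N g \<in> extensional (carrier (tensor K Ms)) \<and>
    (\<forall>xs\<in>tuples Ms. tlift K Ms N g (pure K Ms xs) = g xs)"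
proof -
  interpret T: module K "tensor K Ms" by (rule tensor_module[OF Ms])
  obtain F where F: "F \<in> lin_maps K (tensor K Ms) N" "\<And>xs. xs \<in> tuples Ms \<Longrightarrow> F (pure K Ms xs) = g xs"
    using ex_tensor_lift[OF assms] by metis
  have "\<exists>!F. F \<in> lin_maps K (tensor K Ms) N \<and> F \<in> extensional (carrier (tensor K Ms)) \<and>
      (\<forall>xs\<in>tuples Ms. F (pure K Ms xs) = g xs)"
  proof (rule ex1I[of _ "restrict F (carrier (tensor K Ms))"])
    show "restrict F (carrier (tensor K Ms)) \<in> lin_maps K (tensor K Ms) N \<and>
      restrict F (carrier (tensor K Ms)) \<in> extensional (carrier (tensor K Ms)) \<and>
      (\<forall>xs\<in>tuples Ms. restrict F (carrier (tensor K Ms)) (pure K Ms xs) = g xs)"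
      using F by (auto intro: lin_maps_cong[OF F(1) tensor_module[OF Ms]])
    fix G assume G: "G \<in> lin_maps K (tensor K Ms) N \<and> G \<in> extensional (carrier (tensor K Ms)) \<and>
      (\<forall>xs\<in>tuples Ms. G (pure K Ms xs) = g xs)"
    then have "G t = F t" if "t \<in> carrier (tensor K Ms)" for t
      using lin_maps_eqI[OF Ms N _ F(1) _ that, of G] F(2) by simp
    with G show "G = restrict F (carrier (tensor K Ms))"
      by (intro extensionalityI[of G "carrier (tensor K Ms)"]) auto
  qed
  from theI'[OF this] show ?thesis unfolding tlift_def .
qed

lemmas tlift_lin = tlift_spec[THEN conjunct1]

lemma tlift_pure:
  "modules Ms \<Longrightarrow> module K N \<Longrightarrow> multilin Ms N g \<Longrightarrow> xs \<in> tuples Ms \<Longrightarrow> tlift K Ms N g (pure K Ms xs) = g xs"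
  using tlift_spec by blast

lemma tlift_unique:
  assumes "modules Ms" "module K N" "F \<in> lin_maps K (tensor K Ms) N"
    and "\<And>xs. xs \<in> tuples Ms \<Longrightarrow> F (pure K Ms xs) = g xs" "multilin Ms N g" "t \<in> carrier (tensor K Ms)"
  shows "tlift K Ms N g t = F t"
  by (rule lin_maps_eqI[OF assms(1,2) tlift_lin[OF assms(1,2,5)] assms(3) _ assms(6)])
    (simp add: tlift_pure assms)

section \<open>Multilinear maps and the concatenation of tensors\<close>

abbreviation T :: "('k, 'x) module list \<Rightarrow> ('k, ('x, 'k) tens) module" where
  "T \<equiv> tensor K"

abbreviation C :: "('k, 'x) module list \<Rightarrow> ('x, 'k) tens set" where
  "C Ms \<equiv> carrier (tensor K Ms)"

abbreviation Hom :: "('k, 'x) module list \<Rightarrow> ('k, 'y) module list \<Rightarrow> (('x, 'k) tens \<Rightarrow> ('y, 'k) tens) set" where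
  "Hom Ms Ns \<equiv> lin_maps K (tensor K Ms) (tensor K Ns)"

lemma lin_maps_plus:
  assumes "module K N" "f \<in> lin_maps K M N" "g \<in> lin_maps K M N"
  shows "(\<lambda>x. f x \<oplus>\<^bsub>N\<^esub> g x) \<in> lin_maps K M N"
proof -
  interpret N: module K N by fact
  show ?thesis
    using assms(2,3) by (intro lin_mapsI)
      (auto simp: lin_maps_add lin_maps_smult lin_maps_closed N.a_ac N.smult_r_distr)
qed

lemma lin_maps_scale:
  assumes "module K N" "f \<in> lin_maps K M N" "c \<in> carrier K"
  shows "(\<lambda>x. c \<odot>\<^bsub>N\<^esub> f x) \<in> lin_maps K M N"
proof -
  interpret N: module K N by fact
  show ?thesis
    using assms(2,3) by (intro lin_mapsI)
      (auto simp: lin_maps_add lin_maps_smult lin_maps_closed N.smult_r_distr K.m_comm simp flip: N.smult_assoc1)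
qed

lemma lin_maps_const_zero:
  assumes "module K N" shows "(\<lambda>x. \<zero>\<^bsub>N\<^esub>) \<in> lin_maps K M N"
proof -
  interpret N: module K N by fact
  show ?thesis by (intro lin_mapsI) auto
qed

lemma multilin_comp:
  assumes g: "multilin Ms N g" and f: "f \<in> lin_maps K N P"
  shows "multilin Ms P (\<lambda>xs. f (g xs))"
  by (rule multilinI)
    (use multilin_closed[OF g] lin_maps_closed[OF f] lin_maps_comp[OF multilin_slot f] g in auto)

lemma multilin_cong:
  assumes Ms: "modules Ms" and g: "multilin Ms N g" and eq: "\<And>xs. xs \<in> tuples Ms \<Longrightarrow> h xs = g xs"
  shows "multilin Ms N h"
proof (rule multilinI)
  fix Us M Vs us vs
  assume *: "Ms = Us @ M # Vs" "us \<in> tuples Us" "vs \<in> tuples Vs"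
  show "(\<lambda>x. h (us @ x # vs)) \<in> lin_maps K M N"
    by (rule lin_maps_cong[OF multilin_slot[OF g[unfolded *(1)] *(2,3)]]) (use * Ms eq in simp_all)
qed (use assms multilin_closed in auto)

lemma multilin_single: "f \<in> lin_maps K M N \<Longrightarrow> multilin [M] N (\<lambda>xs. f (hd xs))"
  by (rule multilinI) (auto simp: tuples_Cons lin_maps_closed Cons_eq_append_conv)

text \<open>This makes \<open>s \<otimes> _\<close> well defined when \<open>s\<close> is a pure tensor.\<close>

lemma multilin_fix_prefix:
  assumes g: "multilin (Us @ Ms) N g" and us: "us \<in> tuples Us"
  shows "multilin Ms N (\<lambda>xs. g (us @ xs))"
proof (rule multilinI)
  fix Us' M Vs us' vs
  assume *: "Ms = Us' @ M # Vs" "us' \<in> tuples Us'" "vs \<in> tuples Vs"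
  show "(\<lambda>x. g (us @ us' @ x # vs)) \<in> lin_maps K M N"
    using multilin_slot[of "Us @ Us'" M Vs N g "us @ us'" vs] g us * by simp
qed (auto intro: multilin_closed[OF g] us)

lemma append_eq_slot:
  assumes "Ms @ Ns = Us @ M # Vs"
  obtains (left) Vs' where "Ms = Us @ M # Vs'" "Vs = Vs' @ Ns"
    | (right) Us' where "Us = Ms @ Us'" "Ns = Us' @ M # Vs"
  using assms by (auto simp: append_eq_append_conv2 append_eq_Cons_conv)

lemma multilin_swap:
  assumes g: "multilin (Ms @ Ns) P g"
  shows "multilin (Ns @ Ms) P (\<lambda>xs. g (drop (length Ns) xs @ take (length Ns) xs))"
proof (rule multilinI)
  fix xs assume "xs \<in> tuples (Ns @ Ms)"
  then show "g (drop (length Ns) xs @ take (length Ns) xs) \<in> carrier P"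
    by (auto simp: tuples_append tuples_length intro!: multilin_closed[OF g])
next
  fix Us M Vs us vs
  assume *: "Ns @ Ms = Us @ M # Vs" "us \<in> tuples Us" "vs \<in> tuples Vs"
  let ?h = "\<lambda>xs. g (drop (length Ns) xs @ take (length Ns) xs)"
  from *(1) show "(\<lambda>x. ?h (us @ x # vs)) \<in> lin_maps K M P"
  proof (cases rule: append_eq_slot)
    case (left Vs')
    then obtain vs' ms where v: "vs = vs' @ ms" "vs' \<in> tuples Vs'" "ms \<in> tuples Ms" using * by (auto simp: tuples_append)
    have "?h (us @ z # vs) = g ((ms @ us) @ z # vs')" for z
      using left v * by (simp add: tuples_length)
    then show ?thesis
      using multilin_slot[of "Ms @ Us" M Vs' P g "ms @ us" vs'] g left v * by simp
  next
    case (right Us')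
    then obtain ns us' where v: "us = ns @ us'" "ns \<in> tuples Ns" "us' \<in> tuples Us'" using * by (auto simp: tuples_append)
    have "?h (us @ z # vs) = g (us' @ z # (vs @ ns))" for z
      using right v * by (simp add: tuples_length)
    then show ?thesis
      using multilin_slot[of Us' M "Vs @ Ns" P g us' "vs @ ns"] g right v * by simp
  qed
qed

text \<open>The multilinearity that \<^const>\<open>tmap\<close> presupposes is inherited from a linear map with the same values
  on pure tensors.\<close>

lemma tmap_eqI:
  assumes Ms: "modules Ms" and Ns: "modules Ns" and F: "F \<in> Hom Ms Ns"
    and eq: "\<And>xs. xs \<in> tuples Ms \<Longrightarrow> F (pure K Ms xs) = pure K Ns (h xs)"
    and t: "t \<in> C Ms"
  shows "tmap K Ms Ns h t = F t"
  unfolding tmap_def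
proof (rule tlift_unique[OF Ms tensor_module[OF Ns] F eq _ t])
  show "multilin Ms (T Ns) (\<lambda>xs. pure K Ns (h xs))"
    using multilin_cong[OF Ms multilin_comp[OF pure_multilin[OF Ms] F]] eq by simp
qed

lemma tmap_spec:
  assumes Ms: "modules Ms" and Ns: "modules Ns" and F: "F \<in> Hom Ms Ns"
    and eq: "\<And>xs. xs \<in> tuples Ms \<Longrightarrow> F (pure K Ms xs) = pure K Ns (h xs)"
  shows "tmap K Ms Ns h \<in> Hom Ms Ns" "xs \<in> tuples Ms \<Longrightarrow> tmap K Ms Ns h (pure K Ms xs) = pure K Ns (h xs)"
  using lin_maps_cong[OF F tensor_module[OF Ms] tmap_eqI[OF Ms Ns F eq]] tmap_eqI[OF Ms Ns F eq] eq
  by simp_all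

lemma tmap_lin:
  "modules Ms \<Longrightarrow> modules Ns \<Longrightarrow> multilin Ms (T Ns) (\<lambda>xs. pure K Ns (h xs)) \<Longrightarrow> tmap K Ms Ns h \<in> Hom Ms Ns"
  unfolding tmap_def by (rule tlift_lin) (auto intro: tensor_module)

lemma tmap_pure:
  "modules Ms \<Longrightarrow> modules Ns \<Longrightarrow> multilin Ms (T Ns) (\<lambda>xs. pure K Ns (h xs)) \<Longrightarrow> xs \<in> tuples Ms \<Longrightarrow>
    tmap K Ms Ns h (pure K Ms xs) = pure K Ns (h xs)"
  unfolding tmap_def by (rule tlift_pure) (auto intro: tensor_module)

context
  fixes Ms Ns :: "('k, 'x) module list"
  assumes mods: "modules Ms" "modules Ns"
begin

lemma prepend_multilin:
  assumes "xs \<in> tuples Ms"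
  shows "multilin Ns (T (Ms @ Ns)) (\<lambda>ys. pure K (Ms @ Ns) (xs @ ys))"
  using multilin_fix_prefix[OF pure_multilin assms, of Ns] mods by simp

lemma prepend_lin: "xs \<in> tuples Ms \<Longrightarrow> tmap K Ns (Ms @ Ns) (\<lambda>ys. xs @ ys) \<in> Hom Ns (Ms @ Ns)"
  by (rule tmap_lin) (simp_all add: mods prepend_multilin)

lemma prepend_pure:
  "xs \<in> tuples Ms \<Longrightarrow> ys \<in> tuples Ns \<Longrightarrow> tmap K Ns (Ms @ Ns) (\<lambda>ys. xs @ ys) (pure K Ns ys) = pure K (Ms @ Ns) (xs @ ys)"
  by (rule tmap_pure) (simp_all add: mods prepend_multilin)

text \<open>By induction on \<open>t\<close>: for a pure tensor it is multilinearity of \<^const>\<open>pure\<close>, and the property is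
  preserved by linear combinations of \<open>t\<close>.\<close>

lemma tcat_multilin:
  assumes t: "t \<in> C Ns"
  shows "multilin Ms (T (Ms @ Ns)) (\<lambda>xs. tmap K Ns (Ms @ Ns) (\<lambda>ys. xs @ ys) t)"
proof (rule multilinI)
  show "tmap K Ns (Ms @ Ns) ((@) xs) t \<in> C (Ms @ Ns)" if "xs \<in> tuples Ms" for xs
    using lin_maps_closed[OF prepend_lin[OF that] t] .
next
  have TM: "module K (T (Ms @ Ns))" "module K (T Ns)" using mods by (simp_all add: tensor_module)
  fix Us M Vs us vs
  assume *: "Ms = Us @ M # Vs" "us \<in> tuples Us" "vs \<in> tuples Vs"
  have M: "module K M" using mods * by simp
  have tup: "us @ x # vs \<in> tuples Ms" if "x \<in> carrier M" for x using * that by simp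
  note cong = lin_maps_cong[OF _ M]
  show "(\<lambda>x. tmap K Ns (Ms @ Ns) ((@) (us @ x # vs)) t) \<in> lin_maps K M (T (Ms @ Ns))"
    using mods(2) t
  proof (induction rule: tensor_induct)
    case (pure ys)
    have "multilin (Us @ M # (Vs @ Ns)) (T (Ms @ Ns)) (pure K (Ms @ Ns))"
      using pure_multilin[of "Ms @ Ns"] mods * by simp
    from multilin_slot[OF this *(2), of "vs @ ys"]
    have "(\<lambda>x. pure K (Ms @ Ns) (us @ x # vs @ ys)) \<in> lin_maps K M (T (Ms @ Ns))" using pure * by simp
    then show ?case
      by (rule cong) (use prepend_pure[OF tup pure] in simp)
  next
    case (add r s)
    show ?case
      by (rule cong[OF lin_maps_plus[OF TM(1) add(3,4)]]) (use lin_maps_add[OF prepend_lin[OF tup] add(1,2)] in simp)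
  next
    case (smult c s)
    show ?case
      by (rule cong[OF lin_maps_scale[OF TM(1) smult(3,1)]]) (use lin_maps_smult[OF prepend_lin[OF tup] smult(1,2)] in simp)
  next
    case zero
    show ?case
      by (rule cong[OF lin_maps_const_zero[OF TM(1)]]) (use lin_maps_zero[OF prepend_lin[OF tup] TM(2,1)] in simp)
  qed
qed

lemma tcat_lin_left: "t \<in> C Ns \<Longrightarrow> (\<lambda>s. tcat K Ms Ns s t) \<in> Hom Ms (Ms @ Ns)"
  unfolding tcat_def by (rule tlift_lin) (simp_all add: mods tensor_module tcat_multilin)

lemma tcat_pure_left: "xs \<in> tuples Ms \<Longrightarrow> t \<in> C Ns \<Longrightarrow> tcat K Ms Ns (pure K Ms xs) t = tmap K Ns (Ms @ Ns) (\<lambda>ys. xs @ ys) t"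
  unfolding tcat_def by (rule tlift_pure) (simp_all add: mods tensor_module tcat_multilin)

lemma tcat_pure:
  "xs \<in> tuples Ms \<Longrightarrow> ys \<in> tuples Ns \<Longrightarrow> tcat K Ms Ns (pure K Ms xs) (pure K Ns ys) = pure K (Ms @ Ns) (xs @ ys)"
  by (simp add: tcat_pure_left prepend_pure)

text \<open>By induction on \<open>s\<close>, starting from pure tensors, where the map is one of those given by fixing a
  prefix.\<close>

lemma tcat_lin_right:
  assumes s: "s \<in> C Ms"
  shows "(\<lambda>t. tcat K Ms Ns s t) \<in> Hom Ns (Ms @ Ns)"
proof -
  have TM: "module K (T (Ms @ Ns))" "module K (T Ns)" "module K (T Ms)" using mods by (simp_all add: tensor_module)
  note cong = lin_maps_cong[OF _ TM(2)]
  show ?thesis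
    using mods(1) s
  proof (induction rule: tensor_induct)
    case (pure xs)
    show ?case by (rule cong[OF prepend_lin[OF pure]]) (rule tcat_pure_left[OF pure])
  next
    case (add r s)
    show ?case
      by (rule cong[OF lin_maps_plus[OF TM(1) add(3,4)]]) (use lin_maps_add[OF tcat_lin_left add(1,2)] in simp)
  next
    case (smult c s)
    show ?case
      by (rule cong[OF lin_maps_scale[OF TM(1) smult(3,1)]]) (use lin_maps_smult[OF tcat_lin_left smult(1,2)] in simp)
  next
    case zero
    show ?case
      by (rule cong[OF lin_maps_const_zero[OF TM(1)]]) (use lin_maps_zero[OF tcat_lin_left TM(3,1)] in simp)
  qed
qed

end

lemma tcat_closed:
  "modules Ms \<Longrightarrow> modules Ns \<Longrightarrow> s \<in> C Ms \<Longrightarrow> t \<in> C Ns \<Longrightarrow> Ps = Ms @ Ns \<Longrightarrow> tcat K Ms Ns s t \<in> C Ps"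
  using lin_maps_closed[OF tcat_lin_left] by blast

lemma lin_tcat_left:
  "modules Ms \<Longrightarrow> modules Ns \<Longrightarrow> g \<in> lin_maps K N (T Ms) \<Longrightarrow> t \<in> C Ns \<Longrightarrow> Ps = Ms @ Ns \<Longrightarrow>
    (\<lambda>x. tcat K Ms Ns (g x) t) \<in> lin_maps K N (T Ps)"
  using lin_maps_comp[OF _ tcat_lin_left] by blast

lemma lin_tcat_right:
  "modules Ms \<Longrightarrow> modules Ns \<Longrightarrow> s \<in> C Ms \<Longrightarrow> g \<in> lin_maps K N (T Ns) \<Longrightarrow> Ps = Ms @ Ns \<Longrightarrow>
    (\<lambda>x. tcat K Ms Ns s (g x)) \<in> lin_maps K N (T Ps)"
  using lin_maps_comp[OF _ tcat_lin_right] by blast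

text \<open>Through this lemma \<^const>\<open>tinner\<close> and the flattening of nested tensors below are seen to be well defined.\<close>

lemma multilin_tcat:
  assumes mods: "modules Ms" "modules Ns" "modules Ps" "modules Qs"
    and g: "multilin Ms (T Ps) g" and h: "multilin Ns (T Qs) h"
  shows "multilin (Ms @ Ns) (T (Ps @ Qs)) (\<lambda>xs. tcat K Ps Qs (g (take (length Ms) xs)) (h (drop (length Ms) xs)))"
    (is "multilin _ _ ?f")
proof (rule multilinI)
  fix xs assume "xs \<in> tuples (Ms @ Ns)"
  then show "?f xs \<in> C (Ps @ Qs)"
    by (auto simp: tuples_append tuples_length mods multilin_closed[OF g] multilin_closed[OF h] intro!: tcat_closed)
next
  fix Us M Vs us vs
  assume *: "Ms @ Ns = Us @ M # Vs" "us \<in> tuples Us" "vs \<in> tuples Vs"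
  from *(1) show "(\<lambda>x. ?f (us @ x # vs)) \<in> lin_maps K M (T (Ps @ Qs))"
  proof (cases rule: append_eq_slot)
    case (left Vs')
    then obtain vs' ns where v: "vs = vs' @ ns" "vs' \<in> tuples Vs'" "ns \<in> tuples Ns" using * by (auto simp: tuples_append)
    have "?f (us @ z # vs) = tcat K Ps Qs (g (us @ z # vs')) (h ns)" for z
      using left v * by (simp add: tuples_length)
    moreover have "(\<lambda>z. tcat K Ps Qs (g (us @ z # vs')) (h ns)) \<in> lin_maps K M (T (Ps @ Qs))"
      by (rule lin_tcat_left[OF mods(3,4) multilin_slot[OF g[unfolded left] *(2) v(2)] multilin_closed[OF h v(3)] refl])
    ultimately show ?thesis by simp
  next
    case (right Us')
    then obtain ms us' where v: "us = ms @ us'" "ms \<in> tuples Ms" "us' \<in> tuples Us'" using * by (auto simp: tuples_append)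
    have "?f (us @ z # vs) = tcat K Ps Qs (g ms) (h (us' @ z # vs))" for z
      using right v * by (simp add: tuples_length)
    moreover have "(\<lambda>z. tcat K Ps Qs (g ms) (h (us' @ z # vs))) \<in> lin_maps K M (T (Ps @ Qs))"
      by (rule lin_tcat_right[OF mods(3,4) multilin_closed[OF g v(2)] multilin_slot[OF h[unfolded right] v(3) *(3)] refl])
    ultimately show ?thesis by simp
  qed
qed

text \<open>All expressions are linear in each argument, so the arguments may be replaced by pure tensors one at
  a time.\<close>

lemma tcat_assoc:
  assumes mods: "modules Ls" "modules Ms" "modules Ns" and "r \<in> C Ls" "s \<in> C Ms" "t \<in> C Ns"
  shows "tcat K (Ls @ Ms) Ns (tcat K Ls Ms r s) t = tcat K Ls (Ms @ Ns) r (tcat K Ms Ns s t)"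
proof -
  have TM: "module K (T (Ls @ Ms @ Ns))" using mods by (simp add: tensor_module)
  have 1: "tcat K (Ls @ Ms) Ns (tcat K Ls Ms (pure K Ls xs) (pure K Ms ys)) t = tcat K Ls (Ms @ Ns) (pure K Ls xs) (tcat K Ms Ns (pure K Ms ys) t)"
    if "xs \<in> tuples Ls" "ys \<in> tuples Ms" "t \<in> C Ns" for xs ys t
    by (rule lin_maps_eqI[OF mods(3) TM _ _ _ that(3)])
      (auto intro!: lin_tcat_right tcat_closed lin_maps_id simp: mods that tcat_pure)
  have 2: "tcat K (Ls @ Ms) Ns (tcat K Ls Ms (pure K Ls xs) s) t = tcat K Ls (Ms @ Ns) (pure K Ls xs) (tcat K Ms Ns s t)"
    if "xs \<in> tuples Ls" "s \<in> C Ms" "t \<in> C Ns" for xs s t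
    by (rule lin_maps_eqI[OF mods(2) TM _ _ _ that(2)])
      (auto intro!: lin_tcat_right lin_tcat_left tcat_closed lin_maps_id simp: mods that 1)
  show ?thesis
    by (rule lin_maps_eqI[OF mods(1) TM _ _ _ assms(4)])
      (auto intro!: lin_tcat_right lin_tcat_left tcat_closed lin_maps_id simp: assms 2)
qed

lemma tcat_unit_left:
  assumes "modules Ns" "t \<in> C Ns" shows "tcat K [] Ns (pure K [] []) t = t"
  by (rule lin_maps_eqI[OF assms(1) tensor_module[OF assms(1)] _ _ _ assms(2)])
    (use assms tcat_pure[of "[]" Ns "[]"] in \<open>auto intro!: lin_tcat_right lin_maps_id\<close>)

lemma tcat_unit_right:
  assumes "modules Ns" "t \<in> C Ns" shows "tcat K Ns [] t (pure K [] []) = t"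
  by (rule lin_maps_eqI[OF assms(1) tensor_module[OF assms(1)] _ _ _ assms(2)])
    (use assms tcat_pure[of Ns "[]" _ "[]"] in \<open>auto intro!: lin_tcat_left lin_maps_id\<close>)

section \<open>Applying a linear map to a block of tensor factors\<close>

lemma tensor3_eqI:
  assumes mods: "modules Us" "modules Ms" "modules Vs" and N: "module K N"
    and f: "f \<in> lin_maps K (T (Us @ Ms @ Vs)) N" and g: "g \<in> lin_maps K (T (Us @ Ms @ Vs)) N"
    and eq: "\<And>u m v. u \<in> C Us \<Longrightarrow> m \<in> C Ms \<Longrightarrow> v \<in> C Vs \<Longrightarrow>
      f (tcat K Us (Ms @ Vs) u (tcat K Ms Vs m v)) = g (tcat K Us (Ms @ Vs) u (tcat K Ms Vs m v))"
    and t: "t \<in> C (Us @ Ms @ Vs)"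
  shows "f t = g t"
proof (rule lin_maps_eqI[OF _ N f g _ t])
  fix xs assume "xs \<in> tuples (Us @ Ms @ Vs)"
  then obtain us ms vs where "xs = us @ ms @ vs" "us \<in> tuples Us" "ms \<in> tuples Ms" "vs \<in> tuples Vs"
    by (fastforce simp: tuples_append)
  then show "f (pure K (Us @ Ms @ Vs) xs) = g (pure K (Us @ Ms @ Vs) xs)"
    using eq[of "pure K Us us" "pure K Ms ms" "pure K Vs vs"] mods by (simp add: tcat_pure)
qed (use mods in simp)

text \<open>\<open>W Us Ms Ns Vs F\<close> is \<open>id \<otimes> F \<otimes> id\<close>, here called a whiskering of \<open>F\<close>.\<close>

abbreviation W :: "('k, 'x) module list \<Rightarrow> ('k, 'x) module list \<Rightarrow> ('k, 'x) module list \<Rightarrow> ('k, 'x) module list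
    \<Rightarrow> (('x, 'k) tens \<Rightarrow> ('x, 'k) tens) \<Rightarrow> ('x, 'k) tens \<Rightarrow> ('x, 'k) tens" where
  "W \<equiv> tinner K"

context
  fixes Us Ms Ns Vs :: "('k, 'x) module list" and F :: "('x, 'k) tens \<Rightarrow> ('x, 'k) tens"
  assumes mods: "modules Us" "modules Ms" "modules Ns" "modules Vs" and F: "F \<in> Hom Ms Ns"
begin

lemma whisker_multilin:
  "multilin (Us @ Ms @ Vs) (T (Us @ Ns @ Vs))
    (\<lambda>xs. tcat K Us (Ns @ Vs) (pure K Us (take (length Us) xs))
      (tcat K Ns Vs (F (pure K Ms (take (length Ms) (drop (length Us) xs))))
        (pure K Vs (drop (length Us + length Ms) xs))))"
proof -
  have "multilin (Ms @ Vs) (T (Ns @ Vs))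
      (\<lambda>xs. tcat K Ns Vs (F (pure K Ms (take (length Ms) xs))) (pure K Vs (drop (length Ms) xs)))"
    using mods F by (intro multilin_tcat multilin_comp[OF pure_multilin F] pure_multilin)
  from multilin_tcat[OF _ _ _ _ pure_multilin[OF mods(1)] this] mods
  show ?thesis by (simp add: add.commute)
qed

lemma whisker_lin: "W Us Ms Ns Vs F \<in> Hom (Us @ Ms @ Vs) (Us @ Ns @ Vs)"
  unfolding tinner_def using mods by (intro tlift_lin whisker_multilin tensor_module) auto

text \<open>The formula by which \<^const>\<open>tinner\<close> is defined on pure tensors extends to arbitrary tensors, again by
  linearity in one argument at a time. All the rules of the calculus are consequences.\<close>

lemma whisker_tcat:
  assumes "u \<in> C Us" "m \<in> C Ms" "v \<in> C Vs"
  shows "W Us Ms Ns Vs F (tcat K Us (Ms @ Vs) u (tcat K Ms Vs m v)) = tcat K Us (Ns @ Vs) u (tcat K Ns Vs (F m) v)"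
proof -
  have TM: "module K (T (Us @ Ns @ Vs))" using mods by (simp add: tensor_module)
  note lins = lin_tcat_right lin_tcat_left tcat_closed lin_maps_id lin_maps_comp[OF _ whisker_lin] lin_maps_comp[OF _ F]
    lin_maps_closed[OF F]
  have 1: "W Us Ms Ns Vs F (tcat K Us (Ms @ Vs) (pure K Us xs) (tcat K Ms Vs (pure K Ms ys) (pure K Vs zs)))
      = tcat K Us (Ns @ Vs) (pure K Us xs) (tcat K Ns Vs (F (pure K Ms ys)) (pure K Vs zs))"
    if "xs \<in> tuples Us" "ys \<in> tuples Ms" "zs \<in> tuples Vs" for xs ys zs
    using tlift_pure[OF _ TM whisker_multilin, of "xs @ ys @ zs"] mods that
    by (simp add: tcat_pure tinner_def tuples_length)
  have 2: "W Us Ms Ns Vs F (tcat K Us (Ms @ Vs) (pure K Us xs) (tcat K Ms Vs (pure K Ms ys) v))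
      = tcat K Us (Ns @ Vs) (pure K Us xs) (tcat K Ns Vs (F (pure K Ms ys)) v)"
    if "xs \<in> tuples Us" "ys \<in> tuples Ms" "v \<in> C Vs" for xs ys v
    by (rule lin_maps_eqI[OF mods(4) TM _ _ _ that(3)]) (auto intro!: lins simp: mods that 1)
  have 3: "W Us Ms Ns Vs F (tcat K Us (Ms @ Vs) (pure K Us xs) (tcat K Ms Vs m v))
      = tcat K Us (Ns @ Vs) (pure K Us xs) (tcat K Ns Vs (F m) v)"
    if "xs \<in> tuples Us" "m \<in> C Ms" "v \<in> C Vs" for xs m v
    by (rule lin_maps_eqI[OF mods(2) TM _ _ _ that(2)]) (auto intro!: lins simp: mods that 2)
  show ?thesis
    by (rule lin_maps_eqI[OF mods(1) TM _ _ _ assms(1)]) (auto intro!: lins simp: mods assms 3)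
qed

end

lemma whisker_closed:
  "modules Us \<Longrightarrow> modules Ms \<Longrightarrow> modules Ns \<Longrightarrow> modules Vs \<Longrightarrow> F \<in> Hom Ms Ns \<Longrightarrow>
    x \<in> C Ps \<Longrightarrow> Ps = Us @ Ms @ Vs \<Longrightarrow> Qs = Us @ Ns @ Vs \<Longrightarrow> W Us Ms Ns Vs F x \<in> C Qs"
  using lin_maps_closed[OF whisker_lin] by blast

lemma whisker_hom:
  "modules Us \<Longrightarrow> modules Ms \<Longrightarrow> modules Ns \<Longrightarrow> modules Vs \<Longrightarrow> F \<in> Hom Ms Ns \<Longrightarrow>
    Ps = Us @ Ms @ Vs \<Longrightarrow> Qs = Us @ Ns @ Vs \<Longrightarrow> W Us Ms Ns Vs F \<in> Hom Ps Qs"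
  using whisker_lin by blast

lemma whisker_right:
  assumes "modules Ms" "modules Ns" "modules Vs" "F \<in> Hom Ms Ns" "m \<in> C Ms" "v \<in> C Vs"
  shows "W [] Ms Ns Vs F (tcat K Ms Vs m v) = tcat K Ns Vs (F m) v"
  using whisker_tcat[of "[]" Ms Ns Vs F "pure K [] []" m v] assms lin_maps_closed[OF assms(4,5)]
  by (simp add: tcat_unit_left tcat_closed)

lemma whisker_left:
  assumes "modules Us" "modules Ms" "modules Ns" "F \<in> Hom Ms Ns" "u \<in> C Us" "m \<in> C Ms"
  shows "W Us Ms Ns [] F (tcat K Us Ms u m) = tcat K Us Ns u (F m)"
  using whisker_tcat[of Us Ms Ns "[]" F u m "pure K [] []"] assms lin_maps_closed[OF assms(4,6)]
  by (simp add: tcat_unit_right)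

lemma whisker_none:
  assumes "modules Ms" "modules Ns" "F \<in> Hom Ms Ns" "m \<in> C Ms"
  shows "W [] Ms Ns [] F m = F m"
  using whisker_left[of "[]" Ms Ns F "pure K [] []" m] assms lin_maps_closed[OF assms(3,4)]
  by (simp add: tcat_unit_left)

lemma whisker_cong:
  assumes "modules Us" "modules Ms" "modules Ns" "modules Vs" "F \<in> Hom Ms Ns"
    and eq: "\<And>m. m \<in> C Ms \<Longrightarrow> G m = F m" and x: "x \<in> C (Us @ Ms @ Vs)"
  shows "W Us Ms Ns Vs G x = W Us Ms Ns Vs F x"
proof -
  have G: "G \<in> Hom Ms Ns" using lin_maps_cong[OF assms(5) tensor_module eq] assms by simp
  show ?thesis
    by (rule tensor3_eqI[OF assms(1,2,4) _ whisker_lin whisker_lin _ x])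
      (use assms G in \<open>simp_all add: tensor_module whisker_tcat\<close>)
qed

lemma whisker_id:
  assumes "modules Us" "modules Ms" "modules Vs"
    and eq: "\<And>m. m \<in> C Ms \<Longrightarrow> F m = m" and x: "x \<in> C (Us @ Ms @ Vs)"
  shows "W Us Ms Ms Vs F x = x"
proof -
  have F: "F \<in> Hom Ms Ms" using lin_maps_cong[OF lin_maps_id tensor_module eq] assms by simp
  show ?thesis
    by (rule tensor3_eqI[OF assms(1-3) _ whisker_lin lin_maps_id _ x])
      (use assms F in \<open>simp_all add: tensor_module whisker_tcat\<close>)
qed

lemma whisker_comp:
  assumes mods: "modules Us" "modules Ms" "modules Ns" "modules Ps" "modules Vs"
    and F: "F \<in> Hom Ms Ns" and G: "G \<in> Hom Ns Ps" and x: "x \<in> C (Us @ Ms @ Vs)"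
  shows "W Us Ns Ps Vs G (W Us Ms Ns Vs F x) = W Us Ms Ps Vs (\<lambda>m. G (F m)) x"
  by (rule tensor3_eqI[OF mods(1,2,5) _ lin_maps_comp[OF whisker_lin whisker_lin] whisker_lin _ x])
    (use mods F G lin_maps_closed[OF F] in \<open>simp_all add: tensor_module whisker_tcat lin_maps_comp[OF F G]\<close>)

lemma whisker_square:
  assumes mods: "modules Us" "modules Ms" "modules Ns" "modules Ns'" "modules Ps" "modules Vs"
    and F: "F \<in> Hom Ms Ns" and G: "G \<in> Hom Ns Ps" and F': "F' \<in> Hom Ms Ns'" and G': "G' \<in> Hom Ns' Ps"
    and eq: "\<And>m. m \<in> C Ms \<Longrightarrow> G (F m) = G' (F' m)" and x: "x \<in> C (Us @ Ms @ Vs)"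
  shows "W Us Ns Ps Vs G (W Us Ms Ns Vs F x) = W Us Ns' Ps Vs G' (W Us Ms Ns' Vs F' x)"
proof -
  have "W Us Ns Ps Vs G (W Us Ms Ns Vs F x) = W Us Ms Ps Vs (\<lambda>m. G (F m)) x"
    by (rule whisker_comp[OF mods(1-3,5,6) F G x])
  also have "\<dots> = W Us Ms Ps Vs (\<lambda>m. G' (F' m)) x"
    by (rule whisker_cong[OF mods(1,2,5,6) lin_maps_comp[OF F' G'] eq x])
  also have "\<dots> = W Us Ns' Ps Vs G' (W Us Ms Ns' Vs F' x)"
    by (rule whisker_comp[OF mods(1,2,4-6) F' G' x, symmetric])
  finally show ?thesis .
qed

lemma whisker_whisker:
  assumes mods: "modules Us" "modules Us'" "modules Ms" "modules Ns" "modules Vs'" "modules Vs"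
    and F: "F \<in> Hom Ms Ns" and x: "x \<in> C (Us @ Us' @ Ms @ Vs' @ Vs)"
  shows "W Us (Us' @ Ms @ Vs') (Us' @ Ns @ Vs') Vs (W Us' Ms Ns Vs' F) x = W (Us @ Us') Ms Ns (Vs' @ Vs) F x"
proof (rule lin_maps_eqI[OF _ _ _ _ _ x])
  note [simp] = mods F whisker_lin
  show "modules (Us @ Us' @ Ms @ Vs' @ Vs)" "module K (T (Us @ Us' @ Ns @ Vs' @ Vs))"
    by (simp_all add: tensor_module)
  show "W Us (Us' @ Ms @ Vs') (Us' @ Ns @ Vs') Vs (W Us' Ms Ns Vs' F) \<in> Hom (Us @ Us' @ Ms @ Vs' @ Vs) (Us @ Us' @ Ns @ Vs' @ Vs)"
    "W (Us @ Us') Ms Ns (Vs' @ Vs) F \<in> Hom (Us @ Us' @ Ms @ Vs' @ Vs) (Us @ Us' @ Ns @ Vs' @ Vs)"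
    by (auto intro!: whisker_hom)
  fix xs assume "xs \<in> tuples (Us @ Us' @ Ms @ Vs' @ Vs)"
  then obtain us us' ms vs' vs where xs: "xs = us @ us' @ ms @ vs' @ vs" and
    t: "us \<in> tuples Us" "us' \<in> tuples Us'" "ms \<in> tuples Ms" "vs' \<in> tuples Vs'" "vs \<in> tuples Vs"
    by (fastforce simp: tuples_append)
  have 1: "pure K (Us @ Us' @ Ms @ Vs' @ Vs) xs =
    tcat K Us (Us' @ Ms @ Vs' @ Vs) (pure K Us us) (tcat K (Us' @ Ms @ Vs') Vs
      (tcat K Us' (Ms @ Vs') (pure K Us' us') (tcat K Ms Vs' (pure K Ms ms) (pure K Vs' vs'))) (pure K Vs vs))"
    using t by (simp add: xs tcat_pure)
  have 2: "pure K (Us @ Us' @ Ms @ Vs' @ Vs) xs =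
    tcat K (Us @ Us') (Ms @ Vs' @ Vs) (tcat K Us Us' (pure K Us us) (pure K Us' us')) (tcat K Ms (Vs' @ Vs) (pure K Ms ms)
      (tcat K Vs' Vs (pure K Vs' vs') (pure K Vs vs)))"
    using t by (simp add: xs tcat_pure)
  have Fm: "F (pure K Ms ms) \<in> C Ns" using t lin_maps_closed[OF F] by simp
  have "W Us (Us' @ Ms @ Vs') (Us' @ Ns @ Vs') Vs (W Us' Ms Ns Vs' F) (pure K (Us @ Us' @ Ms @ Vs' @ Vs) xs) =
    tcat K Us (Us' @ Ns @ Vs' @ Vs) (pure K Us us) (tcat K (Us' @ Ns @ Vs') Vs
      (tcat K Us' (Ns @ Vs') (pure K Us' us') (tcat K Ns Vs' (F (pure K Ms ms)) (pure K Vs' vs'))) (pure K Vs vs))"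
    unfolding 1 using t whisker_tcat[of Us "Us' @ Ms @ Vs'" "Us' @ Ns @ Vs'" Vs "W Us' Ms Ns Vs' F"]
      by (simp add: whisker_tcat tcat_closed)
  also have "\<dots> = tcat K (Us @ Us') (Ns @ Vs' @ Vs) (tcat K Us Us' (pure K Us us) (pure K Us' us')) (tcat K Ns (Vs' @ Vs) (F (pure K Ms ms))
      (tcat K Vs' Vs (pure K Vs' vs') (pure K Vs vs)))"
    using t Fm tcat_assoc[of Us' "Ns @ Vs'" Vs] by (simp add: tcat_assoc tcat_closed)
  also have "\<dots> = W (Us @ Us') Ms Ns (Vs' @ Vs) F (pure K (Us @ Us' @ Ms @ Vs' @ Vs) xs)"
    unfolding 2 using t whisker_tcat[of "Us @ Us'" Ms Ns "Vs' @ Vs" F]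
      by (simp add: tcat_closed)
  finally show "W Us (Us' @ Ms @ Vs') (Us' @ Ns @ Vs') Vs (W Us' Ms Ns Vs' F) (pure K (Us @ Us' @ Ms @ Vs' @ Vs) xs)
    = W (Us @ Us') Ms Ns (Vs' @ Vs) F (pure K (Us @ Us' @ Ms @ Vs' @ Vs) xs)" .
qed

text \<open>This rule is what lets letters move in one part of a word while an operation acts on another part.\<close>

lemma whisker_interchange:
  assumes mods: "modules Us" "modules Ms" "modules Ns" "modules Vs" "modules Ps" "modules Qs" "modules Zs"
    and F: "F \<in> Hom Ms Ns" and G: "G \<in> Hom Ps Qs" and x: "x \<in> C (Us @ Ms @ Vs @ Ps @ Zs)"
  shows "W Us Ms Ns (Vs @ Qs @ Zs) F (W (Us @ Ms @ Vs) Ps Qs Zs G x) =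
         W (Us @ Ns @ Vs) Ps Qs Zs G (W Us Ms Ns (Vs @ Ps @ Zs) F x)"
proof (rule lin_maps_eqI[OF _ _ _ _ _ x])
  note [simp] = mods F G
  let ?L = "Us @ Ms @ Vs @ Ps @ Zs" and ?R = "Us @ Ns @ Vs @ Qs @ Zs"
  show "modules ?L" "module K (T ?R)"
    by (simp_all add: tensor_module)
  show "(\<lambda>x. W Us Ms Ns (Vs @ Qs @ Zs) F (W (Us @ Ms @ Vs) Ps Qs Zs G x)) \<in> Hom ?L ?R"
    by (rule lin_maps_comp[where M="T (Us @ Ms @ Vs @ Qs @ Zs)"]) (auto intro!: whisker_hom)
  show "(\<lambda>x. W (Us @ Ns @ Vs) Ps Qs Zs G (W Us Ms Ns (Vs @ Ps @ Zs) F x)) \<in> Hom ?L ?R"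
    by (rule lin_maps_comp[where M="T (Us @ Ns @ Vs @ Ps @ Zs)"]) (auto intro!: whisker_hom)
  fix xs assume "xs \<in> tuples ?L"
  then obtain us ms vs ps zs where xs: "xs = us @ ms @ vs @ ps @ zs" and
    t: "us \<in> tuples Us" "ms \<in> tuples Ms" "vs \<in> tuples Vs" "ps \<in> tuples Ps" "zs \<in> tuples Zs"
    by (fastforce simp: tuples_append)
  have Fm: "F (pure K Ms ms) \<in> C Ns" "G (pure K Ps ps) \<in> C Qs" using t lin_maps_closed[OF F] lin_maps_closed[OF G] by simp_all
  have 1: "pure K ?L xs = tcat K (Us @ Ms @ Vs) (Ps @ Zs)
      (tcat K Us (Ms @ Vs) (pure K Us us) (tcat K Ms Vs (pure K Ms ms) (pure K Vs vs))) (tcat K Ps Zs (pure K Ps ps) (pure K Zs zs))"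
    and 2: "pure K ?L xs = tcat K Us (Ms @ Vs @ Ps @ Zs) (pure K Us us) (tcat K Ms (Vs @ Ps @ Zs) (pure K Ms ms)
      (tcat K Vs (Ps @ Zs) (pure K Vs vs) (tcat K Ps Zs (pure K Ps ps) (pure K Zs zs))))"
    using t by (simp_all add: xs tcat_pure)
  have a: "tcat K (Us @ Xs @ Vs) Ys (tcat K Us (Xs @ Vs) (pure K Us us) (tcat K Xs Vs m (pure K Vs vs))) p
     = tcat K Us (Xs @ Vs @ Ys) (pure K Us us) (tcat K Xs (Vs @ Ys) m (tcat K Vs Ys (pure K Vs vs) p))"
    if "modules Xs" "modules Ys" "m \<in> C Xs" "p \<in> C Ys" for Xs Ys m p
    using that t tcat_assoc[of Us "Xs @ Vs" Ys] by (simp add: tcat_assoc tcat_closed)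
  have "W (Us @ Ms @ Vs) Ps Qs Zs G (pure K ?L xs) = tcat K (Us @ Ms @ Vs) (Qs @ Zs)
      (tcat K Us (Ms @ Vs) (pure K Us us) (tcat K Ms Vs (pure K Ms ms) (pure K Vs vs))) (tcat K Qs Zs (G (pure K Ps ps)) (pure K Zs zs))"
    unfolding 1 using t whisker_tcat[of "Us @ Ms @ Vs" Ps Qs Zs G] by (simp add: tcat_closed)
  then have "W Us Ms Ns (Vs @ Qs @ Zs) F (W (Us @ Ms @ Vs) Ps Qs Zs G (pure K ?L xs)) =
     tcat K Us (Ns @ Vs @ Qs @ Zs) (pure K Us us) (tcat K Ns (Vs @ Qs @ Zs) (F (pure K Ms ms))
      (tcat K Vs (Qs @ Zs) (pure K Vs vs) (tcat K Qs Zs (G (pure K Ps ps)) (pure K Zs zs))))"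
    using t Fm whisker_tcat[of Us Ms Ns "Vs @ Qs @ Zs" F] by (simp add: tcat_closed a)
  moreover have "W Us Ms Ns (Vs @ Ps @ Zs) F (pure K ?L xs) = tcat K Us (Ns @ Vs @ Ps @ Zs) (pure K Us us) (tcat K Ns (Vs @ Ps @ Zs) (F (pure K Ms ms))
      (tcat K Vs (Ps @ Zs) (pure K Vs vs) (tcat K Ps Zs (pure K Ps ps) (pure K Zs zs))))"
    unfolding 2 using t Fm whisker_tcat[of Us Ms Ns "Vs @ Ps @ Zs" F] by (simp add: tcat_closed)
  then have "W (Us @ Ns @ Vs) Ps Qs Zs G (W Us Ms Ns (Vs @ Ps @ Zs) F (pure K ?L xs)) =
     tcat K Us (Ns @ Vs @ Qs @ Zs) (pure K Us us) (tcat K Ns (Vs @ Qs @ Zs) (F (pure K Ms ms))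
      (tcat K Vs (Qs @ Zs) (pure K Vs vs) (tcat K Qs Zs (G (pure K Ps ps)) (pure K Zs zs))))"
    using t Fm whisker_tcat[of "Us @ Ns @ Vs" Ps Qs Zs G] by (simp add: tcat_closed flip: a)
  ultimately show "W Us Ms Ns (Vs @ Qs @ Zs) F (W (Us @ Ms @ Vs) Ps Qs Zs G (pure K ?L xs)) =
      W (Us @ Ns @ Vs) Ps Qs Zs G (W Us Ms Ns (Vs @ Ps @ Zs) F (pure K ?L xs))" by simp
qed

lemma whisker_bij:
  assumes mods: "modules Us" "modules Ms" "modules Ns" "modules Vs"
    and F: "F \<in> Hom Ms Ns" and bij: "bij_betw F (C Ms) (C Ns)"
  shows "bij_betw (W Us Ms Ns Vs F) (C (Us @ Ms @ Vs)) (C (Us @ Ns @ Vs))"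
proof -
  define G where "G = inv_into (C Ms) F"
  have GF: "G (F m) = m" if "m \<in> C Ms" for m
    using bij that by (simp add: G_def bij_betw_def)
  have FG: "F (G n) = n" if "n \<in> C Ns" for n
    using bij that by (simp add: G_def bij_betw_def f_inv_into_f)
  have G: "G \<in> Hom Ns Ms"
    using lin_maps_inverse[OF F bij] GF mods by (simp add: tensor_module)
  show ?thesis
  proof (rule bij_betw_byWitness[where f'="W Us Ns Ms Vs G"])
    show "\<forall>a\<in>C (Us @ Ms @ Vs). W Us Ns Ms Vs G (W Us Ms Ns Vs F a) = a"
      using mods F G GF by (simp add: whisker_comp whisker_id)
    show "\<forall>a\<in>C (Us @ Ns @ Vs). W Us Ms Ns Vs F (W Us Ns Ms Vs G a) = a"
      using mods F G FG by (simp add: whisker_comp whisker_id)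
  qed (use mods F G in \<open>auto intro!: whisker_closed\<close>)
qed

text \<open>Recognises an operation on lists that changes a single block, as contractions and insertions of a unit
  do, as a whiskering.\<close>

lemma whisker_tmap:
  assumes mods: "modules Us" "modules Ms" "modules Ns" "modules Vs"
    and h: "multilin Ms (T Ns) (\<lambda>xs. pure K Ns (h xs))" "\<And>ms. ms \<in> tuples Ms \<Longrightarrow> h ms \<in> tuples Ns"
    and h': "\<And>us ms vs. us \<in> tuples Us \<Longrightarrow> ms \<in> tuples Ms \<Longrightarrow> vs \<in> tuples Vs \<Longrightarrow> h' (us @ ms @ vs) = us @ h ms @ vs"
    and eq: "Ps = Us @ Ms @ Vs" "Qs = Us @ Ns @ Vs" and x: "x \<in> C Ps"
  shows "tmap K Ps Qs h' x = W Us Ms Ns Vs (tmap K Ms Ns h) x"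
  unfolding eq
proof (rule tmap_eqI)
  have F: "tmap K Ms Ns h \<in> Hom Ms Ns" using mods h by (simp add: tmap_lin)
  show "W Us Ms Ns Vs (tmap K Ms Ns h) \<in> Hom (Us @ Ms @ Vs) (Us @ Ns @ Vs)"
    using mods F by (rule whisker_lin)
  fix xs assume "xs \<in> tuples (Us @ Ms @ Vs)"
  then obtain us ms vs where xs: "xs = us @ ms @ vs" "us \<in> tuples Us" "ms \<in> tuples Ms" "vs \<in> tuples Vs"
    by (fastforce simp: tuples_append)
  have "W Us Ms Ns Vs (tmap K Ms Ns h) (tcat K Us (Ms @ Vs) (pure K Us us) (tcat K Ms Vs (pure K Ms ms) (pure K Vs vs)))
     = tcat K Us (Ns @ Vs) (pure K Us us) (tcat K Ns Vs (pure K Ns (h ms)) (pure K Vs vs))"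
    using mods F h xs by (simp add: whisker_tcat tmap_pure)
  then show "W Us Ms Ns Vs (tmap K Ms Ns h) (pure K (Us @ Ms @ Vs) xs) = pure K (Us @ Ns @ Vs) (h' xs)"
    using mods h xs h' by (simp add: tcat_pure)
qed (use mods x eq in simp_all)

section \<open>Block exchange\<close>

lemma flip_multilin:
  assumes "modules Ms" "modules Ns"
  shows "multilin (Ms @ Ns) (T (Ns @ Ms)) (\<lambda>xs. pure K (Ns @ Ms) (drop (length Ms) xs @ take (length Ms) xs))"
  using multilin_swap[OF pure_multilin, of Ns Ms] assms by simp

lemma flip_hom: "modules Ms \<Longrightarrow> modules Ns \<Longrightarrow> tflip K Ms Ns \<in> Hom (Ms @ Ns) (Ns @ Ms)"
  unfolding tflip_def by (rule tmap_lin) (auto intro: flip_multilin)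

lemma flip_pure:
  "modules Ms \<Longrightarrow> modules Ns \<Longrightarrow> ms \<in> tuples Ms \<Longrightarrow> ns \<in> tuples Ns \<Longrightarrow>
    tflip K Ms Ns (pure K (Ms @ Ns) (ms @ ns)) = pure K (Ns @ Ms) (ns @ ms)"
  unfolding tflip_def by (subst tmap_pure) (auto simp: flip_multilin tuples_length)

lemma flip_closed: "modules Ms \<Longrightarrow> modules Ns \<Longrightarrow> x \<in> C Ps \<Longrightarrow> Ps = Ms @ Ns \<Longrightarrow> Qs = Ns @ Ms \<Longrightarrow> tflip K Ms Ns x \<in> C Qs"
  using lin_maps_closed[OF flip_hom] by blast

lemma flip_tcat:
  assumes mods: "modules Ms" "modules Ns" and "s \<in> C Ms" "t \<in> C Ns"
  shows "tflip K Ms Ns (tcat K Ms Ns s t) = tcat K Ns Ms t s"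
proof -
  have TM: "module K (T (Ns @ Ms))" using mods by (simp add: tensor_module)
  have 1: "tflip K Ms Ns (tcat K Ms Ns (pure K Ms xs) t) = tcat K Ns Ms t (pure K Ms xs)"
    if "xs \<in> tuples Ms" "t \<in> C Ns" for xs t
    by (rule lin_maps_eqI[OF mods(2) TM lin_maps_comp[OF tcat_lin_right flip_hom] tcat_lin_left _ that(2)])
      (simp_all add: mods that tcat_pure flip_pure)
  show ?thesis
    by (rule lin_maps_eqI[OF mods(1) TM lin_maps_comp[OF tcat_lin_left flip_hom] tcat_lin_right _ assms(3)])
      (simp_all add: assms 1)
qed

text \<open>Needed to compare the rotation of single letters in the diagonal with the rotation of a pair of
  letters in the smash product.\<close>

lemma flip_comp:
  assumes mods: "modules Ls" "modules Ms" "modules Ns" and x: "x \<in> C (Ls @ Ms @ Ns)"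
  shows "tflip K (Ns @ Ls) Ms (tflip K (Ls @ Ms) Ns x) = tflip K Ls (Ms @ Ns) x"
proof (rule lin_maps_eqI[OF _ _ _ _ _ x])
  show "(\<lambda>x. tflip K (Ns @ Ls) Ms (tflip K (Ls @ Ms) Ns x)) \<in> Hom (Ls @ Ms @ Ns) (Ms @ Ns @ Ls)"
    by (rule lin_maps_comp[where M="T (Ns @ Ls @ Ms)"])
      (use flip_hom[of "Ls @ Ms" Ns] flip_hom[of "Ns @ Ls" Ms] mods in simp_all)
  show "tflip K Ls (Ms @ Ns) \<in> Hom (Ls @ Ms @ Ns) (Ms @ Ns @ Ls)"
    using flip_hom[of Ls "Ms @ Ns"] mods by simp
  fix xs assume "xs \<in> tuples (Ls @ Ms @ Ns)"
  then obtain ls ms ns where xs: "xs = ls @ ms @ ns" "ls \<in> tuples Ls" "ms \<in> tuples Ms" "ns \<in> tuples Ns"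
    by (fastforce simp: tuples_append)
  have "tflip K (Ls @ Ms) Ns (pure K (Ls @ Ms @ Ns) xs) = pure K (Ns @ Ls @ Ms) (ns @ ls @ ms)"
    using flip_pure[of "Ls @ Ms" Ns "ls @ ms" ns] mods xs by simp
  moreover have "tflip K (Ns @ Ls) Ms (pure K (Ns @ Ls @ Ms) (ns @ ls @ ms)) = pure K (Ms @ Ns @ Ls) (ms @ ns @ ls)"
    using flip_pure[of "Ns @ Ls" Ms "ns @ ls" ms] mods xs by simp
  moreover have "tflip K Ls (Ms @ Ns) (pure K (Ls @ Ms @ Ns) xs) = pure K (Ms @ Ns @ Ls) (ms @ ns @ ls)"
    using flip_pure[of Ls "Ms @ Ns" ls "ms @ ns"] mods xs by simp
  ultimately show "tflip K (Ns @ Ls) Ms (tflip K (Ls @ Ms) Ns (pure K (Ls @ Ms @ Ns) xs)) = tflip K Ls (Ms @ Ns) (pure K (Ls @ Ms @ Ns) xs)"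
    by simp
qed (use mods in \<open>simp_all add: tensor_module\<close>)

lemma flip_whisker_left:
  assumes mods: "modules Us" "modules Ms" "modules Ns" "modules Vs" "modules Ps" and F: "F \<in> Hom Ms Ns"
    and x: "x \<in> C (Us @ Ms @ Vs @ Ps)"
  shows "tflip K (Us @ Ns @ Vs) Ps (W Us Ms Ns (Vs @ Ps) F x) = W (Ps @ Us) Ms Ns Vs F (tflip K (Us @ Ms @ Vs) Ps x)"
proof (rule lin_maps_eqI[OF _ _ _ _ _ x])
  note [simp] = mods F
  show "(\<lambda>x. tflip K (Us @ Ns @ Vs) Ps (W Us Ms Ns (Vs @ Ps) F x)) \<in> Hom (Us @ Ms @ Vs @ Ps) (Ps @ Us @ Ns @ Vs)"
    by (rule lin_maps_comp[where M="T (Us @ Ns @ Vs @ Ps)"])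
      (use flip_hom[of "Us @ Ns @ Vs" Ps] whisker_lin[of Us Ms Ns "Vs @ Ps" F] in simp_all)
  show "(\<lambda>x. W (Ps @ Us) Ms Ns Vs F (tflip K (Us @ Ms @ Vs) Ps x)) \<in> Hom (Us @ Ms @ Vs @ Ps) (Ps @ Us @ Ns @ Vs)"
    by (rule lin_maps_comp[where M="T (Ps @ Us @ Ms @ Vs)"])
      (use flip_hom[of "Us @ Ms @ Vs" Ps] whisker_lin[of "Ps @ Us" Ms Ns Vs F] in simp_all)
  fix xs assume "xs \<in> tuples (Us @ Ms @ Vs @ Ps)"
  then obtain us ms vs ps where xs: "xs = us @ ms @ vs @ ps" "us \<in> tuples Us" "ms \<in> tuples Ms" "vs \<in> tuples Vs" "ps \<in> tuples Ps"
    by (fastforce simp: tuples_append)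
  have Fm: "F (pure K Ms ms) \<in> C Ns" using xs lin_maps_closed[OF F] by simp
  have a: "tcat K Us (Xs @ Vs @ Ps) (pure K Us us) (tcat K Xs (Vs @ Ps) m (tcat K Vs Ps (pure K Vs vs) (pure K Ps ps)))
     = tcat K (Us @ Xs @ Vs) Ps (tcat K Us (Xs @ Vs) (pure K Us us) (tcat K Xs Vs m (pure K Vs vs))) (pure K Ps ps)"
    if "modules Xs" "m \<in> C Xs" for Xs m
    using that xs tcat_assoc[of Us "Xs @ Vs" Ps] by (simp add: tcat_assoc tcat_closed)
  have p: "pure K (Us @ Ms @ Vs @ Ps) xs = tcat K Us (Ms @ Vs @ Ps) (pure K Us us) (tcat K Ms (Vs @ Ps) (pure K Ms ms) (tcat K Vs Ps (pure K Vs vs) (pure K Ps ps)))"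
    using xs by (simp add: tcat_pure)
  have "tflip K (Us @ Ns @ Vs) Ps (W Us Ms Ns (Vs @ Ps) F (pure K (Us @ Ms @ Vs @ Ps) xs)) =
     tcat K Ps (Us @ Ns @ Vs) (pure K Ps ps) (tcat K Us (Ns @ Vs) (pure K Us us) (tcat K Ns Vs (F (pure K Ms ms)) (pure K Vs vs)))"
    unfolding p using xs Fm by (simp add: whisker_tcat tcat_closed a[of Ns "F (pure K Ms ms)"] flip_tcat)
  also have "\<dots> = tcat K (Ps @ Us) (Ns @ Vs) (tcat K Ps Us (pure K Ps ps) (pure K Us us)) (tcat K Ns Vs (F (pure K Ms ms)) (pure K Vs vs))"
    using xs Fm by (simp add: tcat_assoc tcat_closed)
  also have "\<dots> = W (Ps @ Us) Ms Ns Vs F (tcat K (Ps @ Us) (Ms @ Vs) (tcat K Ps Us (pure K Ps ps) (pure K Us us)) (tcat K Ms Vs (pure K Ms ms) (pure K Vs vs)))"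
    using xs Fm whisker_tcat[of "Ps @ Us" Ms Ns Vs F] by (simp add: tcat_closed)
  also have "tcat K (Ps @ Us) (Ms @ Vs) (tcat K Ps Us (pure K Ps ps) (pure K Us us)) (tcat K Ms Vs (pure K Ms ms) (pure K Vs vs)) = tflip K (Us @ Ms @ Vs) Ps (pure K (Us @ Ms @ Vs @ Ps) xs)"
    using xs flip_pure[of "Us @ Ms @ Vs" Ps "us @ ms @ vs" ps] by (simp add: tcat_pure)
  finally show "tflip K (Us @ Ns @ Vs) Ps (W Us Ms Ns (Vs @ Ps) F (pure K (Us @ Ms @ Vs @ Ps) xs)) = W (Ps @ Us) Ms Ns Vs F (tflip K (Us @ Ms @ Vs) Ps (pure K (Us @ Ms @ Vs @ Ps) xs))" .
qed (use mods in \<open>simp_all add: tensor_module\<close>)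

lemma flip_whisker_right:
  assumes mods: "modules Us" "modules Ms" "modules Ns" and F: "F \<in> Hom Ms Ns" and x: "x \<in> C (Us @ Ms)"
  shows "tflip K Us Ns (W Us Ms Ns [] F x) = W [] Ms Ns Us F (tflip K Us Ms x)"
proof (rule lin_maps_eqI[OF _ _ _ _ _ x])
  note [simp] = mods F
  show "(\<lambda>x. tflip K Us Ns (W Us Ms Ns [] F x)) \<in> Hom (Us @ Ms) (Ns @ Us)"
    by (rule lin_maps_comp[where M="T (Us @ Ns)"]) (auto intro!: flip_hom whisker_hom)
  show "(\<lambda>x. W [] Ms Ns Us F (tflip K Us Ms x)) \<in> Hom (Us @ Ms) (Ns @ Us)"
    by (rule lin_maps_comp[where M="T (Ms @ Us)"]) (auto intro!: flip_hom whisker_hom)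
  fix xs assume "xs \<in> tuples (Us @ Ms)"
  then obtain us ms where xs: "xs = us @ ms" "us \<in> tuples Us" "ms \<in> tuples Ms"
    by (auto simp: tuples_append)
  then have p: "pure K (Us @ Ms) xs = tcat K Us Ms (pure K Us us) (pure K Ms ms)" by (simp add: tcat_pure)
  show "tflip K Us Ns (W Us Ms Ns [] F (pure K (Us @ Ms) xs)) = W [] Ms Ns Us F (tflip K Us Ms (pure K (Us @ Ms) xs))"
    unfolding p using xs lin_maps_closed[OF F, of "pure K Ms ms"]
    by (simp add: whisker_left whisker_right flip_tcat)
qed (use mods in \<open>simp_all add: tensor_module\<close>)

end

sublocale strong_smash \<subseteq> tensor_ground K
  by unfold_locales

context strong_smash
begin

lemma module_A [simp]: "module K A" by (rule A.module_axioms)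
lemma module_B [simp]: "module K B" by (rule B.module_axioms)

abbreviation As :: "nat \<Rightarrow> ('k, 'x) module list" where "As n \<equiv> replicate n A"
abbreviation Bs :: "nat \<Rightarrow> ('k, 'x) module list" where "Bs n \<equiv> replicate n B"
abbreviation (input) Ts :: "nat \<Rightarrow> bool list" where "Ts n \<equiv> replicate n True"
abbreviation (input) Fs :: "nat \<Rightarrow> bool list" where "Fs n \<equiv> replicate n False"

section \<open>Sorting words in the two algebras\<close>

text \<open>Words are lists of truth values, \<open>True\<close> standing for \<open>A\<close> and \<open>False\<close> for \<open>B\<close>. Lists of modules
  would not do, because \<open>A\<close> and \<open>B\<close> may be equal.\<close>

definition wd :: "bool list \<Rightarrow> ('k, 'x) module list" where
  "wd w = map (\<lambda>c. if c then A else B) w"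

lemma wd_simps [simp]:
  "wd [] = []"
  "wd (True # w) = A # wd w"
  "wd (False # w) = B # wd w"
  "wd (u @ v) = wd u @ wd v"
  "wd (Ts n) = As n"
  "wd (Fs n) = Bs n"
  by (simp_all add: wd_def)

lemma modules_wd [simp]: "modules (wd w)"
  by (auto simp: wd_def modules_def)

definition cA :: "bool list \<Rightarrow> nat" where "cA w = length (filter id w)"
definition cB :: "bool list \<Rightarrow> nat" where "cB w = length (filter Not w)"

lemma count_simps [simp]:
  "cA [] = 0" "cB [] = 0"
  "cA (True # w) = Suc (cA w)" "cA (False # w) = cA w"
  "cB (True # w) = cB w" "cB (False # w) = Suc (cB w)"
  "cA (u @ v) = cA u + cA v" "cB (u @ v) = cB u + cB v"
  "cA (Ts n) = n" "cA (Fs n) = 0"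
  "cB (Ts n) = 0" "cB (Fs n) = n"
  by (simp_all add: cA_def cB_def)

abbreviation sorted_word :: "bool list \<Rightarrow> bool list" where
  "sorted_word w \<equiv> Ts (cA w) @ Fs (cB w)"

abbreviation sorted_mods :: "bool list \<Rightarrow> ('k, 'x) module list" where
  "sorted_mods w \<equiv> As (cA w) @ Bs (cB w)"

lemma R_hom [simp]: "R \<in> Hom [B, A] [A, B]" by (rule R_linear)

text \<open>The composite \<open>R\<^bsub>k,k+1\<^esub> \<cdots> R\<^bsub>12\<^esub>\<close> that moves one \<open>B\<close> past \<open>k\<close> copies of \<open>A\<close>, by recursion on
  the remaining crossings.\<close>

primrec cross :: "nat \<Rightarrow> ('x, 'k) tens \<Rightarrow> ('x, 'k) tens" where
  "cross 0 x = x"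
| "cross (Suc k) x = W [A] (B # As k) (As k @ [B]) [] (cross k) (W [] [B, A] [A, B] (As k) R x)"

lemma cross_hom: "cross k \<in> Hom (B # As k) (As k @ [B])"
proof (induction k)
  case 0
  then show ?case using lin_maps_id by (simp add: lin_maps_def)
next
  case (Suc k)
  have "W [] [B, A] [A, B] (As k) R \<in> Hom (B # As (Suc k)) (A # B # As k)"
    by (rule whisker_hom) simp_all
  moreover have "W [A] (B # As k) (As k @ [B]) [] (cross k) \<in> Hom (A # B # As k) (As (Suc k) @ [B])"
    by (rule whisker_hom) (simp_all add: Suc)
  ultimately show ?case unfolding cross.simps(2)[abs_def] by (rule lin_maps_comp)
qed

text \<open>Bringing all copies of \<open>A\<close> to the front, in one particular order of the moves.\<close>

primrec srt :: "bool list \<Rightarrow> ('x, 'k) tens \<Rightarrow> ('x, 'k) tens" where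
  "srt [] x = x"
| "srt (c # w) x =
    (if c then W [A] (wd w) (sorted_mods w) [] (srt w) x
     else W [] (B # As (cA w)) (As (cA w) @ [B]) (Bs (cB w)) (cross (cA w)) (W [B] (wd w) (sorted_mods w) [] (srt w) x))"

lemma srt_hom: "srt w \<in> Hom (wd w) (sorted_mods w)"
proof (induction w)
  case Nil
  then show ?case using lin_maps_id by (simp add: lin_maps_def)
next
  case (Cons c w)
  show ?case
  proof (cases c)
    case True
    have "W [A] (wd w) (sorted_mods w) [] (srt w) \<in> Hom (A # wd w) (A # sorted_mods w)"
      by (rule whisker_hom) (simp_all add: Cons)
    with True show ?thesis by (simp add: srt.simps(2)[abs_def])
  next
    case False
    have "W [B] (wd w) (sorted_mods w) [] (srt w) \<in> Hom (B # wd w) (B # sorted_mods w)"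
      by (rule whisker_hom) (simp_all add: Cons)
    moreover have "W [] (B # As (cA w)) (As (cA w) @ [B]) (Bs (cB w)) (cross (cA w)) \<in>
        Hom (B # sorted_mods w) (As (cA w) @ Bs (Suc (cB w)))"
      by (rule whisker_hom) (simp_all add: cross_hom)
    ultimately show ?thesis
      using False by (simp add: srt.simps(2)[abs_def] lin_maps_comp del: replicate_Suc)
  qed
qed

lemma srt_closed [simp]: "x \<in> C (wd w) \<Longrightarrow> srt w x \<in> C (sorted_mods w)"
  using lin_maps_closed[OF srt_hom] .

lemma cross_bij: "bij_betw (cross k) (C (B # As k)) (C (As k @ [B]))"
proof (induction k)
  case 0
  then show ?case by (simp add: bij_betw_def inj_on_def)
next
  case (Suc k)
  have 1: "bij_betw (W [] [B, A] [A, B] (As k) R) (C (B # As (Suc k))) (C (A # B # As k))"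
    using whisker_bij[of "[]" "[B, A]" "[A, B]" "As k" R] R_bijective by simp
  have 2: "bij_betw (W [A] (B # As k) (As k @ [B]) [] (cross k)) (C (A # B # As k)) (C (As (Suc k) @ [B]))"
    using whisker_bij[of "[A]" "B # As k" "As k @ [B]" "[]" "cross k"] Suc cross_hom by simp
  show ?case unfolding cross.simps(2)[abs_def] using bij_betw_trans[OF 1 2] by (simp add: comp_def)
qed

lemma srt_bij: "bij_betw (srt w) (C (wd w)) (C (sorted_mods w))"
proof (induction w)
  case Nil
  then show ?case by (simp add: bij_betw_def inj_on_def)
next
  case (Cons c w)
  show ?case
  proof (cases c)
    case True
    then show ?thesis
      using whisker_bij[of "[A]" "wd w" "sorted_mods w" "[]" "srt w"] Cons srt_hom by (simp add: srt.simps(2)[abs_def])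
  next
    case False
    have 1: "bij_betw (W [B] (wd w) (sorted_mods w) [] (srt w)) (C (B # wd w)) (C (B # sorted_mods w))"
      using whisker_bij[of "[B]" "wd w" "sorted_mods w" "[]" "srt w"] Cons srt_hom by simp
    have 2: "bij_betw (W [] (B # As (cA w)) (As (cA w) @ [B]) (Bs (cB w)) (cross (cA w)))
        (C (B # sorted_mods w)) (C (As (cA w) @ Bs (Suc (cB w))))"
      using whisker_bij[of "[]" "B # As (cA w)" "As (cA w) @ [B]" "Bs (cB w)" "cross (cA w)"] cross_hom cross_bij by simp
    show ?thesis
      using False bij_betw_trans[OF 1 2] by (simp add: srt.simps(2)[abs_def] comp_def)
  qed
qed

lemma srt_inj: "srt w x = srt w y \<Longrightarrow> x \<in> C (wd w) \<Longrightarrow> y \<in> C (wd w) \<Longrightarrow> x = y"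
  using srt_bij[of w] by (auto simp: bij_betw_def inj_on_def)

text \<open>The induction step for statements about sorting: a square relating the sortings of \<open>w\<close> and \<open>w'\<close> remains
  one when a letter is put in front.\<close>

lemma srt_prefix_natural:
  assumes f: "f \<in> Hom (wd w) (wd w')" and g: "g \<in> Hom (sorted_mods w) (sorted_mods w')"
    and eq: "\<And>x. x \<in> C (wd w) \<Longrightarrow> srt w' (f x) = g (srt w x)"
    and x: "x \<in> C (X # wd w)" and X: "module K X"
  shows "W [X] (wd w') (sorted_mods w') [] (srt w') (W [X] (wd w) (wd w') [] f x) =
    W [X] (sorted_mods w) (sorted_mods w') [] g (W [X] (wd w) (sorted_mods w) [] (srt w) x)"
proof -
  have "W [X] (wd w') (sorted_mods w') [] (srt w') (W [X] (wd w) (wd w') [] f x) =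
      W [X] (wd w) (sorted_mods w') [] (\<lambda>x. srt w' (f x)) x"
    by (rule whisker_comp[where F=f and G="srt w'"]) (use X f srt_hom x in simp_all)
  also have "\<dots> = W [X] (wd w) (sorted_mods w') [] (\<lambda>x. g (srt w x)) x"
    by (rule whisker_cong[OF _ _ _ _ lin_maps_comp[OF srt_hom g] eq]) (use X x in simp_all)
  also have "\<dots> = W [X] (sorted_mods w) (sorted_mods w') [] g (W [X] (wd w) (sorted_mods w) [] (srt w) x)"
    by (rule whisker_comp[symmetric, where F="srt w" and G=g]) (use X g srt_hom x in simp_all)
  finally show ?thesis .
qed

text \<open>The first move of \<open>B\<close> in the word \<open>B A v\<close> is the crossing of the visible \<open>A\<close>. It happens after \<open>v\<close>
  has been sorted, but may as well happen before, by the interchange rule.\<close>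

lemma srt_step_front:
  assumes x: "x \<in> C (B # A # wd v)"
  shows "srt (True # False # v) (W [] [B, A] [A, B] (wd v) R x) = srt (False # True # v) x"
proof -
  let ?k = "cA v" and ?l = "cB v"
  let ?y = "W [] [B, A] [A, B] (wd v) R x"
  let ?z = "W [B, A] (wd v) (sorted_mods v) [] (srt v) x"
  note [simp] = srt_hom cross_hom
  have y: "?y \<in> C (A # B # wd v)"
    by (rule whisker_closed[where Ms="[B, A]"]) (use x in simp_all)
  have z: "?z \<in> C (B # A # sorted_mods v)"
    by (rule whisker_closed[where Ms="wd v"]) (use x in simp_all)
  have h1: "W [B] (wd v) (sorted_mods v) [] (srt v) \<in> Hom (B # wd v) (B # sorted_mods v)"
    by (rule whisker_hom) simp_all
  have h2: "W [] (B # As ?k) (As ?k @ [B]) (Bs ?l) (cross ?k) \<in> Hom (B # sorted_mods v) (As ?k @ B # Bs ?l)"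
    by (rule whisker_hom) simp_all
  have "srt (True # False # v) ?y = W [A] (B # wd v) (As ?k @ B # Bs ?l) []
      (\<lambda>z. W [] (B # As ?k) (As ?k @ [B]) (Bs ?l) (cross ?k) (W [B] (wd v) (sorted_mods v) [] (srt v) z)) ?y"
    by (simp add: srt.simps(2)[abs_def])
  also have "\<dots> = W [A] (B # sorted_mods v) (As ?k @ B # Bs ?l) [] (W [] (B # As ?k) (As ?k @ [B]) (Bs ?l) (cross ?k))
      (W [A] (B # wd v) (B # sorted_mods v) [] (W [B] (wd v) (sorted_mods v) [] (srt v)) ?y)"
    by (rule whisker_comp[symmetric, OF _ _ _ _ _ h1 h2]) (use y in simp_all)
  also have "W [A] (B # wd v) (B # sorted_mods v) [] (W [B] (wd v) (sorted_mods v) [] (srt v)) ?y =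
      W [A, B] (wd v) (sorted_mods v) [] (srt v) ?y"
    using whisker_whisker[of "[A]" "[B]" "wd v" "sorted_mods v" "[]" "[]" "srt v" ?y] y by simp
  also have "\<dots> = W [] [B, A] [A, B] (sorted_mods v) R ?z"
    using whisker_interchange[of "[]" "[B, A]" "[A, B]" "[]" "wd v" "sorted_mods v" "[]" R "srt v" x] x by simp
  also have "W [A] (B # sorted_mods v) (As ?k @ B # Bs ?l) [] (W [] (B # As ?k) (As ?k @ [B]) (Bs ?l) (cross ?k))
       (W [] [B, A] [A, B] (sorted_mods v) R ?z) =
     W [A] (B # As ?k) (As ?k @ [B]) (Bs ?l) (cross ?k) (W [] [B, A] [A, B] (sorted_mods v) R ?z)"
    using whisker_whisker[of "[A]" "[]" "B # As ?k" "As ?k @ [B]" "Bs ?l" "[]" "cross ?k" "W [] [B, A] [A, B] (sorted_mods v) R ?z"] z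
    by (simp add: whisker_closed[where Ms="[B, A]" and Ns="[A, B]" and Vs="sorted_mods v"])
  finally have L: "srt (True # False # v) ?y =
    W [A] (B # As ?k) (As ?k @ [B]) (Bs ?l) (cross ?k) (W [] [B, A] [A, B] (sorted_mods v) R ?z)" .
  have h3: "W [] [B, A] [A, B] (As ?k) R \<in> Hom (B # A # As ?k) (A # B # As ?k)"
    by (rule whisker_hom) simp_all
  have h4: "W [A] (B # As ?k) (As ?k @ [B]) [] (cross ?k) \<in> Hom (A # B # As ?k) (A # As ?k @ [B])"
    by (rule whisker_hom) simp_all
  have "srt (False # True # v) x = W [] (B # A # As ?k) (A # As ?k @ [B]) (Bs ?l) (cross (Suc ?k))
      (W [B] (A # wd v) (A # sorted_mods v) [] (W [A] (wd v) (sorted_mods v) [] (srt v)) x)"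
    by (simp add: srt.simps(2)[abs_def])
  also have "W [B] (A # wd v) (A # sorted_mods v) [] (W [A] (wd v) (sorted_mods v) [] (srt v)) x = ?z"
    using whisker_whisker[of "[B]" "[A]" "wd v" "sorted_mods v" "[]" "[]" "srt v" x] x by simp
  also have "W [] (B # A # As ?k) (A # As ?k @ [B]) (Bs ?l) (cross (Suc ?k)) ?z =
     W [] (B # A # As ?k) (A # As ?k @ [B]) (Bs ?l) (\<lambda>x. W [A] (B # As ?k) (As ?k @ [B]) [] (cross ?k) (W [] [B, A] [A, B] (As ?k) R x)) ?z"
    by (simp add: cross.simps(2)[abs_def])
  also have "\<dots> = W [] (A # B # As ?k) (A # As ?k @ [B]) (Bs ?l) (W [A] (B # As ?k) (As ?k @ [B]) [] (cross ?k))
      (W [] (B # A # As ?k) (A # B # As ?k) (Bs ?l) (W [] [B, A] [A, B] (As ?k) R) ?z)"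
    by (rule whisker_comp[symmetric, OF _ _ _ _ _ h3 h4]) (use z in simp_all)
  also have "W [] (B # A # As ?k) (A # B # As ?k) (Bs ?l) (W [] [B, A] [A, B] (As ?k) R) ?z = W [] [B, A] [A, B] (sorted_mods v) R ?z"
    using whisker_whisker[of "[]" "[]" "[B, A]" "[A, B]" "As ?k" "Bs ?l" R ?z] z by simp
  also have "W [] (A # B # As ?k) (A # As ?k @ [B]) (Bs ?l) (W [A] (B # As ?k) (As ?k @ [B]) [] (cross ?k)) (W [] [B, A] [A, B] (sorted_mods v) R ?z)
     = W [A] (B # As ?k) (As ?k @ [B]) (Bs ?l) (cross ?k) (W [] [B, A] [A, B] (sorted_mods v) R ?z)"
    using whisker_whisker[of "[]" "[A]" "B # As ?k" "As ?k @ [B]" "[]" "Bs ?l" "cross ?k" "W [] [B, A] [A, B] (sorted_mods v) R ?z"] z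
    by (simp add: whisker_closed[where Ms="[B, A]" and Ns="[A, B]" and Vs="sorted_mods v"])
  finally show ?thesis using L by simp
qed

text \<open>A move does not change the sorted form. This is the confluence of the moves.\<close>

lemma srt_step:
  "x \<in> C (wd (u @ [False, True] @ v)) \<Longrightarrow>
    srt (u @ [True, False] @ v) (W (wd u) [B, A] [A, B] (wd v) R x) = srt (u @ [False, True] @ v) x"
proof (induction u arbitrary: x)
  case Nil
  then show ?case using srt_step_front by simp
next
  case (Cons c u)
  let ?w = "u @ [False, True] @ v" and ?w' = "u @ [True, False] @ v"
  define X where "X = (if c then A else B)"
  have [simp]: "module K X" by (simp add: X_def)
  have wX: "wd (c # w) = X # wd w" for w by (cases c) (simp_all add: X_def)
  have h: "W (wd u) [B, A] [A, B] (wd v) R \<in> Hom (wd ?w) (wd ?w')"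
    by (rule whisker_hom) simp_all
  have x: "x \<in> C (X # wd ?w)" using Cons.prems wX[of ?w] by simp
  have 1: "W (wd (c # u)) [B, A] [A, B] (wd v) R x = W [X] (wd ?w) (wd ?w') [] (W (wd u) [B, A] [A, B] (wd v) R) x"
    using whisker_whisker[of "[X]" "wd u" "[B, A]" "[A, B]" "wd v" "[]" R x] x by (simp add: wX)
  have id: "(\<lambda>x. x) \<in> Hom (sorted_mods ?w) (sorted_mods ?w')" using lin_maps_id by (simp add: lin_maps_def)
  have "W [X] (sorted_mods ?w) (sorted_mods ?w') [] (\<lambda>x. x) (W [X] (wd ?w) (sorted_mods ?w) [] (srt ?w) x) =
      W [X] (wd ?w) (sorted_mods ?w) [] (srt ?w) x"
    using whisker_id[of "[X]" "sorted_mods ?w" "[]" "\<lambda>x. x"]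
      whisker_closed[of "[X]" "wd ?w" "sorted_mods ?w" "[]" "srt ?w" x] x srt_hom[of ?w]
    by simp
  with srt_prefix_natural[OF h id Cons.IH x]
  have "W [X] (wd ?w') (sorted_mods ?w') [] (srt ?w') (W [X] (wd ?w) (wd ?w') [] (W (wd u) [B, A] [A, B] (wd v) R) x)
      = W [X] (wd ?w) (sorted_mods ?w) [] (srt ?w) x" by simp
  then show ?case
    unfolding 1 by (cases c) (simp_all add: X_def del: replicate_Suc)
qed

section \<open>Rearrangements and their uniqueness\<close>

definition R_back :: "('x, 'k) tens \<Rightarrow> ('x, 'k) tens" where
  "R_back = inv_into (C [B, A]) R"

lemma R_back_R [simp]: "x \<in> C [B, A] \<Longrightarrow> R_back (R x) = x"
  using R_bijective by (simp add: R_back_def bij_betw_def)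

lemma R_R_back [simp]: "x \<in> C [A, B] \<Longrightarrow> R (R_back x) = x"
  using R_bijective by (simp add: R_back_def bij_betw_def f_inv_into_f)

lemma R_back_hom [simp]: "R_back \<in> Hom [A, B] [B, A]"
  by (rule lin_maps_inverse[OF R_hom R_bijective]) (simp_all add: tensor_module)

text \<open>The rule \<open>ext\<close> is there because whiskerings are determined on the carrier only.\<close>

inductive rearr :: "bool list \<Rightarrow> bool list \<Rightarrow> (('x, 'k) tens \<Rightarrow> ('x, 'k) tens) \<Rightarrow> bool" where
  refl: "rearr u u (\<lambda>x. x)"
| fwd: "rearr (u @ [False, True] @ v) (u @ [True, False] @ v) (W (wd u) [B, A] [A, B] (wd v) R)"
| bwd: "rearr (u @ [True, False] @ v) (u @ [False, True] @ v) (W (wd u) [A, B] [B, A] (wd v) R_back)"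
| comp: "rearr u v f \<Longrightarrow> rearr v w g \<Longrightarrow> rearr u w (\<lambda>x. g (f x))"
| ext: "rearr u v f \<Longrightarrow> (\<And>x. x \<in> C (wd u) \<Longrightarrow> g x = f x) \<Longrightarrow> rearr u v g"

lemma rearr_hom: "rearr u v f \<Longrightarrow> f \<in> Hom (wd u) (wd v)"
proof (induction rule: rearr.induct)
  case (refl u)
  then show ?case by (rule lin_maps_id)
next
  case (fwd u v)
  then show ?case by (intro whisker_hom) simp_all
next
  case (bwd u v)
  then show ?case by (intro whisker_hom) simp_all
next
  case (comp u v f w g)
  show ?case by (rule lin_maps_comp[OF comp.IH])
next
  case (ext u v f g)
  show ?case by (rule lin_maps_cong[OF ext.IH tensor_module]) (simp_all add: ext.hyps)
qed

lemma rearr_closed: "rearr u v f \<Longrightarrow> x \<in> C (wd u) \<Longrightarrow> f x \<in> C (wd v)"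
  using lin_maps_closed[OF rearr_hom] .

text \<open>Each move, and hence each inverse move, preserves the sorted form.\<close>

lemma rearr_srt: "rearr u v f \<Longrightarrow> x \<in> C (wd u) \<Longrightarrow> srt v (f x) = srt u x"
proof (induction arbitrary: x rule: rearr.induct)
  case (fwd u v)
  then show ?case by (rule srt_step)
next
  case (bwd u v)
  let ?y = "W (wd u) [A, B] [B, A] (wd v) R_back x"
  have y: "?y \<in> C (wd (u @ [False, True] @ v))"
    by (rule whisker_closed[where Ms="[A, B]"]) (use bwd in simp_all)
  have "W (wd u) [B, A] [A, B] (wd v) R ?y = W (wd u) [A, B] [A, B] (wd v) (\<lambda>x. R (R_back x)) x"
    by (rule whisker_comp[OF _ _ _ _ _ R_back_hom R_hom]) (use bwd in simp_all)
  also have "\<dots> = x" by (rule whisker_id) (use bwd in simp_all)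
  finally show ?case using srt_step[OF y] by simp
next
  case (comp u v f w g)
  then show ?case using rearr_closed[OF comp.hyps(1)] by simp
qed auto

lemma rearr_whisker:
  "rearr m n F \<Longrightarrow> rearr (u @ m @ v) (u @ n @ v) (W (wd u) (wd m) (wd n) (wd v) F)"
proof (induction rule: rearr.induct)
  case (refl m)
  show ?case
    by (rule rearr.ext[OF rearr.refl]) (simp add: whisker_id)
next
  case (fwd p q)
  show ?case
  proof (rule rearr.ext)
    show "rearr (u @ (p @ [False, True] @ q) @ v) (u @ (p @ [True, False] @ q) @ v) (W (wd (u @ p)) [B, A] [A, B] (wd (q @ v)) R)"
      using rearr.fwd[of "u @ p" "q @ v"] by simp
    show "W (wd u) (wd (p @ [False, True] @ q)) (wd (p @ [True, False] @ q)) (wd v) (W (wd p) [B, A] [A, B] (wd q) R) x =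
        W (wd (u @ p)) [B, A] [A, B] (wd (q @ v)) R x" if "x \<in> C (wd (u @ (p @ [False, True] @ q) @ v))" for x
      using whisker_whisker[of "wd u" "wd p" "[B, A]" "[A, B]" "wd q" "wd v" R x] that by simp
  qed
next
  case (bwd p q)
  show ?case
  proof (rule rearr.ext)
    show "rearr (u @ (p @ [True, False] @ q) @ v) (u @ (p @ [False, True] @ q) @ v) (W (wd (u @ p)) [A, B] [B, A] (wd (q @ v)) R_back)"
      using rearr.bwd[of "u @ p" "q @ v"] by simp
    show "W (wd u) (wd (p @ [True, False] @ q)) (wd (p @ [False, True] @ q)) (wd v) (W (wd p) [A, B] [B, A] (wd q) R_back) x =
        W (wd (u @ p)) [A, B] [B, A] (wd (q @ v)) R_back x" if "x \<in> C (wd (u @ (p @ [True, False] @ q) @ v))" for x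
      using whisker_whisker[of "wd u" "wd p" "[A, B]" "[B, A]" "wd q" "wd v" R_back x] that by simp
  qed
next
  case (comp m n f k g)
  show ?case
  proof (rule rearr.ext[OF rearr.comp[OF comp.IH]])
    fix x assume "x \<in> C (wd (u @ m @ v))"
    then show "W (wd u) (wd m) (wd k) (wd v) (\<lambda>x. g (f x)) x = W (wd u) (wd n) (wd k) (wd v) g (W (wd u) (wd m) (wd n) (wd v) f x)"
      by (intro whisker_comp[OF _ _ _ _ _ rearr_hom[OF comp.hyps(1)] rearr_hom[OF comp.hyps(2)], symmetric]) simp_all
  qed
next
  case (ext m n f g)
  show ?case
  proof (rule rearr.ext[OF ext.IH])
    fix x assume "x \<in> C (wd (u @ m @ v))"
    then show "W (wd u) (wd m) (wd n) (wd v) g x = W (wd u) (wd m) (wd n) (wd v) f x"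
      by (intro whisker_cong[OF _ _ _ _ rearr_hom[OF ext.hyps(1)] ext.hyps(2)]) simp_all
  qed
qed

text \<open>Coherence: two rearrangements with the same source and target have the same composite with the
  injective sorting map.\<close>

lemma rearr_unique:
  "rearr u v f \<Longrightarrow> rearr u v g \<Longrightarrow> x \<in> C (wd u) \<Longrightarrow> f x = g x"
  by (rule srt_inj[of v]) (simp_all add: rearr_srt rearr_closed)

lemma rearr_cross: "rearr (False # Ts k) (Ts k @ [False]) (cross k)"
proof (induction k)
  case 0
  show ?case using rearr.refl[of "[False]"] by simp
next
  case (Suc k)
  have "rearr (False # Ts (Suc k)) (True # False # Ts k) (W [] [B, A] [A, B] (As k) R)"
    using rearr.fwd[of "[]" "Ts k"] by simp
  moreover have "rearr (True # False # Ts k) (Ts (Suc k) @ [False]) (W [A] (B # As k) (As k @ [B]) [] (cross k))"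
    using rearr_whisker[OF Suc, of "[True]" "[]"] by simp
  ultimately show ?case
    unfolding cross.simps(2)[abs_def] by (rule rearr.comp)
qed

lemma rearr_sort: "rearr w (sorted_word w) (srt w)"
proof (induction w)
  case Nil
  show ?case using rearr.refl[of "[]"] by simp
next
  case (Cons c w)
  show ?case
  proof (cases c)
    case True
    with rearr_whisker[OF Cons, of "[True]" "[]"] show ?thesis by (simp add: srt.simps(2)[abs_def])
  next
    case False
    have "rearr (False # w) (False # sorted_word w) (W [B] (wd w) (sorted_mods w) [] (srt w))"
      using rearr_whisker[OF Cons, of "[False]" "[]"] by simp
    moreover have "rearr (False # sorted_word w) (Ts (cA w) @ Fs (Suc (cB w)))
      (W [] (B # As (cA w)) (As (cA w) @ [B]) (Bs (cB w)) (cross (cA w)))"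
      using rearr_whisker[OF rearr_cross, of "[]" "cA w" "Fs (cB w)"] by simp
    ultimately have "rearr (False # w) (Ts (cA w) @ Fs (Suc (cB w)))
      (\<lambda>x. W [] (B # As (cA w)) (As (cA w) @ [B]) (Bs (cB w)) (cross (cA w)) (W [B] (wd w) (sorted_mods w) [] (srt w) x))"
      by (rule rearr.comp)
    then show ?thesis using False by (simp add: srt.simps(2)[abs_def])
  qed
qed

text \<open>Sorting a sorted word is the identity, so every rearrangement into a sorted word is the sorting map.\<close>

lemma cross_none: "cross 0 = (\<lambda>x. x)"
  by (simp add: fun_eq_iff)

lemma srt_replicate_False: "x \<in> C (Bs l) \<Longrightarrow> srt (Fs l) x = x"
proof (induction l arbitrary: x)
  case (Suc l)
  have "W [B] (Bs l) (Bs l) [] (srt (Fs l)) x = x"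
    by (rule whisker_id) (use Suc in simp_all)
  moreover have "W [] [B] [B] (Bs l) (\<lambda>x. x) x = x"
    by (rule whisker_id) (use Suc in simp_all)
  ultimately show ?case by (simp add: cross_none)
qed simp

lemma srt_sorted: "x \<in> C (As k @ Bs l) \<Longrightarrow> srt (Ts k @ Fs l) x = x"
proof (induction k arbitrary: x)
  case 0
  then show ?case by (simp add: srt_replicate_False)
next
  case (Suc k)
  have "W [A] (As k @ Bs l) (As k @ Bs l) [] (srt (Ts k @ Fs l)) x = x"
    by (rule whisker_id) (use Suc in simp_all)
  then show ?case by simp
qed

lemma rearr_eq_srt:
  assumes "rearr w (Ts k @ Fs l) f" "x \<in> C (wd w)"
  shows "f x = srt w x"
  using rearr_srt[OF assms] srt_sorted[of "f x" k l] rearr_closed[OF assms] by simp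

section \<open>Sorting commutes with operations on letters of one kind\<close>

text \<open>Isolates the crossing of a middle block of \<open>p\<close> letters. Both sides are rearrangements between the
  same words.\<close>

lemma cross_split3:
  assumes x: "x \<in> C (B # As i @ As p @ As j)"
  shows "cross (i + p + j) x =
    W (As i @ As p) (B # As j) (As j @ [B]) [] (cross j)
      (W (As i) (B # As p) (As p @ [B]) (As j) (cross p)
        (W [] (B # As i) (As i @ [B]) (As p @ As j) (cross i) x))"
proof -
  have 1: "rearr (False # Ts (i + p + j)) (Ts i @ False # Ts p @ Ts j) (W [] (B # As i) (As i @ [B]) (As p @ As j) (cross i))"
    using rearr_whisker[OF rearr_cross[of i], of "[]" "Ts p @ Ts j"] by (simp add: replicate_add)
  have 2: "rearr (Ts i @ False # Ts p @ Ts j) (Ts i @ Ts p @ False # Ts j) (W (As i) (B # As p) (As p @ [B]) (As j) (cross p))"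
    using rearr_whisker[OF rearr_cross[of p], of "Ts i" "Ts j"] by simp
  have 3: "rearr (Ts i @ Ts p @ False # Ts j) (Ts (i + p + j) @ [False]) (W (As i @ As p) (B # As j) (As j @ [B]) [] (cross j))"
    using rearr_whisker[OF rearr_cross[of j], of "Ts i @ Ts p" "[]"] by (simp add: replicate_add)
  have "x \<in> C (wd (False # Ts (i + p + j)))" using x by (simp add: replicate_add)
  from rearr_unique[OF rearr_cross rearr.comp[OF rearr.comp[OF 1 2] 3] this] show ?thesis .
qed

text \<open>A map \<open>A\<^sup>p \<rightarrow> A\<^sup>q\<close> past which a single \<open>B\<close> can be moved. The product, with \<open>p = 2\<close> and \<open>q = 1\<close>, and the unit,
  with \<open>p = 0\<close> and \<open>q = 1\<close>, are of this kind.\<close>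

context
  fixes p q :: nat and F :: "('x, 'k) tens \<Rightarrow> ('x, 'k) tens"
  assumes F: "F \<in> Hom (As p) (As q)"
    and slide_A: "\<And>x. x \<in> C (B # As p) \<Longrightarrow> cross q (W [B] (As p) (As q) [] F x) = W [] (As p) (As q) [B] F (cross p x)"
begin

text \<open>The letters before and after the block are crossed independently of the operation on the block.\<close>

lemma cross_natural:
  assumes x: "x \<in> C (B # As i @ As p @ As j)"
  shows "cross (i + q + j) (W (B # As i) (As p) (As q) (As j) F x) =
    W (As i) (As p) (As q) (As j @ [B]) F (cross (i + p + j) x)"
proof -
  note [simp] = F cross_hom
  let ?x1 = "W [] (B # As i) (As i @ [B]) (As p @ As j) (cross i) x"
  let ?x2 = "W (As i) (B # As p) (As p @ [B]) (As j) (cross p) ?x1"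
  have x1: "?x1 \<in> C (As i @ B # As p @ As j)"
    by (rule whisker_closed[where Ms="B # As i"]) (use x in simp_all)
  have x2: "?x2 \<in> C (As i @ As p @ B # As j)"
    by (rule whisker_closed[where Ms="B # As p"]) (use x1 in simp_all)
  have y: "W (B # As i) (As p) (As q) (As j) F x \<in> C (B # As i @ As q @ As j)"
    by (rule whisker_closed[where Ms="As p"]) (use x in simp_all)
  have h1: "W [B] (As p) (As q) [] F \<in> Hom (B # As p) (B # As q)"
    "W [] (As p) (As q) [B] F \<in> Hom (As p @ [B]) (As q @ [B])"
    by (rule whisker_hom; simp)+
  have "W [] (B # As i) (As i @ [B]) (As q @ As j) (cross i) (W (B # As i) (As p) (As q) (As j) F x) =
      W (As i @ [B]) (As p) (As q) (As j) F ?x1" (is "?L1 = _")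
    using whisker_interchange[of "[]" "B # As i" "As i @ [B]" "[]" "As p" "As q" "As j" "cross i" F x] x by simp
  also have "\<dots> = W (As i) (B # As p) (B # As q) (As j) (W [B] (As p) (As q) [] F) ?x1" (is "_ = ?R1")
    using whisker_whisker[of "As i" "[B]" "As p" "As q" "[]" "As j" F ?x1] x1 by simp
  finally have chain1: "?L1 = ?R1" .
  have "W (As i) (B # As q) (As q @ [B]) (As j) (cross q) ?L1 = W (As i) (B # As q) (As q @ [B]) (As j) (cross q) ?R1" (is "?L2 = _") by (simp only: chain1)
  also have "W (As i) (B # As q) (As q @ [B]) (As j) (cross q) ?R1 =
      W (As i) (As p @ [B]) (As q @ [B]) (As j) (W [] (As p) (As q) [B] F) ?x2"
    by (rule whisker_square) (use x1 slide_A h1 in simp_all)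
  also have "\<dots> = W (As i) (As p) (As q) (B # As j) F ?x2" (is "_ = ?R2")
    using whisker_whisker[of "As i" "[]" "As p" "As q" "[B]" "As j" F ?x2] x2 by simp
  finally have chain2: "?L2 = ?R2" .
  have "W (As i @ As q) (B # As j) (As j @ [B]) [] (cross j) ?L2 = W (As i @ As q) (B # As j) (As j @ [B]) [] (cross j) ?R2" by (simp only: chain2)
  also have "W (As i @ As q) (B # As j) (As j @ [B]) [] (cross j) ?R2 =
      W (As i) (As p) (As q) (As j @ [B]) F (W (As i @ As p) (B # As j) (As j @ [B]) [] (cross j) ?x2)"
    using whisker_interchange[of "As i" "As p" "As q" "[]" "B # As j" "As j @ [B]" "[]" F "cross j" ?x2] x2 by simp
  finally show ?thesis
    using cross_split3[OF x] cross_split3[OF y] by simp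
qed

text \<open>By induction on the letters in front of the block: a letter \<open>A\<close> stays where it is, while a letter \<open>B\<close>
  crosses the block, which is the preceding lemma.\<close>

lemma srt_natural_A:
  "x \<in> C (wd (u @ Ts p @ v)) \<Longrightarrow>
    srt (u @ Ts q @ v) (W (wd u) (As p) (As q) (wd v) F x) =
    W (As (cA u)) (As p) (As q) (As (cA v) @ Bs (cB u) @ Bs (cB v)) F (srt (u @ Ts p @ v) x)"
proof (induction u arbitrary: x)
  case Nil
  have s: "srt (Ts n @ v) y = W (As n) (wd v) (sorted_mods v) [] (srt v) y"
    if "y \<in> C (As n @ wd v)" for n y
  proof (rule rearr_eq_srt[symmetric])
    show "rearr (Ts n @ v) (Ts (n + cA v) @ Fs (cB v)) (W (As n) (wd v) (sorted_mods v) [] (srt v))"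
      using rearr_whisker[OF rearr_sort[of v], of "Ts n" "[]"] by (simp add: replicate_add)
  qed (use that in simp)
  have y: "W [] (As p) (As q) (wd v) F x \<in> C (As q @ wd v)"
    by (rule whisker_closed[where Ms="As p"]) (use Nil F in simp_all)
  show ?case
    using Nil F srt_hom[of v] s[of x p] s[OF y]
      whisker_interchange[of "[]" "As p" "As q" "[]" "wd v" "sorted_mods v" "[]" F "srt v" x] by simp
next
  case (Cons c u)
  let ?w = "u @ Ts p @ v" and ?w' = "u @ Ts q @ v"
  define X where "X = (if c then A else B)"
  have [simp]: "module K X" by (simp add: X_def)
  have wX: "wd (c # w) = X # wd w" for w by (cases c) (simp_all add: X_def)
  let ?f = "W (wd u) (As p) (As q) (wd v) F"
  let ?g = "W (As (cA u)) (As p) (As q) (As (cA v) @ Bs (cB u) @ Bs (cB v)) F"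
  note [simp] = F cross_hom
  have f: "?f \<in> Hom (wd ?w) (wd ?w')" by (rule whisker_hom) simp_all
  have g: "?g \<in> Hom (sorted_mods ?w) (sorted_mods ?w')" by (rule whisker_hom) (simp_all add: replicate_add)
  have x: "x \<in> C (X # wd ?w)" using Cons.prems wX[of ?w] by simp
  let ?z = "W [X] (wd ?w) (sorted_mods ?w) [] (srt ?w) x"
  have z: "?z \<in> C (X # sorted_mods ?w)"
    by (rule whisker_closed[where Ms="wd ?w"]) (use x srt_hom[of ?w] in simp_all)
  have 1: "W (wd (c # u)) (As p) (As q) (wd v) F x = W [X] (wd ?w) (wd ?w') [] ?f x"
    using whisker_whisker[of "[X]" "wd u" "As p" "As q" "wd v" "[]" F x] x by (simp add: wX)
  have 2: "W [X] (wd ?w') (sorted_mods ?w') [] (srt ?w') (W [X] (wd ?w) (wd ?w') [] ?f x) =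
      W [X] (sorted_mods ?w) (sorted_mods ?w') [] ?g ?z"
    by (rule srt_prefix_natural[OF f g Cons.IH x]) simp_all
  also have 3: "\<dots> = W (X # As (cA u)) (As p) (As q) (As (cA v) @ Bs (cB u) @ Bs (cB v)) F ?z"
    using whisker_whisker[of "[X]" "As (cA u)" "As p" "As q" "As (cA v) @ Bs (cB u) @ Bs (cB v)" "[]" F ?z] z
    by (simp add: replicate_add)
  finally have 4: "W [X] (wd ?w') (sorted_mods ?w') [] (srt ?w') (W [X] (wd ?w) (wd ?w') [] ?f x) =
    W (X # As (cA u)) (As p) (As q) (As (cA v) @ Bs (cB u) @ Bs (cB v)) F ?z" .
  show ?case
  proof (cases c)
    case True
    with 4 show ?thesis unfolding 1 by (simp add: X_def)
  next
    case False
    then have XB: "X = B" by (simp add: X_def)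
    let ?l = "Bs (cB u) @ Bs (cB v)"
    let ?i = "As (cA u)" and ?j = "As (cA v)"
    let ?n = "cA u + p + cA v" and ?n' = "cA u + q + cA v"
    have zB: "?z \<in> C (B # ?i @ As p @ ?j @ ?l)" using z by (simp add: XB replicate_add)
    have h: "W (B # ?i) (As p) (As q) ?j F \<in> Hom (B # ?i @ As p @ ?j) (B # ?i @ As q @ ?j)"
      "W ?i (As p) (As q) (?j @ [B]) F \<in> Hom (?i @ As p @ ?j @ [B]) (?i @ As q @ ?j @ [B])"
      by (rule whisker_hom; simp)+
    have h': "cross ?n \<in> Hom (B # ?i @ As p @ ?j) (?i @ As p @ ?j @ [B])"
      "cross ?n' \<in> Hom (B # ?i @ As q @ ?j) (?i @ As q @ ?j @ [B])"
      using cross_hom[of ?n] cross_hom[of ?n'] by (simp_all add: replicate_add del: cross_hom)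
    let ?s = "W [] (B # ?i @ As p @ ?j) (?i @ As p @ ?j @ [B]) ?l (cross ?n) ?z"
    have s: "?s \<in> C (?i @ As p @ ?j @ B # ?l)"
      by (rule whisker_closed[where Ms="B # ?i @ As p @ ?j"]) (use zB h' in simp_all)
    have "W (B # ?i) (As p) (As q) (?j @ ?l) F ?z = W [] (B # ?i @ As p @ ?j) (B # ?i @ As q @ ?j) ?l (W (B # ?i) (As p) (As q) ?j F) ?z" (is "?L3 = ?R3")
      using whisker_whisker[of "[]" "B # ?i" "As p" "As q" ?j ?l F ?z] zB by simp
    then have chain3: "?L3 = ?R3" .
    have "W [] (B # ?i @ As q @ ?j) (?i @ As q @ ?j @ [B]) ?l (cross ?n') ?L3 = W [] (B # ?i @ As q @ ?j) (?i @ As q @ ?j @ [B]) ?l (cross ?n') ?R3" by (simp only: chain3)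
    also have "W [] (B # ?i @ As q @ ?j) (?i @ As q @ ?j @ [B]) ?l (cross ?n') ?R3 =
      W [] (?i @ As p @ ?j @ [B]) (?i @ As q @ ?j @ [B]) ?l (W ?i (As p) (As q) (?j @ [B]) F) ?s"
      by (rule whisker_square) (use zB h h' cross_natural in simp_all)
    also have "\<dots> = W ?i (As p) (As q) (?j @ B # ?l) F ?s"
      using whisker_whisker[of "[]" ?i "As p" "As q" "?j @ [B]" ?l F ?s] s by simp
    finally have 5: "W [] (B # ?i @ As q @ ?j) (?i @ As q @ ?j @ [B]) ?l (cross ?n') (W (B # ?i) (As p) (As q) (?j @ ?l) F ?z) =
      W ?i (As p) (As q) (?j @ B # ?l) F ?s" .
    show ?thesis unfolding 1 using 4 5 False XB
      by (simp add: replicate_add add.assoc)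
  qed
qed

end

text \<open>A map \<open>B\<^sup>p \<rightarrow> B\<^sup>q\<close> that can be moved past a single \<open>A\<close>.\<close>

context
  fixes p q :: nat and G :: "('x, 'k) tens \<Rightarrow> ('x, 'k) tens"
  assumes G: "G \<in> Hom (Bs p) (Bs q)"
    and slide_B: "\<And>x. x \<in> C (Bs p @ [A]) \<Longrightarrow>
      srt (Fs q @ [True]) (W [] (Bs p) (Bs q) [A] G x) = W [A] (Bs p) (Bs q) [] G (srt (Fs p @ [True]) x)"
begin

text \<open>The assumption on \<open>G\<close> concerns one letter \<open>A\<close>. For several of them, the block is moved past one after
  the other.\<close>

lemma srt_natural_B_block:
  "x \<in> C (Bs p @ As k) \<Longrightarrow>
    srt (Fs q @ Ts k) (W [] (Bs p) (Bs q) (As k) G x) =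
    W (As k) (Bs p) (Bs q) [] G (srt (Fs p @ Ts k) x)"
proof (induction k arbitrary: x)
  case 0
  have "W [] (Bs p) (Bs q) [] G x \<in> C (Bs q)"
    by (rule whisker_closed[where Ms="Bs p"]) (use 0 G in simp_all)
  with 0 show ?case by (simp add: srt_replicate_False)
next
  case (Suc k)
  note [simp] = G
  have s: "srt (Fs n @ True # Ts k) y = W [A] (Bs n @ As k) (As k @ Bs n) [] (srt (Fs n @ Ts k))
      (W [] (Bs n @ [A]) (A # Bs n) (As k) (srt (Fs n @ [True])) y)"
    if "y \<in> C (Bs n @ A # As k)" for n y
  proof (rule rearr_eq_srt[symmetric])
    have 1: "rearr (Fs n @ True # Ts k) (True # Fs n @ Ts k) (W [] (Bs n @ [A]) (A # Bs n) (As k) (srt (Fs n @ [True])))"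
      using rearr_whisker[OF rearr_sort[of "Fs n @ [True]"], of "[]" "Ts k"] by simp
    have 2: "rearr (True # Fs n @ Ts k) (True # Ts k @ Fs n) (W [A] (Bs n @ As k) (As k @ Bs n) [] (srt (Fs n @ Ts k)))"
      using rearr_whisker[OF rearr_sort[of "Fs n @ Ts k"], of "[True]" "[]"] by simp
    show "rearr (Fs n @ True # Ts k) (Ts (Suc k) @ Fs n) (\<lambda>y. W [A] (Bs n @ As k) (As k @ Bs n) [] (srt (Fs n @ Ts k))
      (W [] (Bs n @ [A]) (A # Bs n) (As k) (srt (Fs n @ [True])) y))"
      using rearr.comp[OF 1 2] by simp
  qed (use that in simp)
  have x: "x \<in> C (Bs p @ A # As k)" using Suc.prems by simp
  have y: "W [] (Bs p) (Bs q) (A # As k) G x \<in> C (Bs q @ A # As k)"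
    by (rule whisker_closed[where Ms="Bs p"]) (use x in simp_all)
  have S: "srt (Fs n @ [True]) \<in> Hom (Bs n @ [A]) (A # Bs n)" "srt (Fs n @ Ts k) \<in> Hom (Bs n @ As k) (As k @ Bs n)" for n
    using srt_hom[of "Fs n @ [True]"] srt_hom[of "Fs n @ Ts k"] by simp_all
  let ?x1 = "W [] (Bs p @ [A]) (A # Bs p) (As k) (srt (Fs p @ [True])) x"
  let ?x2 = "W [A] (Bs p @ As k) (As k @ Bs p) [] (srt (Fs p @ Ts k)) ?x1"
  have x1: "?x1 \<in> C (A # Bs p @ As k)" by (rule whisker_closed[where Ms="Bs p @ [A]"]) (use x S in simp_all)
  have x2: "?x2 \<in> C (A # As k @ Bs p)" by (rule whisker_closed[where Ms="Bs p @ As k"]) (use x1 S in simp_all)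
  have h: "W [] (Bs p) (Bs q) [A] G \<in> Hom (Bs p @ [A]) (Bs q @ [A])" "W [A] (Bs p) (Bs q) [] G \<in> Hom (A # Bs p) (A # Bs q)"
    "W [] (Bs p) (Bs q) (As k) G \<in> Hom (Bs p @ As k) (Bs q @ As k)" "W (As k) (Bs p) (Bs q) [] G \<in> Hom (As k @ Bs p) (As k @ Bs q)"
    by (rule whisker_hom; simp)+
  have "W [] (Bs p) (Bs q) (A # As k) G x = W [] (Bs p @ [A]) (Bs q @ [A]) (As k) (W [] (Bs p) (Bs q) [A] G) x" (is "?L4 = ?R4")
    using whisker_whisker[of "[]" "[]" "Bs p" "Bs q" "[A]" "As k" G x] x by simp
  then have chain4: "?L4 = ?R4" .
  have "W [] (Bs q @ [A]) (A # Bs q) (As k) (srt (Fs q @ [True])) ?L4 = W [] (Bs q @ [A]) (A # Bs q) (As k) (srt (Fs q @ [True])) ?R4" (is "?L5 = _") by (simp only: chain4)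
  also have "W [] (Bs q @ [A]) (A # Bs q) (As k) (srt (Fs q @ [True])) ?R4 = W [] (A # Bs p) (A # Bs q) (As k) (W [A] (Bs p) (Bs q) [] G) ?x1"
    by (rule whisker_square) (use x S h slide_B in simp_all)
  also have "\<dots> = W [A] (Bs p) (Bs q) (As k) G ?x1"
    using whisker_whisker[of "[]" "[A]" "Bs p" "Bs q" "[]" "As k" G ?x1] x1 by simp
  also have "\<dots> = W [A] (Bs p @ As k) (Bs q @ As k) [] (W [] (Bs p) (Bs q) (As k) G) ?x1" (is "_ = ?R5")
    using whisker_whisker[of "[A]" "[]" "Bs p" "Bs q" "As k" "[]" G ?x1] x1 by simp
  finally have chain5: "?L5 = ?R5" .
  have "W [A] (Bs q @ As k) (As k @ Bs q) [] (srt (Fs q @ Ts k)) ?L5 = W [A] (Bs q @ As k) (As k @ Bs q) [] (srt (Fs q @ Ts k)) ?R5" by (simp only: chain5)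
  also have "W [A] (Bs q @ As k) (As k @ Bs q) [] (srt (Fs q @ Ts k)) ?R5 = W [A] (As k @ Bs p) (As k @ Bs q) [] (W (As k) (Bs p) (Bs q) [] G) ?x2"
    by (rule whisker_square) (use x1 S h Suc.IH in simp_all)
  also have "\<dots> = W (A # As k) (Bs p) (Bs q) [] G ?x2"
    using whisker_whisker[of "[A]" "As k" "Bs p" "Bs q" "[]" "[]" G ?x2] x2 by simp
  finally show ?case using s[OF x] s[OF y] by simp
qed

text \<open>The block has to cross the copies of \<open>A\<close> behind it. Afterwards it lies to the right of all copies of
  \<open>A\<close>, and a further \<open>B\<close> coming from the front stops before it.\<close>

lemma srt_natural_B:
  "x \<in> C (wd (u @ Fs p @ v)) \<Longrightarrow>
    srt (u @ Fs q @ v) (W (wd u) (Bs p) (Bs q) (wd v) G x) =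
    W (As (cA u) @ As (cA v) @ Bs (cB u)) (Bs p) (Bs q) (Bs (cB v)) G (srt (u @ Fs p @ v) x)"
proof (induction u arbitrary: x)
  case Nil
  note [simp] = G srt_hom
  let ?k = "cA v" and ?l = "cB v"
  have s: "srt (Fs n @ v) y = W [] (Bs n @ As ?k) (As ?k @ Bs n) (Bs ?l) (srt (Fs n @ Ts ?k))
      (W (Bs n) (wd v) (sorted_mods v) [] (srt v) y)"
    if "y \<in> C (Bs n @ wd v)" for n y
  proof (rule rearr_eq_srt[symmetric])
    have 1: "rearr (Fs n @ v) (Fs n @ Ts ?k @ Fs ?l) (W (Bs n) (wd v) (sorted_mods v) [] (srt v))"
      using rearr_whisker[OF rearr_sort[of v], of "Fs n" "[]"] by simp
    have 2: "rearr (Fs n @ Ts ?k @ Fs ?l) (Ts ?k @ Fs n @ Fs ?l) (W [] (Bs n @ As ?k) (As ?k @ Bs n) (Bs ?l) (srt (Fs n @ Ts ?k)))"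
      using rearr_whisker[OF rearr_sort[of "Fs n @ Ts ?k"], of "[]" "Fs ?l"] by simp
    show "rearr (Fs n @ v) (Ts ?k @ Fs (n + ?l)) (\<lambda>y. W [] (Bs n @ As ?k) (As ?k @ Bs n) (Bs ?l) (srt (Fs n @ Ts ?k))
      (W (Bs n) (wd v) (sorted_mods v) [] (srt v) y))"
      using rearr.comp[OF 1 2] by (simp add: replicate_add)
  qed (use that in simp)
  have x: "x \<in> C (Bs p @ wd v)" using Nil by simp
  have y: "W [] (Bs p) (Bs q) (wd v) G x \<in> C (Bs q @ wd v)"
    by (rule whisker_closed[where Ms="Bs p"]) (use x in simp_all)
  have S: "srt (Fs n @ Ts ?k) \<in> Hom (Bs n @ As ?k) (As ?k @ Bs n)" for n
    using srt_hom[of "Fs n @ Ts ?k"] by simp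
  have h: "W [] (Bs p) (Bs q) (As ?k) G \<in> Hom (Bs p @ As ?k) (Bs q @ As ?k)"
    "W (As ?k) (Bs p) (Bs q) [] G \<in> Hom (As ?k @ Bs p) (As ?k @ Bs q)"
    by (rule whisker_hom; simp)+
  let ?x1 = "W (Bs p) (wd v) (sorted_mods v) [] (srt v) x"
  let ?x2 = "W [] (Bs p @ As ?k) (As ?k @ Bs p) (Bs ?l) (srt (Fs p @ Ts ?k)) ?x1"
  have x1: "?x1 \<in> C (Bs p @ As ?k @ Bs ?l)" by (rule whisker_closed[where Ms="wd v"]) (use x in simp_all)
  have x2: "?x2 \<in> C (As ?k @ Bs p @ Bs ?l)" by (rule whisker_closed[where Ms="Bs p @ As ?k"]) (use x1 S in simp_all)
  have "W (Bs q) (wd v) (sorted_mods v) [] (srt v) (W [] (Bs p) (Bs q) (wd v) G x) = W [] (Bs p) (Bs q) (sorted_mods v) G ?x1" (is "?L6 = _")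
    using whisker_interchange[of "[]" "Bs p" "Bs q" "[]" "wd v" "sorted_mods v" "[]" G "srt v" x] x by simp
  also have "\<dots> = W [] (Bs p @ As ?k) (Bs q @ As ?k) (Bs ?l) (W [] (Bs p) (Bs q) (As ?k) G) ?x1" (is "_ = ?R6")
    using whisker_whisker[of "[]" "[]" "Bs p" "Bs q" "As ?k" "Bs ?l" G ?x1] x1 by simp
  finally have chain6: "?L6 = ?R6" .
  have "W [] (Bs q @ As ?k) (As ?k @ Bs q) (Bs ?l) (srt (Fs q @ Ts ?k)) ?L6 = W [] (Bs q @ As ?k) (As ?k @ Bs q) (Bs ?l) (srt (Fs q @ Ts ?k)) ?R6" by (simp only: chain6)
  also have "W [] (Bs q @ As ?k) (As ?k @ Bs q) (Bs ?l) (srt (Fs q @ Ts ?k)) ?R6 =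
      W [] (As ?k @ Bs p) (As ?k @ Bs q) (Bs ?l) (W (As ?k) (Bs p) (Bs q) [] G) ?x2"
    by (rule whisker_square) (use x1 S h srt_natural_B_block in simp_all)
  also have "\<dots> = W (As ?k) (Bs p) (Bs q) (Bs ?l) G ?x2"
    using whisker_whisker[of "[]" "As ?k" "Bs p" "Bs q" "[]" "Bs ?l" G ?x2] x2 by simp
  finally show ?case using s[OF x] s[OF y] by simp
next
  case (Cons c u)
  let ?w = "u @ Fs p @ v" and ?w' = "u @ Fs q @ v"
  define X where "X = (if c then A else B)"
  have [simp]: "module K X" by (simp add: X_def)
  have wX: "wd (c # w) = X # wd w" for w by (cases c) (simp_all add: X_def)
  let ?f = "W (wd u) (Bs p) (Bs q) (wd v) G"
  let ?P = "As (cA u) @ As (cA v) @ Bs (cB u)" and ?S = "Bs (cB v)"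
  let ?g = "W ?P (Bs p) (Bs q) ?S G"
  note [simp] = G cross_hom
  have f: "?f \<in> Hom (wd ?w) (wd ?w')" by (rule whisker_hom) simp_all
  have g: "?g \<in> Hom (sorted_mods ?w) (sorted_mods ?w')" by (rule whisker_hom) (simp_all add: replicate_add)
  have x: "x \<in> C (X # wd ?w)" using Cons.prems wX[of ?w] by simp
  let ?z = "W [X] (wd ?w) (sorted_mods ?w) [] (srt ?w) x"
  have z: "?z \<in> C (X # sorted_mods ?w)"
    by (rule whisker_closed[where Ms="wd ?w"]) (use x srt_hom[of ?w] in simp_all)
  have 1: "W (wd (c # u)) (Bs p) (Bs q) (wd v) G x = W [X] (wd ?w) (wd ?w') [] ?f x"
    using whisker_whisker[of "[X]" "wd u" "Bs p" "Bs q" "wd v" "[]" G x] x by (simp add: wX)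
  have 2: "W [X] (wd ?w') (sorted_mods ?w') [] (srt ?w') (W [X] (wd ?w) (wd ?w') [] ?f x) =
      W [X] (sorted_mods ?w) (sorted_mods ?w') [] ?g ?z"
    by (rule srt_prefix_natural[OF f g Cons.IH x]) simp_all
  also have 3: "\<dots> = W (X # ?P) (Bs p) (Bs q) ?S G ?z"
    using whisker_whisker[of "[X]" ?P "Bs p" "Bs q" ?S "[]" G ?z] z
    by (simp add: replicate_add)
  finally have 4: "W [X] (wd ?w') (sorted_mods ?w') [] (srt ?w') (W [X] (wd ?w) (wd ?w') [] ?f x) =
    W (X # ?P) (Bs p) (Bs q) ?S G ?z" .
  show ?case
  proof (cases c)
    case True
    with 4 show ?thesis unfolding 1 by (simp add: X_def)
  next
    case False
    then have XB: "X = B" by (simp add: X_def)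
    let ?k = "cA u + cA v"
    have zB: "?z \<in> C (B # As ?k @ Bs (cB u) @ Bs p @ ?S)" using z by (simp add: XB replicate_add)
    have 5: "W [] (B # As ?k) (As ?k @ [B]) (Bs (cB u) @ Bs q @ ?S) (cross ?k) (W (B # As ?k @ Bs (cB u)) (Bs p) (Bs q) ?S G ?z) =
      W (As ?k @ B # Bs (cB u)) (Bs p) (Bs q) ?S G (W [] (B # As ?k) (As ?k @ [B]) (Bs (cB u) @ Bs p @ ?S) (cross ?k) ?z)"
      using whisker_interchange[of "[]" "B # As ?k" "As ?k @ [B]" "Bs (cB u)" "Bs p" "Bs q" ?S "cross ?k" G ?z] zB by simp
    show ?thesis unfolding 1 using 4 5 False XB
      by (simp add: replicate_add)
  qed
qed

end

end

context tensor_ground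
begin

section \<open>Multiplication and unit of an algebra as maps of tensor powers\<close>

lemma assoc_algebra_module: "assoc_algebra K X \<Longrightarrow> module K X"
  by (rule assoc_algebra.axioms(1))

lemma pure_single_lin:
  assumes "module K X" shows "(\<lambda>x. pure K [X] [x]) \<in> lin_maps K X (T [X])"
  using multilin_slot[of "[]" X "[]" "T [X]" "pure K [X]" "[]" "[]"] pure_multilin[of "[X]"] assms by simp

lemma multilin_pure_single: "module K X \<Longrightarrow> multilin Ms X g \<Longrightarrow> multilin Ms (T [X]) (\<lambda>xs. pure K [X] [g xs])"
  by (rule multilin_comp[OF _ pure_single_lin])

lemma mult_multilin:
  assumes "assoc_algebra K X"
  shows "multilin [X, X] X (\<lambda>xs. xs ! 0 \<otimes>\<^bsub>X\<^esub> xs ! 1)"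
proof -
  interpret X: assoc_algebra K X by fact
  show ?thesis
  proof (rule multilinI)
    fix Us M Vs us vs
    assume *: "[X, X] = Us @ M # Vs" "us \<in> tuples Us" "vs \<in> tuples Vs"
    then consider "Us = []" "M = X" "Vs = [X]" | "Us = [X]" "M = X" "Vs = []"
      by (auto simp: Cons_eq_append_conv)
    then show "(\<lambda>x. (us @ x # vs) ! 0 \<otimes>\<^bsub>X\<^esub> (us @ x # vs) ! 1) \<in> lin_maps K M X"
      by cases (use * in \<open>auto simp: tuples_Cons X.l_distr X.r_distr X.smult_mult_left X.smult_mult_right
          intro!: lin_mapsI\<close>)
  qed (auto simp: tuples_Cons)
qed

lemma contract_multilin:
  assumes "assoc_algebra K X"
  shows "multilin [X, X] (T [X]) (\<lambda>xs. pure K [X] (contract X 0 xs))"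
  by (rule multilin_cong[OF _ multilin_pure_single[OF _ mult_multilin[OF assms]]])
    (auto simp: assoc_algebra_module[OF assms] contract_def tuples_Cons)

lemma mult_hom: "assoc_algebra K X \<Longrightarrow> mult_map K X \<in> Hom [X, X] [X]"
  unfolding mult_map_def by (rule tmap_lin) (simp_all add: assoc_algebra_module contract_multilin)

lemma mult_pure:
  "assoc_algebra K X \<Longrightarrow> x \<in> carrier X \<Longrightarrow> y \<in> carrier X \<Longrightarrow>
    mult_map K X (pure K [X, X] [x, y]) = pure K [X] [x \<otimes>\<^bsub>X\<^esub> y]"
  unfolding mult_map_def by (subst tmap_pure) (simp_all add: assoc_algebra_module contract_multilin, simp add: contract_def)

definition unit_map :: "('k, 'x) module \<Rightarrow> ('x, 'k) tens \<Rightarrow> ('x, 'k) tens" where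
  "unit_map X = tmap K [] [X] (\<lambda>_. [\<one>\<^bsub>X\<^esub>])"

lemma unit_multilin:
  assumes "assoc_algebra K X"
  shows "multilin [] (T [X]) (\<lambda>_. pure K [X] [\<one>\<^bsub>X\<^esub>])"
proof -
  interpret X: assoc_algebra K X by fact
  show ?thesis by (rule multilinI) auto
qed

lemma unit_hom: "assoc_algebra K X \<Longrightarrow> unit_map X \<in> Hom [] [X]"
  unfolding unit_map_def by (rule tmap_lin) (simp_all add: assoc_algebra_module unit_multilin)

lemma unit_pure: "assoc_algebra K X \<Longrightarrow> unit_map X (pure K [] []) = pure K [X] [\<one>\<^bsub>X\<^esub>]"
  unfolding unit_map_def by (subst tmap_pure) (simp_all add: assoc_algebra_module unit_multilin)

text \<open>The operators \<open>d_op\<close> and \<open>dbar_op\<close> are given by list contraction; this turns them into whiskerings.\<close>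

lemma tmap_contract:
  assumes X: "assoc_algebra K X" and mods: "modules Us" "modules Vs"
    and i: "i = length Us" and eq: "Ps = Us @ [X, X] @ Vs" "Qs = Us @ [X] @ Vs" and x: "x \<in> C Ps"
  shows "tmap K Ps Qs (contract X i) x = W Us [X, X] [X] Vs (mult_map K X) x"
proof -
  interpret X: assoc_algebra K X by fact
  note [simp] = assoc_algebra_module[OF X]
  show ?thesis
    unfolding mult_map_def
    by (rule whisker_tmap[OF mods(1) _ _ mods(2) contract_multilin[OF X] _ _ eq x])
      (auto simp: i contract_def tuples_Cons tuples_length nth_append)
qed

lemma tmap_insert_one:
  assumes X: "assoc_algebra K X" and mods: "modules Us" "modules Vs"
    and i: "i = length Us" and eq: "Ps = Us @ Vs" "Qs = Us @ [X] @ Vs" and x: "x \<in> C Ps"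
  shows "tmap K Ps Qs (insert_one X i) x = W Us [] [X] Vs (unit_map X) x"
proof -
  interpret X: assoc_algebra K X by fact
  note [simp] = assoc_algebra_module[OF X]
  have eq': "Ps = Us @ [] @ Vs" using eq by simp
  show ?thesis
    unfolding unit_map_def
    by (rule whisker_tmap[OF mods(1) _ _ mods(2) unit_multilin[OF X] _ _ eq' eq(2) x])
      (auto simp: i insert_one_def tuples_length)
qed

lemma mult_assoc:
  assumes X: "assoc_algebra K X" and x: "x \<in> C [X, X, X]"
  shows "mult_map K X (W [] [X, X] [X] [X] (mult_map K X) x) = mult_map K X (W [X] [X, X] [X] [] (mult_map K X) x)"
proof (rule lin_maps_eqI[OF _ _ _ _ _ x])
  interpret X: assoc_algebra K X by fact
  note [simp] = assoc_algebra_module[OF X] mult_hom[OF X]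
  show "modules [X, X, X]" "module K (T [X])" by (simp_all add: tensor_module)
  have h: "W [] [X, X] [X] [X] (mult_map K X) \<in> Hom [X, X, X] [X, X]" "W [X] [X, X] [X] [] (mult_map K X) \<in> Hom [X, X, X] [X, X]"
    by (rule whisker_hom; simp)+
  show "(\<lambda>x. mult_map K X (W [] [X, X] [X] [X] (mult_map K X) x)) \<in> Hom [X, X, X] [X]"
    "(\<lambda>x. mult_map K X (W [X] [X, X] [X] [] (mult_map K X) x)) \<in> Hom [X, X, X] [X]"
    by (rule lin_maps_comp[OF h(1) mult_hom[OF X]] lin_maps_comp[OF h(2) mult_hom[OF X]])+
  fix xs assume "xs \<in> tuples [X, X, X]"
  then obtain a b c where xs: "xs = [a, b, c]" "a \<in> carrier X" "b \<in> carrier X" "c \<in> carrier X"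
    by (auto simp: tuples_Cons)
  have "W [] [X, X] [X] [X] (mult_map K X) (pure K [X, X, X] xs) = pure K [X, X] [a \<otimes>\<^bsub>X\<^esub> b, c]"
    using whisker_right[of "[X, X]" "[X]" "[X]" "mult_map K X" "pure K [X, X] [a, b]" "pure K [X] [c]"] xs
    by (simp add: mult_pure[OF X] tcat_pure)
  moreover have "W [X] [X, X] [X] [] (mult_map K X) (pure K [X, X, X] xs) = pure K [X, X] [a, b \<otimes>\<^bsub>X\<^esub> c]"
    using whisker_left[of "[X]" "[X, X]" "[X]" "mult_map K X" "pure K [X] [a]" "pure K [X, X] [b, c]"] xs
    by (simp add: mult_pure[OF X] tcat_pure)
  ultimately show "mult_map K X (W [] [X, X] [X] [X] (mult_map K X) (pure K [X, X, X] xs)) =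
      mult_map K X (W [X] [X, X] [X] [] (mult_map K X) (pure K [X, X, X] xs))"
    using xs by (simp add: mult_pure[OF X] X.m_assoc)
qed

lemma whisker_mult_assoc:
  assumes Y: "assoc_algebra K Y" and mods: "modules Us" "modules Vs" and x: "x \<in> C (Us @ Y # Y # Y # Vs)"
  shows "W Us [Y, Y] [Y] Vs (mult_map K Y) (W Us [Y, Y] [Y] (Y # Vs) (mult_map K Y) x) =
    W Us [Y, Y] [Y] Vs (mult_map K Y) (W (Us @ [Y]) [Y, Y] [Y] Vs (mult_map K Y) x)"
proof -
  let ?m = "mult_map K Y"
  note [simp] = mods mult_hom[OF Y] assoc_algebra_module[OF Y]
  have h: "W [] [Y, Y] [Y] [Y] ?m \<in> Hom [Y, Y, Y] [Y, Y]" "W [Y] [Y, Y] [Y] [] ?m \<in> Hom [Y, Y, Y] [Y, Y]"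
    by (rule whisker_hom; simp)+
  have "W Us [Y, Y] [Y] (Y # Vs) ?m x = W Us [Y, Y, Y] [Y, Y] Vs (W [] [Y, Y] [Y] [Y] ?m) x"
    using whisker_whisker[of Us "[]" "[Y, Y]" "[Y]" "[Y]" Vs ?m x] x by simp
  moreover have "W (Us @ [Y]) [Y, Y] [Y] Vs ?m x = W Us [Y, Y, Y] [Y, Y] Vs (W [Y] [Y, Y] [Y] [] ?m) x"
    using whisker_whisker[of Us "[Y]" "[Y, Y]" "[Y]" "[]" Vs ?m x] x by simp
  moreover have "W Us [Y, Y] [Y] Vs ?m (W Us [Y, Y, Y] [Y, Y] Vs (W [] [Y, Y] [Y] [Y] ?m) x) =
      W Us [Y, Y] [Y] Vs ?m (W Us [Y, Y, Y] [Y, Y] Vs (W [Y] [Y, Y] [Y] [] ?m) x)"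
    by (rule whisker_square) (use x h in \<open>simp_all add: mult_assoc[OF Y]\<close>)
  ultimately show ?thesis by simp
qed

end

context strong_smash
begin

lemma algebra_A [simp]: "assoc_algebra K A" by (rule A.assoc_algebra_axioms)
lemma algebra_B [simp]: "assoc_algebra K B" by (rule B.assoc_algebra_axioms)

abbreviation "mA \<equiv> mult_map K A"
abbreviation "mB \<equiv> mult_map K B"
abbreviation "uA \<equiv> unit_map A"
abbreviation "uB \<equiv> unit_map B"

section \<open>The twist is compatible with products and units\<close>

text \<open>A single crossing is \<open>R\<close>, whiskered by empty words.\<close>

lemma cross_1: "x \<in> C [B, A] \<Longrightarrow> cross (Suc 0) x = R x"
  using rearr_unique[of "[False, True]" "[True, False]" "cross (Suc 0)" "W [] [B, A] [A, B] [] R" x]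
    rearr_cross[of "Suc 0"] rearr.fwd[of "[]" "[]"]
  by (simp add: whisker_none del: cross.simps)

lemma srt_BA: "x \<in> C [B, A] \<Longrightarrow> srt [False, True] x = R x"
  using rearr_eq_srt[of "[False, True]" "Suc 0" "Suc 0" "W [] [B, A] [A, B] [] R" x] rearr.fwd[of "[]" "[]"]
  by (simp add: whisker_none)

text \<open>This is the second quasitriangularity equation.\<close>

lemma mult_A_slide:
  assumes x: "x \<in> C (B # As (Suc (Suc 0)))"
  shows "cross (Suc 0) (W [B] (As (Suc (Suc 0))) (As (Suc 0)) [] mA x) =
    W [] (As (Suc (Suc 0))) (As (Suc 0)) [B] mA (cross (Suc (Suc 0)) x)"
proof -
  have x': "x \<in> C [B, A, A]" using x by simp
  have "W [B] [A, A] [A] [] mA x \<in> C [B, A]"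
    by (rule whisker_closed[where Ms="[A, A]"]) (use x' in \<open>simp_all add: mult_hom\<close>)
  then have "cross (Suc 0) (W [B] [A, A] [A] [] mA x) = R (W [B] [A, A] [A] [] mA x)"
    by (rule cross_1)
  also have "\<dots> = W [] [A, A] [A] [B] mA (W [A] [B, A] [A, B] [] R (W [] [B, A] [A, B] [A] R x))"
    using R_quasitriangular x' by (simp add: quasitriangular_def)
  also have "W [A] [B, A] [A, B] [] R (W [] [B, A] [A, B] [A] R x) = cross (Suc (Suc 0)) x"
  proof -
    have f: "rearr [False, True, True] [True, True, False] (\<lambda>x. W [A] [B, A] [A, B] [] R (W [] [B, A] [A, B] [A] R x))"
      using rearr.comp[OF rearr.fwd[of "[]" "[True]", simplified] rearr.fwd[of "[True]" "[]", simplified]] by simp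
    have g: "rearr [False, True, True] [True, True, False] (cross (Suc (Suc 0)))"
      using rearr_cross[of "Suc (Suc 0)"] by simp
    show ?thesis using rearr_unique[OF f g, of x] x' by simp
  qed
  finally show ?thesis by simp
qed

text \<open>This is the first quasitriangularity equation.\<close>

lemma mult_B_slide:
  assumes x: "x \<in> C (Bs (Suc (Suc 0)) @ [A])"
  shows "srt (Fs (Suc 0) @ [True]) (W [] (Bs (Suc (Suc 0))) (Bs (Suc 0)) [A] mB x) =
    W [A] (Bs (Suc (Suc 0))) (Bs (Suc 0)) [] mB (srt (Fs (Suc (Suc 0)) @ [True]) x)"
proof -
  have x': "x \<in> C [B, B, A]" using x by simp
  have "W [] [B, B] [B] [A] mB x \<in> C [B, A]"
    by (rule whisker_closed[where Ms="[B, B]"]) (use x' in \<open>simp_all add: mult_hom\<close>)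
  then have "srt [False, True] (W [] [B, B] [B] [A] mB x) = R (W [] [B, B] [B] [A] mB x)"
    by (rule srt_BA)
  also have "\<dots> = W [A] [B, B] [B] [] mB (W [] [B, A] [A, B] [B] R (W [B] [B, A] [A, B] [] R x))"
    using R_quasitriangular x' by (simp add: quasitriangular_def)
  also have "W [] [B, A] [A, B] [B] R (W [B] [B, A] [A, B] [] R x) = srt [False, False, True] x"
  proof -
    have f: "rearr [False, False, True] [True, False, False] (\<lambda>x. W [] [B, A] [A, B] [B] R (W [B] [B, A] [A, B] [] R x))"
      using rearr.comp[OF rearr.fwd[of "[False]" "[]", simplified] rearr.fwd[of "[]" "[False]", simplified]] by simp
    show ?thesis
      using rearr_eq_srt[of "[False, False, True]" "Suc 0" "Suc (Suc 0)", simplified, OF f] x' by simp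
  qed
  finally show ?thesis by (simp del: srt.simps)
qed

text \<open>This is the normality condition \<open>R (b \<otimes> 1) = 1 \<otimes> b\<close>.\<close>

lemma unit_A_slide:
  assumes x: "x \<in> C (B # As 0)"
  shows "cross (Suc 0) (W [B] (As 0) (As (Suc 0)) [] uA x) = W [] (As 0) (As (Suc 0)) [B] uA (cross 0 x)"
proof -
  have h: "W [B] [] [A] [] uA \<in> Hom [B] [B, A]" "W [] [] [A] [B] uA \<in> Hom [B] [A, B]"
    by (rule whisker_hom; simp add: unit_hom)+
  have "R (W [B] [] [A] [] uA x) = W [] [] [A] [B] uA x"
  proof (rule lin_maps_eqI[OF _ _ lin_maps_comp[OF h(1) R_hom] h(2)])
    fix xs assume "xs \<in> tuples [B]"
    then obtain b where xs: "xs = [b]" "b \<in> carrier B" by (auto simp: tuples_Cons)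
    have "W [B] [] [A] [] uA (pure K [B] [b]) = pure K [B, A] [b, \<one>\<^bsub>A\<^esub>]"
      using whisker_left[of "[B]" "[]" "[A]" "uA" "pure K [B] [b]" "pure K [] []"] xs
      by (simp add: unit_hom unit_pure tcat_pure)
    moreover have "W [] [] [A] [B] uA (pure K [B] [b]) = pure K [A, B] [\<one>\<^bsub>A\<^esub>, b]"
      using whisker_right[of "[]" "[A]" "[B]" "uA" "pure K [] []" "pure K [B] [b]"] xs
      by (simp add: unit_hom unit_pure tcat_pure)
    ultimately show "R (W [B] [] [A] [] uA (pure K [B] xs)) = W [] [] [A] [B] uA (pure K [B] xs)"
      using xs R_normal by (simp add: normal_twist_def)
  qed (use x in \<open>simp_all add: tensor_module\<close>)
  moreover have "W [B] [] [A] [] uA x \<in> C [B, A]"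
    using lin_maps_closed[OF h(1)] x by simp
  ultimately show ?thesis using cross_1 by (simp del: cross.simps(2))
qed

text \<open>This is the normality condition \<open>R (1 \<otimes> a) = a \<otimes> 1\<close>.\<close>

lemma unit_B_slide:
  assumes x: "x \<in> C (Bs 0 @ [A])"
  shows "srt (Fs (Suc 0) @ [True]) (W [] (Bs 0) (Bs (Suc 0)) [A] uB x) =
    W [A] (Bs 0) (Bs (Suc 0)) [] uB (srt (Fs 0 @ [True]) x)"
proof -
  have h: "W [A] [] [B] [] uB \<in> Hom [A] [A, B]" "W [] [] [B] [A] uB \<in> Hom [A] [B, A]"
    by (rule whisker_hom; simp add: unit_hom)+
  have "R (W [] [] [B] [A] uB x) = W [A] [] [B] [] uB x"
  proof (rule lin_maps_eqI[OF _ _ lin_maps_comp[OF h(2) R_hom] h(1)])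
    fix xs assume "xs \<in> tuples [A]"
    then obtain a where xs: "xs = [a]" "a \<in> carrier A" by (auto simp: tuples_Cons)
    have "W [A] [] [B] [] uB (pure K [A] [a]) = pure K [A, B] [a, \<one>\<^bsub>B\<^esub>]"
      using whisker_left[of "[A]" "[]" "[B]" "uB" "pure K [A] [a]" "pure K [] []"] xs
      by (simp add: unit_hom unit_pure tcat_pure)
    moreover have "W [] [] [B] [A] uB (pure K [A] [a]) = pure K [B, A] [\<one>\<^bsub>B\<^esub>, a]"
      using whisker_right[of "[]" "[B]" "[A]" "uB" "pure K [] []" "pure K [A] [a]"] xs
      by (simp add: unit_hom unit_pure tcat_pure)
    ultimately show "R (W [] [] [B] [A] uB (pure K [A] xs)) = W [A] [] [B] [] uB (pure K [A] xs)"
      using xs R_normal by (simp add: normal_twist_def)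
  qed (use x in \<open>simp_all add: tensor_module\<close>)
  moreover have "W [] [] [B] [A] uB x \<in> C [B, A]"
    using lin_maps_closed[OF h(2)] x by simp
  moreover have "srt [True] x = x" using srt_sorted[of x "Suc 0" 0] x by simp
  ultimately show ?thesis using srt_BA by (simp del: srt.simps)
qed

lemma srt_mult_A:
  assumes "x \<in> C (wd (u @ [True, True] @ v))"
  shows "srt (u @ [True] @ v) (W (wd u) [A, A] [A] (wd v) mA x) =
    W (As (cA u)) [A, A] [A] (As (cA v) @ Bs (cB u) @ Bs (cB v)) mA (srt (u @ [True, True] @ v) x)"
  using srt_natural_A[OF _ mult_A_slide, of x u v] assms by (simp add: mult_hom)

lemma srt_unit_A:
  assumes "x \<in> C (wd (u @ v))"
  shows "srt (u @ [True] @ v) (W (wd u) [] [A] (wd v) uA x) =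
    W (As (cA u)) [] [A] (As (cA v) @ Bs (cB u) @ Bs (cB v)) uA (srt (u @ v) x)"
  using srt_natural_A[OF _ unit_A_slide, of x u v] assms by (simp add: unit_hom)

lemma srt_mult_B:
  assumes "x \<in> C (wd (u @ [False, False] @ v))"
  shows "srt (u @ [False] @ v) (W (wd u) [B, B] [B] (wd v) mB x) =
    W (As (cA u) @ As (cA v) @ Bs (cB u)) [B, B] [B] (Bs (cB v)) mB (srt (u @ [False, False] @ v) x)"
  using srt_natural_B[OF _ mult_B_slide, of x u v] assms by (simp add: mult_hom)

lemma srt_unit_B:
  assumes "x \<in> C (wd (u @ v))"
  shows "srt (u @ [False] @ v) (W (wd u) [] [B] (wd v) uB x) =
    W (As (cA u) @ As (cA v) @ Bs (cB u)) [] [B] (Bs (cB v)) uB (srt (u @ v) x)"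
  using srt_natural_B[OF _ unit_B_slide, of x u v] assms by (simp add: unit_hom)

section \<open>The smash product algebra\<close>

abbreviation X :: "('k, ('x, 'k) tens) module" where "X \<equiv> smash_product K A B R"

text \<open>The product of the smash product as a linear map on \<open>A \<otimes> B \<otimes> A \<otimes> B\<close>, in which form it can be
  whiskered.\<close>

definition smash_mult :: "('x, 'k) tens \<Rightarrow> ('x, 'k) tens" where
  "smash_mult x = W [A] [B, B] [B] [] mB
    (W [] [A, A] [A] [B, B] mA (W [A] [B, A] [A, B] [B] R x))"

lemma smash_mult_parts:
  "W [A] [B, A] [A, B] [B] R \<in> Hom [A, B, A, B] [A, A, B, B]"
  "W [] [A, A] [A] [B, B] mA \<in> Hom [A, A, B, B] [A, B, B]"
  "W [A] [B, B] [B] [] mB \<in> Hom [A, B, B] [A, B]"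
  by (rule whisker_hom; simp add: mult_hom)+

lemma smash_mult_hom: "smash_mult \<in> Hom [A, B, A, B] [A, B]"
  unfolding smash_mult_def[abs_def]
  by (rule lin_maps_comp[OF lin_maps_comp[OF smash_mult_parts(1,2)] smash_mult_parts(3)])

text \<open>The crossing \<open>R\<close> inside the product is one of the moves of sorting. What remains are the products of
  \<open>A\<close> and of \<open>B\<close>, which commute with sorting.\<close>

lemma srt_smash_mult:
  assumes x: "x \<in> C (wd (u @ [True, False, True, False] @ v))"
  shows "srt (u @ [True, False] @ v) (W (wd u) [A, B, A, B] [A, B] (wd v) smash_mult x) =
    W (As (cA u) @ A # As (cA v) @ Bs (cB u)) [B, B] [B] (Bs (cB v)) mB
      (W (As (cA u)) [A, A] [A] (As (cA v) @ Bs (cB u) @ B # B # Bs (cB v)) mA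
        (srt (u @ [True, False, True, False] @ v) x))"
proof -
  let ?y1 = "W (wd u @ [A]) [B, A] [A, B] (B # wd v) R x"
  let ?y2 = "W (wd u) [A, A] [A] (B # B # wd v) mA ?y1"
  let ?y3 = "W (wd u @ [A]) [B, B] [B] (wd v) mB ?y2"
  note [simp] = mult_hom
  have x': "x \<in> C (wd u @ A # B # A # B # wd v)" using x by simp
  have y1: "?y1 \<in> C (wd u @ A # A # B # B # wd v)"
    by (rule whisker_closed[where Ms="[B, A]"]) (use x' in simp_all)
  have y2: "?y2 \<in> C (wd u @ A # B # B # wd v)"
    by (rule whisker_closed[where Ms="[A, A]"]) (use y1 in simp_all)
  have "W (wd u) [A, B, A, B] [A, B] (wd v) smash_mult x =
      W (wd u) [A, B, B] [A, B] (wd v) (W [A] [B, B] [B] [] mB)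
        (W (wd u) [A, B, A, B] [A, B, B] (wd v) (\<lambda>x. W [] [A, A] [A] [B, B] mA (W [A] [B, A] [A, B] [B] R x)) x)"
    unfolding smash_mult_def[abs_def]
    by (rule whisker_comp[OF _ _ _ _ _ lin_maps_comp[OF smash_mult_parts(1,2)] smash_mult_parts(3), symmetric]) (use x' in simp_all)
  also have "W (wd u) [A, B, A, B] [A, B, B] (wd v) (\<lambda>x. W [] [A, A] [A] [B, B] mA (W [A] [B, A] [A, B] [B] R x)) x =
      W (wd u) [A, A, B, B] [A, B, B] (wd v) (W [] [A, A] [A] [B, B] mA)
        (W (wd u) [A, B, A, B] [A, A, B, B] (wd v) (W [A] [B, A] [A, B] [B] R) x)"
    by (rule whisker_comp[OF _ _ _ _ _ smash_mult_parts(1,2), symmetric]) (use x' in simp_all)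
  also have "W (wd u) [A, B, A, B] [A, A, B, B] (wd v) (W [A] [B, A] [A, B] [B] R) x = ?y1"
    using whisker_whisker[of "wd u" "[A]" "[B, A]" "[A, B]" "[B]" "wd v" R x] x' by simp
  also have "W (wd u) [A, A, B, B] [A, B, B] (wd v) (W [] [A, A] [A] [B, B] mA) ?y1 = ?y2"
    using whisker_whisker[of "wd u" "[]" "[A, A]" "[A]" "[B, B]" "wd v" "mA" ?y1] y1 by simp
  also have "W (wd u) [A, B, B] [A, B] (wd v) (W [A] [B, B] [B] [] mB) ?y2 = ?y3"
    using whisker_whisker[of "wd u" "[A]" "[B, B]" "[B]" "[]" "wd v" "mB" ?y2] y2 by simp
  finally have 1: "W (wd u) [A, B, A, B] [A, B] (wd v) smash_mult x = ?y3" .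
  have "srt (u @ [True, False] @ v) ?y3 =
      W (As (cA u) @ A # As (cA v) @ Bs (cB u)) [B, B] [B] (Bs (cB v)) mB (srt (u @ [True, False, False] @ v) ?y2)"
    using srt_mult_B[of ?y2 "u @ [True]" v] y2 by (simp del: srt.simps add: replicate_app_Cons_same)
  also have "srt (u @ [True, False, False] @ v) ?y2 =
      W (As (cA u)) [A, A] [A] (As (cA v) @ Bs (cB u) @ B # B # Bs (cB v)) mA (srt (u @ [True, True, False, False] @ v) ?y1)"
    using srt_mult_A[of ?y1 u "[False, False] @ v"] y1 by (simp del: srt.simps)
  also have "srt (u @ [True, True, False, False] @ v) ?y1 = srt (u @ [True, False, True, False] @ v) x"
    using srt_step[of x "u @ [True]" "False # v"] x' by (simp del: srt.simps)
  finally show ?thesis unfolding 1 .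
qed

text \<open>Here the result is a tensor on the sorted word \<open>A B\<close>, so the left-hand side needs no sorting.\<close>

lemma smash_mult_eq:
  assumes z: "z \<in> C [A, B, A, B]"
  shows "smash_mult z = W [A] [B, B] [B] [] mB
    (W [] [A, A] [A] [B, B] mA (srt [True, False, True, False] z))"
proof -
  have "smash_mult z \<in> C [A, B]" using lin_maps_closed[OF smash_mult_hom z] .
  then have "srt [True, False] (smash_mult z) = smash_mult z"
    using srt_sorted[of "smash_mult z" "Suc 0" "Suc 0"] by (simp del: srt.simps)
  moreover have "W [] [A, B, A, B] [A, B] [] smash_mult z = smash_mult z"
    by (rule whisker_none) (use z smash_mult_hom in simp_all)
  ultimately show ?thesis
    using srt_smash_mult[of z "[]" "[]"] z by (simp del: srt.simps)
qed

text \<open>After sorting the word \<open>A B A B A B\<close>, either bracketing multiplies three letters \<open>A\<close> and three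
  letters \<open>B\<close>, so the claim reduces to associativity of \<open>A\<close> and \<open>B\<close>.\<close>

lemma smash_mult_assoc:
  assumes x: "x \<in> C [A, B, A, B, A, B]"
  shows "smash_mult (W [] [A, B, A, B] [A, B] [A, B] smash_mult x) =
    smash_mult (W [A, B] [A, B, A, B] [A, B] [] smash_mult x)"
proof -
  let ?s = "srt [True, False, True, False, True, False] x"
  note [simp] = mult_hom smash_mult_hom
  have s: "?s \<in> C [A, A, A, B, B, B]"
    using srt_closed[of x "[True, False, True, False, True, False]"] x by (simp del: srt.simps srt_closed)
  let ?l = "W [] [A, A] [A] [A, B, B, B] mA ?s" and ?r = "W [A] [A, A] [A] [B, B, B] mA ?s"
  have lr: "?l \<in> C [A, A, B, B, B]" "?r \<in> C [A, A, B, B, B]"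
    by (rule whisker_closed[where Ms="[A, A]"]; use s in simp)+
  let ?t = "W [] [A, A] [A] [B, B, B] mA ?l"
  have t: "?t = W [] [A, A] [A] [B, B, B] mA ?r" "?t \<in> C [A, B, B, B]"
    using whisker_mult_assoc[of A "[]" "[B, B, B]" ?s] s lr
    by (simp_all add: whisker_closed[where Ms="[A, A]" and Ns="[A]" and Us="[]" and Vs="[B, B, B]"])
  let ?P = "\<lambda>y. W [A] [B, B] [B] [] mB (W [] [A, A] [A] [B, B] mA y)"
  have zl: "W [] [A, B, A, B] [A, B] [A, B] smash_mult x \<in> C [A, B, A, B]"
    "W [A, B] [A, B, A, B] [A, B] [] smash_mult x \<in> C [A, B, A, B]"
    by (rule whisker_closed[where Ms="[A, B, A, B]"]; use x in simp)+
  have "smash_mult (W [] [A, B, A, B] [A, B] [A, B] smash_mult x) = ?P (W [A, A] [B, B] [B] [B] mB ?l)"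
    using smash_mult_eq[OF zl(1)] srt_smash_mult[of x "[]" "[True, False]"] x by (simp del: srt.simps)
  also have "W [] [A, A] [A] [B, B] mA (W [A, A] [B, B] [B] [B] mB ?l) = W [A] [B, B] [B] [B] mB ?t"
    using whisker_interchange[of "[]" "[A, A]" "[A]" "[]" "[B, B]" "[B]" "[B]" mA mB ?l] lr by simp
  also have "W [A] [B, B] [B] [] mB (W [A] [B, B] [B] [B] mB ?t) = W [A] [B, B] [B] [] mB (W [A, B] [B, B] [B] [] mB ?t)"
    using whisker_mult_assoc[of B "[A]" "[]" ?t] t by simp
  also have "W [A, B] [B, B] [B] [] mB ?t = W [] [A, A] [A] [B, B] mA (W [A, A, B] [B, B] [B] [] mB ?r)"
    using whisker_interchange[of "[]" "[A, A]" "[A]" "[B]" "[B, B]" "[B]" "[]" mA mB ?r] lr t by simp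
  also have "?P (W [A, A, B] [B, B] [B] [] mB ?r) = smash_mult (W [A, B] [A, B, A, B] [A, B] [] smash_mult x)"
    using smash_mult_eq[OF zl(2)] srt_smash_mult[of x "[True, False]" "[]"] x by (simp del: srt.simps)
  finally show ?thesis .
qed

lemma tmap_pairs:
  assumes z: "z \<in> C [A, A, B, B]"
  shows "tmap K [A, A, B, B] [A, B] (\<lambda>xs. [xs ! 0 \<otimes>\<^bsub>A\<^esub> xs ! 1, xs ! 2 \<otimes>\<^bsub>B\<^esub> xs ! 3]) z =
    W [A] [B, B] [B] [] mB (W [] [A, A] [A] [B, B] mA z)"
proof (rule tmap_eqI[OF _ _ lin_maps_comp[OF smash_mult_parts(2,3)] _ z])
  fix xs assume "xs \<in> tuples [A, A, B, B]"
  then obtain a a' b b' where xs: "xs = [a, a', b, b']" "a \<in> carrier A" "a' \<in> carrier A" "b \<in> carrier B" "b' \<in> carrier B"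
    by (auto simp: tuples_Cons)
  have "W [] [A, A] [A] [B, B] mA (pure K [A, A, B, B] xs) = pure K [A, B, B] [a \<otimes>\<^bsub>A\<^esub> a', b, b']"
    using whisker_right[of "[A, A]" "[A]" "[B, B]" "mA" "pure K [A, A] [a, a']" "pure K [B, B] [b, b']"] xs
    by (simp add: mult_hom mult_pure tcat_pure)
  moreover have "W [A] [B, B] [B] [] mB (pure K [A, B, B] [a \<otimes>\<^bsub>A\<^esub> a', b, b']) = pure K [A, B] [a \<otimes>\<^bsub>A\<^esub> a', b \<otimes>\<^bsub>B\<^esub> b']"
    using whisker_left[of "[A]" "[B, B]" "[B]" "mB" "pure K [A] [a \<otimes>\<^bsub>A\<^esub> a']" "pure K [B, B] [b, b']"] xs
    by (simp add: mult_hom mult_pure tcat_pure)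
  ultimately show "W [A] [B, B] [B] [] mB (W [] [A, A] [A] [B, B] mA (pure K [A, A, B, B] xs)) =
      pure K [A, B] [xs ! 0 \<otimes>\<^bsub>A\<^esub> xs ! 1, xs ! 2 \<otimes>\<^bsub>B\<^esub> xs ! 3]"
    using xs by (simp add: numeral_2_eq_2 numeral_3_eq_3)
qed simp_all

lemma smash_simps [simp]:
  "carrier X = C [A, B]" "\<zero>\<^bsub>X\<^esub> = \<zero>\<^bsub>T [A, B]\<^esub>" "\<one>\<^bsub>X\<^esub> = pure K [A, B] [\<one>\<^bsub>A\<^esub>, \<one>\<^bsub>B\<^esub>]"
  "s \<oplus>\<^bsub>X\<^esub> t = s \<oplus>\<^bsub>T [A, B]\<^esub> t" "c \<odot>\<^bsub>X\<^esub> t = c \<odot>\<^bsub>T [A, B]\<^esub> t"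
  by (simp_all add: smash_product_def)

lemma smash_mult:
  assumes "s \<in> C [A, B]" "t \<in> C [A, B]"
  shows "s \<otimes>\<^bsub>X\<^esub> t = smash_mult (tcat K [A, B] [A, B] s t)"
proof -
  have "tcat K [A, B] [A, B] s t \<in> C [A, B, A, B]" using assms by (simp add: tcat_closed)
  then have "W [A] [B, A] [A, B] [B] R (tcat K [A, B] [A, B] s t) \<in> C [A, A, B, B]"
    by (rule lin_maps_closed[OF smash_mult_parts(1)])
  then show ?thesis by (simp add: smash_product_def smash_mult_def tmap_pairs[unfolded One_nat_def])
qed

lemma one_tensor_closed [simp]: "pure K [A, B] [\<one>\<^bsub>A\<^esub>, \<one>\<^bsub>B\<^esub>] \<in> C [A, B]"
  by simp

lemma smash_lin_left:
  assumes "t \<in> C [A, B]" shows "(\<lambda>s. smash_mult (tcat K [A, B] [A, B] s t)) \<in> Hom [A, B] [A, B]"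
  by (rule lin_maps_comp[OF _ smash_mult_hom]) (use tcat_lin_left[of "[A, B]" "[A, B]" t] assms in simp)

lemma smash_lin_right:
  assumes "s \<in> C [A, B]" shows "(\<lambda>t. smash_mult (tcat K [A, B] [A, B] s t)) \<in> Hom [A, B] [A, B]"
  by (rule lin_maps_comp[OF _ smash_mult_hom]) (use tcat_lin_right[of "[A, B]" "[A, B]" s] assms in simp)

lemma smash_one_left:
  assumes t: "t \<in> C [A, B]"
  shows "smash_mult (tcat K [A, B] [A, B] (pure K [A, B] [\<one>\<^bsub>A\<^esub>, \<one>\<^bsub>B\<^esub>]) t) = t"
proof (rule lin_maps_eqI[OF _ _ smash_lin_right lin_maps_id _ t])
  fix xs assume "xs \<in> tuples [A, B]"
  then obtain a b where xs: "xs = [a, b]" "a \<in> carrier A" "b \<in> carrier B" by (auto simp: tuples_Cons)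
  have p: "pure K [A, B, A, B] [\<one>\<^bsub>A\<^esub>, \<one>\<^bsub>B\<^esub>, a, b] \<in> C [A, B, A, B]" using xs by simp
  have "W [A] [B, A] [A, B] [B] R (pure K [A, B, A, B] [\<one>\<^bsub>A\<^esub>, \<one>\<^bsub>B\<^esub>, a, b]) = pure K [A, A, B, B] [\<one>\<^bsub>A\<^esub>, a, \<one>\<^bsub>B\<^esub>, b]"
    using whisker_tcat[of "[A]" "[B, A]" "[A, B]" "[B]" R "pure K [A] [\<one>\<^bsub>A\<^esub>]" "pure K [B, A] [\<one>\<^bsub>B\<^esub>, a]" "pure K [B] [b]"] xs R_normal
    by (simp add: tcat_pure normal_twist_def)
  then have "smash_mult (pure K [A, B, A, B] [\<one>\<^bsub>A\<^esub>, \<one>\<^bsub>B\<^esub>, a, b]) = pure K [A, B] [a, b]"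
    using whisker_right[of "[A, A]" "[A]" "[B, B]" "mA" "pure K [A, A] [\<one>\<^bsub>A\<^esub>, a]" "pure K [B, B] [\<one>\<^bsub>B\<^esub>, b]"]
      whisker_left[of "[A]" "[B, B]" "[B]" "mB" "pure K [A] [a]" "pure K [B, B] [\<one>\<^bsub>B\<^esub>, b]"] xs
    by (simp add: smash_mult_def mult_hom mult_pure tcat_pure)
  then show "smash_mult (tcat K [A, B] [A, B] (pure K [A, B] [\<one>\<^bsub>A\<^esub>, \<one>\<^bsub>B\<^esub>]) (pure K [A, B] xs)) = pure K [A, B] xs"
    using xs by (simp add: tcat_pure)
qed (simp_all add: tensor_module)

lemma smash_one_right:
  assumes t: "t \<in> C [A, B]"
  shows "smash_mult (tcat K [A, B] [A, B] t (pure K [A, B] [\<one>\<^bsub>A\<^esub>, \<one>\<^bsub>B\<^esub>])) = t"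
proof (rule lin_maps_eqI[OF _ _ smash_lin_left lin_maps_id _ t])
  fix xs assume "xs \<in> tuples [A, B]"
  then obtain a b where xs: "xs = [a, b]" "a \<in> carrier A" "b \<in> carrier B" by (auto simp: tuples_Cons)
  have "W [A] [B, A] [A, B] [B] R (pure K [A, B, A, B] [a, b, \<one>\<^bsub>A\<^esub>, \<one>\<^bsub>B\<^esub>]) = pure K [A, A, B, B] [a, \<one>\<^bsub>A\<^esub>, b, \<one>\<^bsub>B\<^esub>]"
    using whisker_tcat[of "[A]" "[B, A]" "[A, B]" "[B]" R "pure K [A] [a]" "pure K [B, A] [b, \<one>\<^bsub>A\<^esub>]" "pure K [B] [\<one>\<^bsub>B\<^esub>]"] xs R_normal
    by (simp add: tcat_pure normal_twist_def)
  then have "smash_mult (pure K [A, B, A, B] [a, b, \<one>\<^bsub>A\<^esub>, \<one>\<^bsub>B\<^esub>]) = pure K [A, B] [a, b]"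
    using whisker_right[of "[A, A]" "[A]" "[B, B]" "mA" "pure K [A, A] [a, \<one>\<^bsub>A\<^esub>]" "pure K [B, B] [b, \<one>\<^bsub>B\<^esub>]"]
      whisker_left[of "[A]" "[B, B]" "[B]" "mB" "pure K [A] [a]" "pure K [B, B] [b, \<one>\<^bsub>B\<^esub>]"] xs
    by (simp add: smash_mult_def mult_hom mult_pure tcat_pure)
  then show "smash_mult (tcat K [A, B] [A, B] (pure K [A, B] xs) (pure K [A, B] [\<one>\<^bsub>A\<^esub>, \<one>\<^bsub>B\<^esub>])) = pure K [A, B] xs"
    using xs by (simp add: tcat_pure)
qed (simp_all add: tensor_module)

lemma smash_closed: "s \<in> C [A, B] \<Longrightarrow> t \<in> C [A, B] \<Longrightarrow> smash_mult (tcat K [A, B] [A, B] s t) \<in> C [A, B]"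
  using lin_maps_closed[OF smash_lin_left] .

lemma smash_assoc:
  assumes "r \<in> C [A, B]" "s \<in> C [A, B]" "t \<in> C [A, B]"
  shows "smash_mult (tcat K [A, B] [A, B] (smash_mult (tcat K [A, B] [A, B] r s)) t) =
    smash_mult (tcat K [A, B] [A, B] r (smash_mult (tcat K [A, B] [A, B] s t)))"
proof -
  have "tcat K [A, B, A, B] [A, B] (tcat K [A, B] [A, B] r s) t = tcat K [A, B] [A, B, A, B] r (tcat K [A, B] [A, B] s t)"
    using tcat_assoc[of "[A, B]" "[A, B]" "[A, B]" r s t] assms by simp
  moreover have "tcat K [A, B, A, B] [A, B] (tcat K [A, B] [A, B] r s) t \<in> C [A, B, A, B, A, B]"
    using assms by (simp add: tcat_closed)
  moreover have "W [] [A, B, A, B] [A, B] [A, B] smash_mult (tcat K [A, B, A, B] [A, B] (tcat K [A, B] [A, B] r s) t) =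
      tcat K [A, B] [A, B] (smash_mult (tcat K [A, B] [A, B] r s)) t"
    by (rule whisker_right) (use assms in \<open>simp_all add: smash_mult_hom tcat_closed\<close>)
  moreover have "W [A, B] [A, B, A, B] [A, B] [] smash_mult (tcat K [A, B] [A, B, A, B] r (tcat K [A, B] [A, B] s t)) =
      tcat K [A, B] [A, B] r (smash_mult (tcat K [A, B] [A, B] s t))"
    by (rule whisker_left) (use assms in \<open>simp_all add: smash_mult_hom tcat_closed\<close>)
  ultimately show ?thesis using smash_mult_assoc by metis
qed

lemma smash_algebra: "assoc_algebra K X"
proof -
  interpret AB: module K "T [A, B]" by (rule tensor_module) simp
  note [simp] = smash_mult smash_closed
  have ag: "abelian_group X"
  proof (rule abelian_groupI)
    fix x assume "x \<in> carrier X"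
    then show "\<exists>y\<in>carrier X. y \<oplus>\<^bsub>X\<^esub> x = \<zero>\<^bsub>X\<^esub>"
      by (intro bexI[of _ "\<ominus>\<^bsub>T [A, B]\<^esub> x"]) (simp_all add: AB.l_neg)
  qed (simp_all add: AB.a_ac)
  have md: "module K X"
    by (rule moduleI[OF module.axioms(1)[OF module_A] ag]) (simp_all add: AB.smult_l_distr AB.smult_r_distr AB.smult_assoc1)
  have "ring X"
  proof (rule ringI[OF ag])
    show "monoid X"
      by (rule monoidI) (simp_all add: smash_assoc smash_one_left smash_one_right)
  qed (simp_all add: lin_maps_add[OF smash_lin_left] lin_maps_add[OF smash_lin_right])
  moreover have "assoc_algebra_axioms K X"
    by unfold_locales (simp_all add: lin_maps_smult[OF smash_lin_left] lin_maps_smult[OF smash_lin_right])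
  ultimately show ?thesis
    using md by (intro assoc_algebra.intro)
qed

end

section \<open>The cyclic module of an algebra\<close>

lemma tuples_replicate:
  "xs \<in> tuples (replicate m X) \<longleftrightarrow> length xs = m \<and> (\<forall>k<m. xs ! k \<in> carrier X)"
  by (auto simp: tuples_def list_all2_conv_all_nth)

text \<open>The face operators on the entries of a pure tensor, \<open>n\<close> being the degree. The last face multiplies the
  last entry with the first.\<close>

definition face_list :: "('k, 'x) module \<Rightarrow> nat \<Rightarrow> nat \<Rightarrow> 'x list \<Rightarrow> 'x list" where
  "face_list X n i xs = (if i < n then contract X i xs else (last xs \<otimes>\<^bsub>X\<^esub> hd xs) # butlast (tl xs))"

definition rot :: "'x list \<Rightarrow> 'x list" where
  "rot xs = last xs # butlast xs"

lemma length_face_list: "length xs = Suc n \<Longrightarrow> i \<le> n \<Longrightarrow> 1 \<le> n \<Longrightarrow> length (face_list X n i xs) = n"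
  by (auto simp: face_list_def contract_def)

lemma nth_face_list:
  assumes "length xs = Suc n" "i \<le> n" "1 \<le> n" "k < n"
  shows "face_list X n i xs ! k =
    (if i < n then if k < i then xs ! k else if k = i then xs ! k \<otimes>\<^bsub>X\<^esub> xs ! Suc k else xs ! Suc k
     else if k = 0 then xs ! n \<otimes>\<^bsub>X\<^esub> xs ! 0 else xs ! k)"
proof -
  have ne: "xs \<noteq> []" using assms by auto
  show ?thesis
  proof (cases "i < n")
    case True
    consider "k < i" | "k = i" | d where "k = Suc (i + d)"
      using less_iff_Suc_add by (metis linorder_neqE_nat)
    then show ?thesis
      using True assms by cases (simp_all add: face_list_def contract_def nth_append)
  next
    case False
    with ne assms show ?thesis
      by (auto simp: face_list_def last_conv_nth hd_conv_nth nth_butlast nth_tl nth_Cons')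
  qed
qed

lemma length_insert_one: "i \<le> length xs \<Longrightarrow> length (insert_one X i xs) = Suc (length xs)"
  by (simp add: insert_one_def)

lemma nth_insert_one:
  "i \<le> length xs \<Longrightarrow> k \<le> length xs \<Longrightarrow>
    insert_one X i xs ! k = (if k < i then xs ! k else if k = i then \<one>\<^bsub>X\<^esub> else xs ! (k - 1))"
proof -
  assume *: "i \<le> length xs" "k \<le> length xs"
  consider "k < i" | "k = i" | d where "k = Suc (i + d)"
    using less_iff_Suc_add by (metis linorder_neqE_nat)
  then show ?thesis
    using * by cases (simp_all add: insert_one_def nth_append)
qed

lemma length_rot: "xs \<noteq> [] \<Longrightarrow> length (rot xs) = length xs"
  by (simp add: rot_def)

lemma nth_rot: "k < length xs \<Longrightarrow> rot xs ! k = (if k = 0 then xs ! (length xs - 1) else xs ! (k - 1))"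
  by (auto simp: rot_def nth_Cons last_conv_nth nth_butlast split: nat.splits)

lemma rotate1_rot: "xs \<noteq> [] \<Longrightarrow> rotate1 (rot xs) = xs"
  by (simp add: rot_def)

text \<open>\<open>rot\<close> is inverse to \<^const>\<open>rotate1\<close>, whose iterate by the length is the identity.\<close>

lemma rot_period: "(rot ^^ length xs) xs = xs"
proof (cases "xs = []")
  case False
  have "(rot ^^ k) xs \<noteq> [] \<and> length ((rot ^^ k) xs) = length xs \<and> (rotate1 ^^ k) ((rot ^^ k) xs) = xs" for k
  proof (induction k)
    case (Suc k)
    then have "rotate1 (rot ((rot ^^ k) xs)) = (rot ^^ k) xs" by (simp add: rotate1_rot)
    moreover have "rot ((rot ^^ k) xs) \<noteq> []" by (simp add: rot_def)
    ultimately show ?case using Suc by (simp add: length_rot funpow_swap1[of rotate1])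
  qed (use False in simp)
  from this[of "length xs"] show ?thesis
    by (metis rotate_def rotate_length01 rotate_id mod_self)
qed simp

context
  fixes X :: "('k, 'x) module" and K :: "'k ring"
  assumes X: "assoc_algebra K X"
begin

interpretation X: assoc_algebra K X by (rule X)

lemma face_list_closed:
  "xs \<in> tuples (replicate (Suc n) X) \<Longrightarrow> i \<le> n \<Longrightarrow> 1 \<le> n \<Longrightarrow> face_list X n i xs \<in> tuples (replicate n X)"
  unfolding tuples_replicate by (auto simp: length_face_list nth_face_list)

lemma insert_one_closed:
  "xs \<in> tuples (replicate n X) \<Longrightarrow> i \<le> n \<Longrightarrow> insert_one X i xs \<in> tuples (replicate (Suc n) X)"
  unfolding tuples_replicate by (auto simp: length_insert_one nth_insert_one)

lemma rot_closed:
  "xs \<in> tuples (replicate (Suc n) X) \<Longrightarrow> rot xs \<in> tuples (replicate (Suc n) X)"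
  unfolding tuples_replicate by (auto simp: length_rot nth_rot simp flip: length_greater_0_conv)

text \<open>The identities of a cyclic module for lists are proved entry by entry. Associativity enters here only,
  when two adjacent contractions meet.\<close>

lemma face_face_list:
  assumes "xs \<in> tuples (replicate (Suc (Suc (Suc m))) X)" "i \<le> j" "j \<le> Suc m"
  shows "face_list X (Suc m) i (face_list X (Suc (Suc m)) (Suc j) xs) = face_list X (Suc m) j (face_list X (Suc (Suc m)) i xs)"
  using assms unfolding tuples_replicate
  by (intro nth_equalityI) (auto simp: length_face_list nth_face_list X.m_assoc)

lemma degen_degen_list:
  assumes "xs \<in> tuples (replicate (Suc n) X)" "i \<le> j" "j \<le> n"
  shows "insert_one X (Suc i) (insert_one X (Suc j) xs) = insert_one X (Suc (Suc j)) (insert_one X (Suc i) xs)"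
  using assms unfolding tuples_replicate
  by (intro nth_equalityI) (auto simp: length_insert_one nth_insert_one)

lemma face_degen_less_list:
  assumes "xs \<in> tuples (replicate (Suc (Suc m)) X)" "i \<le> j" "j \<le> m"
  shows "face_list X (Suc (Suc m)) i (insert_one X (Suc (Suc j)) xs) = insert_one X (Suc j) (face_list X (Suc m) i xs)"
  using assms unfolding tuples_replicate
  by (intro nth_equalityI) (auto simp: length_insert_one nth_insert_one length_face_list nth_face_list)

lemma face_degen_same_list:
  assumes "xs \<in> tuples (replicate (Suc n) X)" "j \<le> n" "i = j \<or> i = Suc j"
  shows "face_list X (Suc n) i (insert_one X (Suc j) xs) = xs"
  using assms unfolding tuples_replicate
  by (intro nth_equalityI) (auto simp: length_insert_one nth_insert_one length_face_list nth_face_list)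

lemma face_degen_greater_list:
  assumes "xs \<in> tuples (replicate (Suc (Suc m)) X)" "j < i" "i \<le> Suc m"
  shows "face_list X (Suc (Suc m)) (Suc i) (insert_one X (Suc j) xs) = insert_one X (Suc j) (face_list X (Suc m) i xs)"
  using assms unfolding tuples_replicate
  by (intro nth_equalityI) (auto simp: length_insert_one nth_insert_one length_face_list nth_face_list)

lemma face_cyc_list:
  assumes "xs \<in> tuples (replicate (Suc (Suc m)) X)" "i \<le> m"
  shows "face_list X (Suc m) (Suc i) (rot xs) = rot (face_list X (Suc m) i xs)"
proof -
  have "face_list X (Suc m) i xs \<noteq> []" using length_face_list[of xs "Suc m" i X] assms unfolding tuples_replicate by auto
  moreover have "xs \<noteq> []" using assms unfolding tuples_replicate by auto
  ultimately show ?thesis using assms unfolding tuples_replicate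
    by (intro nth_equalityI) (auto simp: length_rot nth_rot length_face_list nth_face_list)
qed

lemma face_0_cyc_list:
  assumes "xs \<in> tuples (replicate (Suc (Suc m)) X)"
  shows "face_list X (Suc m) 0 (rot xs) = face_list X (Suc m) (Suc m) xs"
proof -
  have "xs \<noteq> []" using assms unfolding tuples_replicate by auto
  then show ?thesis using assms unfolding tuples_replicate
    by (intro nth_equalityI) (auto simp: length_rot nth_rot length_face_list nth_face_list)
qed

lemma degen_cyc_list:
  assumes "xs \<in> tuples (replicate (Suc n) X)" "i < n"
  shows "insert_one X (Suc (Suc i)) (rot xs) = rot (insert_one X (Suc i) xs)"
proof -
  have "xs \<noteq> []" "insert_one X (Suc i) xs \<noteq> []" using assms unfolding tuples_replicate by (auto simp: insert_one_def)
  then show ?thesis using assms unfolding tuples_replicate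
    by (intro nth_equalityI) (auto simp: length_rot nth_rot length_insert_one nth_insert_one)
qed

lemma degen_0_cyc_list:
  assumes "xs \<in> tuples (replicate (Suc n) X)"
  shows "insert_one X (Suc 0) (rot xs) = rot (rot (insert_one X (Suc n) xs))"
proof -
  have "xs \<noteq> []" "insert_one X (Suc n) xs \<noteq> []" "rot (insert_one X (Suc n) xs) \<noteq> []"
    using assms unfolding tuples_replicate by (auto simp: insert_one_def rot_def)
  then show ?thesis using assms unfolding tuples_replicate
    by (intro nth_equalityI) (auto simp: length_rot nth_rot length_insert_one nth_insert_one)
qed

end

context tensor_ground
begin

lemma contract_pure:
  assumes X: "assoc_algebra K X" and mods: "modules Us" "modules Vs" and xs: "xs \<in> tuples (Us @ [X, X] @ Vs)"
  shows "W Us [X, X] [X] Vs (mult_map K X) (pure K (Us @ [X, X] @ Vs) xs) = pure K (Us @ [X] @ Vs) (contract X (length Us) xs)"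
proof -
  interpret X: assoc_algebra K X by fact
  note [simp] = mods mult_hom[OF X] assoc_algebra_module[OF X]
  obtain us x y vs where e: "xs = us @ [x, y] @ vs" "us \<in> tuples Us" "x \<in> carrier X" "y \<in> carrier X" "vs \<in> tuples Vs"
    using xs by (auto simp: tuples_append tuples_Cons)
  then show ?thesis
    using whisker_tcat[of Us "[X, X]" "[X]" Vs "mult_map K X" "pure K Us us" "pure K [X, X] [x, y]" "pure K Vs vs"]
    by (simp add: mult_pure[OF X] tcat_pure contract_def tuples_length nth_append)
qed

lemma insert_one_pure:
  assumes X: "assoc_algebra K X" and mods: "modules Us" "modules Vs" and xs: "xs \<in> tuples (Us @ Vs)"
  shows "W Us [] [X] Vs (unit_map X) (pure K (Us @ Vs) xs) = pure K (Us @ [X] @ Vs) (insert_one X (length Us) xs)"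
proof -
  interpret X: assoc_algebra K X by fact
  note [simp] = mods unit_hom[OF X] assoc_algebra_module[OF X]
  obtain us vs where e: "xs = us @ vs" "us \<in> tuples Us" "vs \<in> tuples Vs"
    using xs by (auto simp: tuples_append)
  then show ?thesis
    using whisker_tcat[of Us "[]" "[X]" Vs "unit_map X" "pure K Us us" "pure K [] []" "pure K Vs vs"]
    by (simp add: unit_pure[OF X] tcat_pure insert_one_def tuples_length)
qed

context
  fixes X :: "('k, 'x) module"
  assumes X: "assoc_algebra K X"
begin

lemma module_X [simp]: "module K X" by (rule assoc_algebra_module[OF X])

abbreviation Pw :: "nat \<Rightarrow> ('k, 'x) module list" where "Pw n \<equiv> replicate n X"

lemma replicate_split: "i < n \<Longrightarrow> Pw (Suc n) = Pw i @ [X, X] @ Pw (n - 1 - i)"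
proof -
  assume "i < n"
  then have "Suc n = i + Suc (Suc (n - 1 - i))" by simp
  then show ?thesis by (metis append_Cons append_Nil replicate_Suc replicate_add)
qed

lemma replicate_split1: "i \<le> n \<Longrightarrow> Pw (Suc n) = Pw i @ [X] @ Pw (n - i)"
  by (metis append_Cons append_Nil replicate_Suc replicate_add le_add_diff_inverse add_Suc_right)

lemma replicate_split0: "i \<le> n \<Longrightarrow> Pw n = Pw i @ Pw (n - i)"
  by (metis replicate_add le_add_diff_inverse)

lemma flip_rot:
  assumes xs: "xs \<in> tuples (Pw (Suc n))"
  shows "tflip K (Pw n) [X] (pure K (Pw (Suc n)) xs) = pure K (Pw (Suc n)) (rot xs)"
proof -
  have e: "Pw (Suc n) = Pw n @ [X]" by (simp add: replicate_append_same)
  obtain us x where "xs = us @ [x]" "us \<in> tuples (Pw n)" "x \<in> carrier X"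
    using xs unfolding e by (auto simp: tuples_append tuples_Cons)
  then show ?thesis
    using flip_pure[of "Pw n" "[X]" us "[x]"] by (simp add: rot_def replicate_append_same)
qed

lemma flip_rot_hom: "tflip K (Pw n) [X] \<in> Hom (Pw (Suc n)) (Pw (Suc n))"
  using flip_hom[of "Pw n" "[X]"] by (simp add: replicate_append_same)

text \<open>A face with index \<open>i < n\<close> is a whiskering of the product, and the last face is a rotation followed by
  the face with index \<open>0\<close>. In this form the operator on lists is seen to induce a linear map.\<close>

lemma alg_face:
  assumes "i \<le> n" "1 \<le> n"
  shows "tmap K (Pw (Suc n)) (Pw n) (face_list X n i) \<in> Hom (Pw (Suc n)) (Pw n)"
    and "xs \<in> tuples (Pw (Suc n)) \<Longrightarrow> tmap K (Pw (Suc n)) (Pw n) (face_list X n i) (pure K (Pw (Suc n)) xs) =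
      pure K (Pw n) (face_list X n i xs)"
proof -
  have "\<exists>F \<in> Hom (Pw (Suc n)) (Pw n). \<forall>xs\<in>tuples (Pw (Suc n)).
    F (pure K (Pw (Suc n)) xs) = pure K (Pw n) (face_list X n i xs)"
  proof (cases "i < n")
    case True
    have e: "Pw n = Pw i @ [X] @ Pw (n - 1 - i)"
    proof -
      have "Suc (n - 1) = n" "i \<le> n - 1" using True by simp_all
      with replicate_split1[of i "n - 1"] show ?thesis by (simp only:)
    qed
    have "W (Pw i) [X, X] [X] (Pw (n - 1 - i)) (mult_map K X) \<in> Hom (Pw (Suc n)) (Pw n)"
      by (rule whisker_hom[OF _ _ _ _ mult_hom[OF X] replicate_split[OF True] e]) simp_all
    moreover have "W (Pw i) [X, X] [X] (Pw (n - 1 - i)) (mult_map K X) (pure K (Pw (Suc n)) xs)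
       = pure K (Pw n) (face_list X n i xs)" if "xs \<in> tuples (Pw (Suc n))" for xs
    proof -
      have "xs \<in> tuples (Pw i @ [X, X] @ Pw (n - 1 - i))"
        using that unfolding replicate_split[OF True] .
      from contract_pure[OF X _ _ this] True show ?thesis
        unfolding e[symmetric] replicate_split[OF True, symmetric]
        by (simp only: modules_replicate module_X length_replicate face_list_def if_True)
    qed
    ultimately show ?thesis by blast
  next
    case False
    \<comment> \<open>The last face: rotate the last entry to the front and multiply the first two entries.\<close>
    define m where "m = n - 1"
    with False assms have n: "n = Suc m" "i = Suc m" by simp_all
    let ?F = "\<lambda>x. W [] [X, X] [X] (Pw m) (mult_map K X) (tflip K (Pw n) [X] x)"
    have "W [] [X, X] [X] (Pw m) (mult_map K X) \<in> Hom (Pw (Suc n)) (Pw n)"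
      unfolding n by (rule whisker_hom[OF _ _ _ _ mult_hom[OF X]]) simp_all
    then have "?F \<in> Hom (Pw (Suc n)) (Pw n)"
      by (rule lin_maps_comp[OF flip_rot_hom])
    moreover have "?F (pure K (Pw (Suc n)) xs) = pure K (Pw n) (face_list X n i xs)"
      if xs: "xs \<in> tuples (Pw (Suc n))" for xs
    proof -
      have R: "Pw (Suc n) = [] @ [X, X] @ Pw m" "Pw n = [] @ [X] @ Pw m"
        by (simp_all add: n)
      have "rot xs \<in> tuples ([] @ [X, X] @ Pw m)"
        using rot_closed[OF X xs] unfolding R .
      from contract_pure[OF X _ _ this]
      have "W [] [X, X] [X] (Pw m) (mult_map K X) (pure K (Pw (Suc n)) (rot xs)) = pure K (Pw n) (contract X 0 (rot xs))"
        unfolding R by (simp only: modules_replicate module_X modules_simps list.size)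
      moreover have "contract X 0 (rot xs) = face_list X n i xs"
      proof -
        have "face_list X (Suc m) 0 (rot xs) = face_list X (Suc m) (Suc m) xs"
          by (rule face_0_cyc_list[OF X]) (use xs in \<open>simp only: n\<close>)
        moreover have "face_list X (Suc m) 0 (rot xs) = contract X 0 (rot xs)"
          unfolding face_list_def by (rule if_P) simp
        ultimately show ?thesis unfolding n by (simp only:)
      qed
      ultimately show ?thesis by (simp only: flip_rot[OF xs])
    qed
    ultimately show ?thesis
      by (intro bexI[of _ ?F] ballI)
  qed
  then obtain F where F: "F \<in> Hom (Pw (Suc n)) (Pw n)"
    "\<And>xs. xs \<in> tuples (Pw (Suc n)) \<Longrightarrow> F (pure K (Pw (Suc n)) xs) = pure K (Pw n) (face_list X n i xs)"
    by blast
  show "tmap K (Pw (Suc n)) (Pw n) (face_list X n i) \<in> Hom (Pw (Suc n)) (Pw n)"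
    by (rule tmap_spec(1)[OF _ _ F]) simp_all
  show "xs \<in> tuples (Pw (Suc n)) \<Longrightarrow> tmap K (Pw (Suc n)) (Pw n) (face_list X n i) (pure K (Pw (Suc n)) xs) =
      pure K (Pw n) (face_list X n i xs)"
    by (rule tmap_spec(2)[OF _ _ F]) simp_all
qed

lemma alg_degen:
  assumes "i \<le> n"
  shows "tmap K (Pw n) (Pw (Suc n)) (insert_one X i) \<in> Hom (Pw n) (Pw (Suc n))"
    and "xs \<in> tuples (Pw n) \<Longrightarrow> tmap K (Pw n) (Pw (Suc n)) (insert_one X i) (pure K (Pw n) xs) =
      pure K (Pw (Suc n)) (insert_one X i xs)"
proof -
  let ?F = "W (Pw i) [] [X] (Pw (n - i)) (unit_map X)"
  have F: "?F \<in> Hom (Pw n) (Pw (Suc n))"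
    by (rule whisker_hom[OF _ _ _ _ unit_hom[OF X] _ replicate_split1[OF assms]])
      (simp_all only: append_Nil replicate_split0[OF assms, symmetric], simp_all)
  have eq: "?F (pure K (Pw n) xs) = pure K (Pw (Suc n)) (insert_one X i xs)"
    if "xs \<in> tuples (Pw n)" for xs
  proof -
    have "xs \<in> tuples (Pw i @ Pw (n - i))"
      using that unfolding replicate_split0[OF assms, symmetric] .
    from insert_one_pure[OF X _ _ this] show ?thesis
      unfolding replicate_split0[OF assms, symmetric] replicate_split1[OF assms, symmetric]
      by (simp only: modules_replicate module_X length_replicate)
  qed
  show "tmap K (Pw n) (Pw (Suc n)) (insert_one X i) \<in> Hom (Pw n) (Pw (Suc n))"
    by (rule tmap_spec(1)[OF _ _ F eq]) simp_all
  show "xs \<in> tuples (Pw n) \<Longrightarrow> tmap K (Pw n) (Pw (Suc n)) (insert_one X i) (pure K (Pw n) xs) =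
      pure K (Pw (Suc n)) (insert_one X i xs)"
    by (rule tmap_spec(2)[OF _ _ F eq]) simp_all
qed

lemma alg_cyc:
  shows "tmap K (Pw (Suc n)) (Pw (Suc n)) rot \<in> Hom (Pw (Suc n)) (Pw (Suc n))"
    and "xs \<in> tuples (Pw (Suc n)) \<Longrightarrow> tmap K (Pw (Suc n)) (Pw (Suc n)) rot (pure K (Pw (Suc n)) xs) =
      pure K (Pw (Suc n)) (rot xs)"
  by (rule tmap_spec[OF _ _ flip_rot_hom flip_rot]; simp)+

lemma algebra_cyclic_simps:
  "obj (algebra_cyclic K X) n = T (Pw (Suc n))"
  "face (algebra_cyclic K X) (Suc m) i = tmap K (Pw (Suc (Suc m))) (Pw (Suc m)) (face_list X (Suc m) i)"
  "degen (algebra_cyclic K X) n i = tmap K (Pw (Suc n)) (Pw (Suc (Suc n))) (insert_one X (Suc i))"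
  "cyc (algebra_cyclic K X) n = tmap K (Pw (Suc n)) (Pw (Suc n)) rot"
  by (simp_all add: algebra_cyclic_def Let_def face_list_def[abs_def] rot_def[abs_def])

text \<open>The operators take pure tensors to pure tensors, so every identity follows from the one for lists.\<close>

lemma algebra_cyclic_module: "cyclic_module K (algebra_cyclic K X)"
proof -
  define R where "R n = Pw n" for n
  define d where "d n i = tmap K (R (Suc n)) (R n) (face_list X n i)" for n i
  define s where "s n i = tmap K (R (Suc n)) (R (Suc (Suc n))) (insert_one X (Suc i))" for n i
  define t where "t n = tmap K (R (Suc n)) (R (Suc n)) rot" for n
  have mR [simp]: "modules (R n)" "module K (T (R n))" for n by (simp_all add: R_def tensor_module)
  have d: "d n i \<in> Hom (R (Suc n)) (R n)" if "i \<le> n" "1 \<le> n" for n i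
    using alg_face(1)[OF that] by (simp add: d_def R_def)
  have dp: "d n i (pure K (R (Suc n)) xs) = pure K (R n) (face_list X n i xs)"
    if "xs \<in> tuples (R (Suc n))" "i \<le> n" "1 \<le> n" for n i xs
    using alg_face(2)[OF that(2,3), of xs] that(1) by (simp add: d_def R_def)
  have s: "s n i \<in> Hom (R (Suc n)) (R (Suc (Suc n)))" if "i \<le> n" for n i
    using alg_degen(1)[of "Suc i" "Suc n"] that by (simp add: s_def R_def)
  have sp: "s n i (pure K (R (Suc n)) xs) = pure K (R (Suc (Suc n))) (insert_one X (Suc i) xs)"
    if "xs \<in> tuples (R (Suc n))" "i \<le> n" for n i xs
    using alg_degen(2)[of "Suc i" "Suc n" xs] that by (simp add: s_def R_def)
  have t: "t n \<in> Hom (R (Suc n)) (R (Suc n))" for n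
    using alg_cyc(1)[of n] by (simp add: t_def R_def)
  have tp: "t n (pure K (R (Suc n)) xs) = pure K (R (Suc n)) (rot xs)" if "xs \<in> tuples (R (Suc n))" for n xs
    using alg_cyc(2)[of xs n] that by (simp add: t_def R_def)
  have fc: "face_list X n i xs \<in> tuples (R n)" if "xs \<in> tuples (R (Suc n))" "i \<le> n" "1 \<le> n" for n i xs
    using face_list_closed[OF X] that by (simp add: R_def)
  have ic: "insert_one X (Suc i) xs \<in> tuples (R (Suc (Suc n)))" if "xs \<in> tuples (R (Suc n))" "i \<le> n" for n i xs
    using insert_one_closed[OF X, of xs "Suc n" "Suc i"] that by (simp add: R_def)
  have rc: "rot xs \<in> tuples (R (Suc n))" if "xs \<in> tuples (R (Suc n))" for n xs
    using rot_closed[OF X] that by (simp add: R_def)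
  note eqI = lin_maps_eqI[OF mR(1) mR(2)]
  have t_pow: "(t n ^^ k) \<in> Hom (R (Suc n)) (R (Suc n))" for n k
    by (induction k) (simp_all add: lin_maps_id id_def lin_maps_comp[OF _ t] comp_def)
  have t_pow_pure: "(t n ^^ k) (pure K (R (Suc n)) xs) = pure K (R (Suc n)) ((rot ^^ k) xs) \<and> (rot ^^ k) xs \<in> tuples (R (Suc n))"
    if "xs \<in> tuples (R (Suc n))" for n k xs
    by (induction k) (simp_all add: that tp rc)
  have period: "(t n ^^ Suc n) x = x" if "x \<in> C (R (Suc n))" for n x
  proof (rule eqI[OF t_pow lin_maps_id _ that])
    fix xs assume xs: "xs \<in> tuples (R (Suc n))"
    then have "length xs = Suc n" using tuples_length[of xs "R (Suc n)"] by (simp add: R_def)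
    then show "(t n ^^ Suc n) (pure K (R (Suc n)) xs) = pure K (R (Suc n)) xs"
      using t_pow_pure[OF xs, of "Suc n"] rot_period[of xs] by (simp del: funpow.simps)
  qed
  have op: "obj (algebra_cyclic K X) n = T (R (Suc n))" "face (algebra_cyclic K X) (Suc m) i = d (Suc m) i"
    "degen (algebra_cyclic K X) n i = s n i" "cyc (algebra_cyclic K X) n = t n" for n m i
    by (simp_all add: algebra_cyclic_simps d_def s_def t_def R_def)
  show ?thesis
  proof (rule cyclic_module.intro, goal_cases)
    case (1 n) then show ?case by (simp add: op)
  next
    case (2 n i) then show ?case by (cases n) (simp_all add: op d)
  next
    case (3 i n) then show ?case by (simp add: op s)
  next
    case (4 n) then show ?case by (simp add: op t)
  next
    case (5 n)
    have inv: "(t n ^^ n) (t n x) = x" "t n ((t n ^^ n) x) = x" if "x \<in> C (R (Suc n))" for x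
      using period[OF that] by (simp_all add: funpow_swap1)
    show ?case unfolding op
      by (rule bij_betw_byWitness[where f'="t n ^^ n"]) (auto simp: inv lin_maps_closed[OF t] lin_maps_closed[OF t_pow])
  next
    case (6 n i j x)
    then obtain m where n: "n = Suc (Suc m)" by (metis One_nat_def Suc_1 Suc_le_D Suc_le_mono)
    from 6 obtain j' where j: "j = Suc j'" by (cases j) auto
    have x: "x \<in> C (R (Suc (Suc (Suc m))))" using 6 by (simp add: op n)
    have "d (Suc m) i (d (Suc (Suc m)) (Suc j') x) = d (Suc m) j' (d (Suc (Suc m)) i x)"
      by (rule eqI[OF lin_maps_comp[OF d d] lin_maps_comp[OF d d] _ x])
        (use 6 n j face_face_list[OF X, of _ m i j'] in \<open>simp_all add: dp fc, simp add: R_def\<close>)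
    then show ?case by (simp add: n j op)
  next
    case (7 i j n x)
    have x: "x \<in> C (R (Suc n))" using 7 by (simp add: op)
    have "s (Suc n) i (s n j x) = s (Suc n) (Suc j) (s n i x)"
      by (rule eqI[OF lin_maps_comp[OF s s] lin_maps_comp[OF s s] _ x])
        (use 7 degen_degen_list[OF X, of _ n i j] in \<open>simp_all add: sp ic, simp add: R_def\<close>)
    then show ?case by (simp add: op)
  next
    case (8 i j n x)
    then obtain m j' where n: "n = Suc m" "j = Suc j'" by (cases n; cases j) auto
    have x: "x \<in> C (R (Suc (Suc m)))" using 8 by (simp add: op n)
    have "d (Suc (Suc m)) i (s (Suc m) (Suc j') x) = s m j' (d (Suc m) i x)"
      by (rule eqI[OF lin_maps_comp[OF s d] lin_maps_comp[OF d s] _ x])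
        (use 8 n face_degen_less_list[OF X, of _ m i j'] in \<open>simp_all add: sp ic dp fc, simp add: R_def\<close>)
    then show ?case by (simp add: op n)
  next
    case (9 j n i x)
    have x: "x \<in> C (R (Suc n))" using 9 by (simp add: op)
    have "d (Suc n) i (s n j x) = x"
    proof (rule eqI[OF lin_maps_comp[OF s d] lin_maps_id _ x])
      fix xs assume xs: "xs \<in> tuples (R (Suc n))"
      have "face_list X (Suc n) i (insert_one X (Suc j) xs) = xs"
        by (rule face_degen_same_list[OF X _ 9(1) 9(2)[unfolded Suc_eq_plus1[symmetric]]]) (use xs in \<open>simp only: R_def\<close>)
      then show "d (Suc n) i (s n j (pure K (R (Suc n)) xs)) = pure K (R (Suc n)) xs"
        using 9 xs by (auto simp: sp ic dp)
    qed (use 9 in auto)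
    then show ?case by (simp add: op)
  next
    case (10 j i n x)
    then obtain m i' where n: "n = Suc m" "i = Suc i'" by (cases n; cases i) auto
    have x: "x \<in> C (R (Suc (Suc m)))" using 10 by (simp add: op n)
    have "d (Suc (Suc m)) (Suc i') (s (Suc m) j x) = s m j (d (Suc m) i' x)"
      by (rule eqI[OF lin_maps_comp[OF s d] lin_maps_comp[OF d s] _ x])
        (use 10 n face_degen_greater_list[OF X, of _ m j i'] in \<open>simp_all add: sp ic dp fc, simp add: R_def\<close>)
    then show ?case by (simp add: op n)
  next
    case (11 i n x)
    then obtain m i' where n: "n = Suc m" "i = Suc i'" by (cases n; cases i) auto
    have x: "x \<in> C (R (Suc (Suc m)))" using 11 by (simp add: op n)
    have "d (Suc m) (Suc i') (t (Suc m) x) = t m (d (Suc m) i' x)"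
      by (rule eqI[OF lin_maps_comp[OF t d] lin_maps_comp[OF d t] _ x])
        (use 11 n face_cyc_list[OF X, of _ m i'] in \<open>simp_all add: tp rc dp fc, simp add: R_def\<close>)
    then show ?case by (simp add: op n)
  next
    case (12 n x)
    then obtain m where n: "n = Suc m" by (cases n) auto
    have x: "x \<in> C (R (Suc (Suc m)))" using 12 by (simp add: op n)
    have "d (Suc m) 0 (t (Suc m) x) = d (Suc m) (Suc m) x"
      by (rule eqI[OF lin_maps_comp[OF t d] d _ x])
        (use n face_0_cyc_list[OF X, of _ m] in \<open>simp_all add: tp rc dp fc, simp add: R_def\<close>)
    then show ?case by (simp add: op n)
  next
    case (13 i n x)
    then obtain i' where i: "i = Suc i'" by (cases i) auto
    have x: "x \<in> C (R (Suc n))" using 13 by (simp add: op)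
    have "s n (Suc i') (t n x) = t (Suc n) (s n i' x)"
      by (rule eqI[OF lin_maps_comp[OF t s] lin_maps_comp[OF s t] _ x])
        (use 13 i degen_cyc_list[OF X, of _ n i'] in \<open>simp_all add: tp rc sp ic, simp add: R_def\<close>)
    then show ?case by (simp add: op i)
  next
    case (14 x n)
    have x: "x \<in> C (R (Suc n))" using 14 by (simp add: op)
    have "s n 0 (t n x) = t (Suc n) (t (Suc n) (s n n x))"
      by (rule eqI[OF lin_maps_comp[OF t s] lin_maps_comp[OF s lin_maps_comp[OF t t]] _ x])
        (use degen_0_cyc_list[OF X, of _ n] in \<open>simp_all add: tp rc sp ic, simp add: R_def\<close>)
    then show ?case by (simp add: op)
  next
    case (15 x n)
    then show ?case using period[of x n] by (simp add: op del: funpow.simps)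
  qed
qed

end

end

section \<open>Transport of a cyclic structure\<close>

text \<open>The operators of \<open>C\<close> are the conjugates of those of \<open>D\<close>, and therefore inherit linearity and the
  identities from them.\<close>

lemma isomorphic_cyclic_modules_transport:
  assumes D: "cyclic_module K D" and mods: "\<And>n. module K (obj C n)"
    and lin: "\<And>n. \<theta> n \<in> lin_maps K (obj D n) (obj C n)"
    and bij: "\<And>n. bij_betw (\<theta> n) (carrier (obj D n)) (carrier (obj C n))"
    and face: "\<And>n i y. 1 \<le> n \<Longrightarrow> i \<le> n \<Longrightarrow> y \<in> carrier (obj D n) \<Longrightarrow> \<theta> (n - 1) (face D n i y) = face C n i (\<theta> n y)"
    and degen: "\<And>n i y. i \<le> n \<Longrightarrow> y \<in> carrier (obj D n) \<Longrightarrow> \<theta> (n + 1) (degen D n i y) = degen C n i (\<theta> n y)"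
    and cyc: "\<And>n y. y \<in> carrier (obj D n) \<Longrightarrow> \<theta> n (cyc D n y) = cyc C n (\<theta> n y)"
  shows "isomorphic_cyclic_modules K C D"
proof -
  interpret D: cyclic_module K D by fact
  define \<phi> where "\<phi> n = inv_into (carrier (obj D n)) (\<theta> n)" for n
  have \<phi>\<theta>: "\<phi> n (\<theta> n y) = y" if "y \<in> carrier (obj D n)" for n y
    using bij[of n] that by (simp add: \<phi>_def bij_betw_def)
  have \<theta>\<phi>: "\<theta> n (\<phi> n x) = x" if "x \<in> carrier (obj C n)" for n x
    using bij[of n] that by (simp add: \<phi>_def bij_betw_def f_inv_into_f)
  have \<phi>_cl: "\<phi> n x \<in> carrier (obj D n)" if "x \<in> carrier (obj C n)" for n x
    using bij[of n] that by (simp add: \<phi>_def bij_betw_def inv_into_into)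
  have \<theta>_cl: "\<theta> n y \<in> carrier (obj C n)" if "y \<in> carrier (obj D n)" for n y
    using lin_maps_closed[OF lin that] .
  have \<phi>_lin: "\<phi> n \<in> lin_maps K (obj C n) (obj D n)" for n
    by (rule lin_maps_inverse[OF lin bij D.obj_module mods \<phi>\<theta>])
  have ex: "\<exists>y\<in>carrier (obj D n). x = \<theta> n y" if "x \<in> carrier (obj C n)" for n x
    using \<theta>\<phi>[OF that] \<phi>_cl[OF that] by metis
  have face': "face C n i (\<theta> n y) = \<theta> (n - 1) (face D n i y)" if "1 \<le> n" "i \<le> n" "y \<in> carrier (obj D n)" for n i y
    using face[OF that] by simp
  have degen': "degen C n i (\<theta> n y) = \<theta> (Suc n) (degen D n i y)" if "i \<le> n" "y \<in> carrier (obj D n)" for n i y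
    using degen[OF that] by simp
  have cyc': "cyc C n (\<theta> n y) = \<theta> n (cyc D n y)" if "y \<in> carrier (obj D n)" for n y
    using cyc[OF that] by simp
  have fcl: "face D n i y \<in> carrier (obj D (n - 1))" if "1 \<le> n" "i \<le> n" "y \<in> carrier (obj D n)" for n i y
    using lin_maps_closed[OF D.face_linear[OF that(1,2)] that(3)] .
  have scl: "degen D n i y \<in> carrier (obj D (Suc n))" if "i \<le> n" "y \<in> carrier (obj D n)" for n i y
    using lin_maps_closed[OF D.degen_linear[OF that(1)] that(2)] by simp
  have tcl: "cyc D n y \<in> carrier (obj D n)" if "y \<in> carrier (obj D n)" for n y
    using lin_maps_closed[OF D.cyc_linear that] .
  have tpow: "(cyc D n ^^ k) y \<in> carrier (obj D n) \<and> (cyc C n ^^ k) (\<theta> n y) = \<theta> n ((cyc D n ^^ k) y)"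
    if "y \<in> carrier (obj D n)" for n k y
    by (induction k) (simp_all add: that tcl cyc')
  have C: "cyclic_module K C"
  proof (rule cyclic_module.intro, goal_cases)
    case (1 n) show ?case by (rule mods)
  next
    case (2 n i)
    have "(\<lambda>x. \<theta> (n - 1) (face D n i (\<phi> n x))) \<in> lin_maps K (obj C n) (obj C (n - 1))"
      by (rule lin_maps_comp[OF lin_maps_comp[OF \<phi>_lin D.face_linear[OF 2]] lin])
    then show ?case
      by (rule lin_maps_cong[OF _ mods]) (use face'[OF 2 \<phi>_cl] \<theta>\<phi> in simp)
  next
    case (3 i n)
    have "(\<lambda>x. \<theta> (n + 1) (degen D n i (\<phi> n x))) \<in> lin_maps K (obj C n) (obj C (n + 1))"
      by (rule lin_maps_comp[OF lin_maps_comp[OF \<phi>_lin D.degen_linear[OF 3]] lin])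
    then show ?case
      by (rule lin_maps_cong[OF _ mods]) (use degen'[OF 3 \<phi>_cl] \<theta>\<phi> in simp)
  next
    case (4 n)
    have "(\<lambda>x. \<theta> n (cyc D n (\<phi> n x))) \<in> lin_maps K (obj C n) (obj C n)"
      by (rule lin_maps_comp[OF lin_maps_comp[OF \<phi>_lin D.cyc_linear] lin])
    then show ?case
      by (rule lin_maps_cong[OF _ mods]) (use cyc'[OF \<phi>_cl] \<theta>\<phi> in simp)
  next
    case (5 n)
    have "bij_betw (\<phi> n) (carrier (obj C n)) (carrier (obj D n))"
      unfolding \<phi>_def by (rule bij_betw_inv_into[OF bij])
    from bij_betw_trans[OF bij_betw_trans[OF this D.cyc_bij] bij]
    show ?case
      by (rule iffD1[OF bij_betw_cong, rotated]) (use cyc'[OF \<phi>_cl] \<theta>\<phi> in simp)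
  next
    case (6 n i j x)
    then obtain y where y: "y \<in> carrier (obj D n)" "x = \<theta> n y" using ex by blast
    \<comment> \<open>Faces of faces start in degree \<open>n \<ge> 2\<close>, so no subtraction is truncated.\<close>
    define m where "m = n - 2"
    with 6 have n: "n = Suc (Suc m)" by simp
    have "face C (n - 1) i (face C n j x) = \<theta> m (face D (Suc m) i (face D n j y))"
      using 6 y n face'[of "Suc m" i "face D n j y"] fcl[of n j y] by (simp add: face')
    also have "\<dots> = \<theta> m (face D (Suc m) (j - 1) (face D n i y))"
      using D.face_face[OF 6(1-3) y(1)] n by simp
    also have "\<dots> = face C (n - 1) (j - 1) (face C n i x)"
      using 6 y n face'[of "Suc m" "j - 1" "face D n i y"] fcl[of n i y] by (simp add: face')
    finally show ?case .
  next
    case (7 i j n x)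
    then obtain y where y: "y \<in> carrier (obj D n)" "x = \<theta> n y" using ex by blast
    show ?case using 7 y D.degen_degen[OF 7(1,2) y(1)] by (simp add: degen' scl)
  next
    case (8 i j n x)
    then obtain y where y: "y \<in> carrier (obj D n)" "x = \<theta> n y" using ex by blast
    obtain m where n: "n = Suc m" using 8 by (cases n) auto
    have "face C (n + 1) i (degen C n j x) = \<theta> n (face D (n + 1) i (degen D n j y))"
      using 8 y face'[of "Suc n" i] by (simp add: degen' scl)
    also have "\<dots> = \<theta> n (degen D (n - 1) (j - 1) (face D n i y))"
      using D.face_degen_less[OF 8(1,2) y(1)] by simp
    also have "\<dots> = degen C (n - 1) (j - 1) (face C n i x)"
      using 8 y n degen'[of "j - 1" m] fcl[of n i y] by (simp add: face')
    finally show ?case .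
  next
    case (9 j n i x)
    then obtain y where y: "y \<in> carrier (obj D n)" "x = \<theta> n y" using ex by blast
    have "face C (n + 1) i (degen C n j x) = \<theta> n (face D (n + 1) i (degen D n j y))"
      using 9 y face'[of "Suc n" i] by (auto simp: degen' scl)
    with D.face_degen_same[OF 9(1,2) y(1)] y show ?case by simp
  next
    case (10 j i n x)
    then obtain y where y: "y \<in> carrier (obj D n)" "x = \<theta> n y" using ex by blast
    obtain m where n: "n = Suc m" using 10 by (cases n) auto
    have "face C (n + 1) i (degen C n j x) = \<theta> n (face D (n + 1) i (degen D n j y))"
      using 10 y face'[of "Suc n" i] by (simp add: degen' scl)
    also have "\<dots> = \<theta> n (degen D (n - 1) j (face D n (i - 1) y))"
      using D.face_degen_greater[OF 10(1,2) y(1)] by simp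
    also have "\<dots> = degen C (n - 1) j (face C n (i - 1) x)"
      using 10 y n degen'[of j m] fcl[of n "i - 1" y] by (simp add: face')
    finally show ?case .
  next
    case (11 i n x)
    then obtain y where y: "y \<in> carrier (obj D n)" "x = \<theta> n y" using ex by blast
    have "face C n i (cyc C n x) = \<theta> (n - 1) (face D n i (cyc D n y))"
      using 11 y by (simp add: cyc' tcl face')
    also have "\<dots> = \<theta> (n - 1) (cyc D (n - 1) (face D n (i - 1) y))"
      using D.face_cyc[OF 11(1,2) y(1)] by simp
    also have "\<dots> = cyc C (n - 1) (face C n (i - 1) x)"
      using 11 y fcl[of n "i - 1" y] by (simp add: cyc' face')
    finally show ?case .
  next
    case (12 n x)
    then obtain y where y: "y \<in> carrier (obj D n)" "x = \<theta> n y" using ex by blast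
    show ?case using 12 y D.face_0_cyc[OF 12(1) y(1)] by (simp add: cyc' tcl face')
  next
    case (13 i n x)
    then obtain y where y: "y \<in> carrier (obj D n)" "x = \<theta> n y" using ex by blast
    show ?case using 13 y D.degen_cyc[OF 13(1,2) y(1)] by (simp add: cyc' tcl degen' scl)
  next
    case (14 x n)
    then obtain y where y: "y \<in> carrier (obj D n)" "x = \<theta> n y" using ex by blast
    show ?case using y D.degen_0_cyc[OF y(1)] by (simp add: cyc' tcl degen' scl)
  next
    case (15 x n)
    then obtain y where y: "y \<in> carrier (obj D n)" "x = \<theta> n y" using ex by blast
    show ?case using y D.cyc_period[OF y(1)] tpow[OF y(1), of "n + 1"] by simp
  qed
  have "cyclic_iso K C D \<phi>"
    unfolding cyclic_iso_def
  proof (intro allI conjI ballI impI)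
    fix n
    show "\<phi> n \<in> lin_maps K (obj C n) (obj D n)" by (rule \<phi>_lin)
    show "bij_betw (\<phi> n) (carrier (obj C n)) (carrier (obj D n))"
      unfolding \<phi>_def by (rule bij_betw_inv_into[OF bij])
    fix x assume "x \<in> carrier (obj C n)"
    then obtain y where y: "y \<in> carrier (obj D n)" "x = \<theta> n y" using ex by blast
    show "\<phi> (n - 1) (face C n i x) = face D n i (\<phi> n x)" if "i \<le> n" "1 \<le> n" for i
      using that y \<phi>\<theta>[OF fcl[OF that(2,1) y(1)]] by (simp add: face' \<phi>\<theta>)
    show "\<phi> (n + 1) (degen C n i x) = degen D n i (\<phi> n x)" if "i \<le> n" for i
      using that y by (simp add: degen' \<phi>\<theta> scl)
    show "\<phi> n (cyc C n x) = cyc D n (\<phi> n x)"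
      using y by (simp add: cyc' \<phi>\<theta> tcl)
  qed
  with C D show ?thesis unfolding isomorphic_cyclic_modules_def by blast
qed

sublocale strong_smash \<subseteq> natural_data K A B R .

context strong_smash
begin

section \<open>Flattening tensor powers of the smash product\<close>

primrec ab :: "nat \<Rightarrow> bool list" where
  "ab 0 = []"
| "ab (Suc n) = True # False # ab n"

abbreviation AB :: "nat \<Rightarrow> ('k, 'x) module list" where "AB n \<equiv> wd (ab n)"

lemma ab_add: "ab (m + n) = ab m @ ab n"
  by (induction m) auto

lemma count_ab [simp]: "cA (ab n) = n" "cB (ab n) = n"
  by (induction n) auto

abbreviation Xs :: "nat \<Rightarrow> ('k, ('x, 'k) tens) module list" where "Xs n \<equiv> replicate n X"

lemma module_smash [simp]: "module K X" by (rule assoc_algebra_module[OF smash_algebra])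

text \<open>Concatenation of the entries of a list over the smash product, which are themselves tensors over
  \<open>[A, B]\<close>.\<close>

primrec cat :: "('x, 'k) tens list \<Rightarrow> ('x, 'k) tens" where
  "cat [] = pure K [] []"
| "cat (x # xs) = tcat K [A, B] (AB (length xs)) x (cat xs)"

lemma cat_multilin: "multilin (Xs n) (T (AB n)) cat"
proof (induction n)
  case 0
  show ?case by (rule multilinI) auto
next
  case (Suc n)
  have "(\<lambda>x. x) \<in> lin_maps K X (T [A, B])" by (rule lin_mapsI) simp_all
  from multilin_single[OF this] have 1: "multilin [X] (T [A, B]) (\<lambda>xs. hd xs)" .
  have "multilin ([X] @ Xs n) (T ([A, B] @ AB n)) (\<lambda>xs. tcat K [A, B] (AB n) (hd (take (length [X]) xs)) (cat (drop (length [X]) xs)))"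
    by (rule multilin_tcat[OF _ _ _ _ 1 Suc]) simp_all
  then have "multilin ([X] @ Xs n) (T ([A, B] @ AB n)) cat"
    by (rule multilin_cong[rotated]) (auto simp: tuples_Cons tuples_length)
  then show ?case by simp
qed

lemma cat_closed: "xs \<in> tuples (Xs n) \<Longrightarrow> cat xs \<in> C (AB n)"
  using multilin_closed[OF cat_multilin] .

text \<open>A tensor power of the smash product consists of tensors of tensors; \<open>flat\<close> removes the inner level.\<close>

definition flat :: "nat \<Rightarrow> (('x, 'k) tens, 'k) tens \<Rightarrow> ('x, 'k) tens" where
  "flat n = tlift K (Xs n) (T (AB n)) cat"

lemma flat_hom: "flat n \<in> Hom (Xs n) (AB n)"
  unfolding flat_def by (rule tlift_lin) (simp_all add: tensor_module cat_multilin)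

lemma flat_pure: "xs \<in> tuples (Xs n) \<Longrightarrow> flat n (pure K (Xs n) xs) = cat xs"
  unfolding flat_def by (rule tlift_pure) (simp_all add: tensor_module cat_multilin)

text \<open>Reads a word \<open>A B A B \<cdots>\<close> as a list of pure tensors over \<open>[A, B]\<close>; the inverse of \<open>flat\<close> is induced
  by it.\<close>

fun pairs :: "'x list \<Rightarrow> ('x, 'k) tens list" where
  "pairs (a # b # r) = pure K [A, B] [a, b] # pairs r"
| "pairs _ = []"

lemma pairs_closed: "ys \<in> tuples (AB n) \<Longrightarrow> pairs ys \<in> tuples (Xs n)"
  by (induction n arbitrary: ys) (auto simp: tuples_Cons)

lemma pairs_multilin: "multilin (AB n) (T (Xs n)) (\<lambda>ys. pure K (Xs n) (pairs ys))"
proof (induction n)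
  case 0
  show ?case by (rule multilinI) auto
next
  case (Suc n)
  have "multilin [A, B] (T [A, B]) (pure K [A, B])" by (rule pure_multilin) simp
  then have "multilin [A, B] X (pure K [A, B])" by (simp add: multilin_def lin_maps_def)
  then have 1: "multilin [A, B] (T [X]) (\<lambda>ys. pure K [X] [pure K [A, B] ys])"
    by (intro multilin_pure_single) simp_all
  have "multilin ([A, B] @ AB n) (T ([X] @ Xs n))
      (\<lambda>xs. tcat K [X] (Xs n) (pure K [X] [pure K [A, B] (take (length [A, B]) xs)]) (pure K (Xs n) (pairs (drop (length [A, B]) xs))))"
    by (rule multilin_tcat[OF _ _ _ _ 1 Suc]) simp_all
  then have "multilin ([A, B] @ AB n) (T ([X] @ Xs n)) (\<lambda>ys. pure K ([X] @ Xs n) (pairs ys))"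
  proof (rule multilin_cong[rotated])
    fix ys assume "ys \<in> tuples ([A, B] @ AB n)"
    then obtain a b r where ys: "ys = a # b # r" "a \<in> carrier A" "b \<in> carrier B" "r \<in> tuples (AB n)" by (auto simp: tuples_Cons)
    then show "pure K ([X] @ Xs n) (pairs ys) =
        tcat K [X] (Xs n) (pure K [X] [pure K [A, B] (take (length [A, B]) ys)]) (pure K (Xs n) (pairs (drop (length [A, B]) ys)))"
      using tcat_pure[of "[X]" "Xs n" "[pure K [A, B] [a, b]]" "pairs r"] pairs_closed[OF ys(4)] by simp
  qed simp
  then show ?case by simp
qed

definition unflat :: "nat \<Rightarrow> ('x, 'k) tens \<Rightarrow> (('x, 'k) tens, 'k) tens" where
  "unflat n = tlift K (AB n) (T (Xs n)) (\<lambda>ys. pure K (Xs n) (pairs ys))"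

lemma unflat_hom: "unflat n \<in> Hom (AB n) (Xs n)"
  unfolding unflat_def by (rule tlift_lin) (simp_all add: tensor_module pairs_multilin)

lemma unflat_pure: "ys \<in> tuples (AB n) \<Longrightarrow> unflat n (pure K (AB n) ys) = pure K (Xs n) (pairs ys)"
  unfolding unflat_def by (rule tlift_pure) (simp_all add: tensor_module pairs_multilin)

text \<open>By definition \<open>unflat\<close> is known on pure tensors of the letters. For \<open>unflat \<circ> flat = id\<close> it has to be
  evaluated when the entries are arbitrary tensors over \<open>[A, B]\<close>, and this follows by bilinearity.\<close>

lemma unflat_tcat:
  assumes p: "p \<in> C [A, B]" and y: "y \<in> C (AB n)"
  shows "unflat (Suc n) (tcat K [A, B] (AB n) p y) = tcat K [X] (Xs n) (pure K [X] [p]) (unflat n y)"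
proof -
  have TM: "module K (T ([X] @ Xs n))" by (rule tensor_module) simp
  have u: "unflat (Suc n) \<in> Hom ([A, B] @ AB n) ([X] @ Xs n)" using unflat_hom[of "Suc n"] by simp
  have sgl: "(\<lambda>p. pure K [X] [p]) \<in> Hom [A, B] [X]"
    using pure_single_lin[OF module_smash] by (simp add: lin_maps_def)
  have 1: "unflat (Suc n) (tcat K [A, B] (AB n) (pure K [A, B] xs) y) = tcat K [X] (Xs n) (pure K [X] [pure K [A, B] xs]) (unflat n y)"
    if xs: "xs \<in> tuples [A, B]" and y: "y \<in> C (AB n)" for xs y
  proof (rule lin_maps_eqI[OF _ TM lin_maps_comp[OF tcat_lin_right u] lin_maps_comp[OF unflat_hom tcat_lin_right] _ y])
    fix ys assume ys: "ys \<in> tuples (AB n)"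
    obtain a b where ab: "xs = [a, b]" "a \<in> carrier A" "b \<in> carrier B" using xs by (auto simp: tuples_Cons)
    have "tcat K [A, B] (AB n) (pure K [A, B] xs) (pure K (AB n) ys) = pure K (AB (Suc n)) (xs @ ys)"
      using tcat_pure[of "[A, B]" "AB n" xs ys] xs ys by simp
    moreover have "unflat (Suc n) (pure K (AB (Suc n)) (xs @ ys)) = pure K (Xs (Suc n)) (pairs (xs @ ys))"
      by (rule unflat_pure) (use ab ys in simp)
    moreover have "pure K (Xs (Suc n)) (pairs (xs @ ys)) = tcat K [X] (Xs n) (pure K [X] [pure K [A, B] xs]) (pure K (Xs n) (pairs ys))"
      using tcat_pure[of "[X]" "Xs n" "[pure K [A, B] xs]" "pairs ys"] pairs_closed[OF ys] xs ab by simp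
    ultimately show "unflat (Suc n) (tcat K [A, B] (AB n) (pure K [A, B] xs) (pure K (AB n) ys)) =
        tcat K [X] (Xs n) (pure K [X] [pure K [A, B] xs]) (unflat n (pure K (AB n) ys))"
      using unflat_pure[OF ys] by simp
  qed (use xs in simp_all)
  have uy: "unflat n y \<in> C (Xs n)" by (rule lin_maps_closed[OF unflat_hom y])
  show ?thesis
    by (rule lin_maps_eqI[OF _ TM lin_maps_comp[OF tcat_lin_left u] lin_maps_comp[OF sgl tcat_lin_left] _ p])
      (simp_all add: y uy 1)
qed

lemma unflat_cat: "xs \<in> tuples (Xs n) \<Longrightarrow> unflat n (cat xs) = pure K (Xs n) xs"
proof (induction n arbitrary: xs)
  case 0
  then show ?case using unflat_pure[of "[]" 0] by simp
next
  case (Suc n)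
  then obtain x r where xs: "xs = x # r" "x \<in> C [A, B]" "r \<in> tuples (Xs n)" by (auto simp: tuples_Cons)
  then show ?case
    using unflat_tcat[OF xs(2) cat_closed[OF xs(3)]] Suc.IH[OF xs(3)] tcat_pure[of "[X]" "Xs n" "[x]" r]
    by (simp add: tuples_length)
qed

lemma cat_pairs: "ys \<in> tuples (AB n) \<Longrightarrow> cat (pairs ys) = pure K (AB n) ys"
proof (induction n arbitrary: ys)
  case (Suc n)
  then obtain a b r where ys: "ys = a # b # r" "a \<in> carrier A" "b \<in> carrier B" "r \<in> tuples (AB n)" by (auto simp: tuples_Cons)
  then show ?case
    using Suc.IH[OF ys(4)] tcat_pure[of "[A, B]" "AB n" "[a, b]" r] tuples_length[OF pairs_closed[OF ys(4)]] by simp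
qed simp

lemma flat_bij: "bij_betw (flat n) (C (Xs n)) (C (AB n))"
proof (rule bij_betw_byWitness[where f'="unflat n"])
  show "\<forall>a\<in>C (Xs n). unflat n (flat n a) = a"
  proof
    fix a assume a: "a \<in> C (Xs n)"
    show "unflat n (flat n a) = a"
      by (rule lin_maps_eqI[OF _ _ lin_maps_comp[OF flat_hom unflat_hom] lin_maps_id _ a])
        (simp_all add: tensor_module flat_pure unflat_cat)
  qed
  show "\<forall>a\<in>C (AB n). flat n (unflat n a) = a"
  proof
    fix a assume a: "a \<in> C (AB n)"
    show "flat n (unflat n a) = a"
      by (rule lin_maps_eqI[OF _ _ lin_maps_comp[OF unflat_hom flat_hom] lin_maps_id _ a])
        (simp_all add: tensor_module flat_pure unflat_pure pairs_closed cat_pairs)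
  qed
qed (auto simp: lin_maps_closed[OF flat_hom] lin_maps_closed[OF unflat_hom])

lemma cat_append:
  "xs \<in> tuples (Xs m) \<Longrightarrow> ys \<in> tuples (Xs n) \<Longrightarrow> cat (xs @ ys) = tcat K (AB m) (AB n) (cat xs) (cat ys)"
proof (induction m arbitrary: xs)
  case 0
  then show ?case using cat_closed[of ys n] by (simp add: tcat_unit_left)
next
  case (Suc m)
  then obtain x r where xs: "xs = x # r" "x \<in> C [A, B]" "r \<in> tuples (Xs m)" by (auto simp: tuples_Cons)
  then show ?case
    using Suc.IH[OF xs(3) Suc.prems(2)] tcat_assoc[of "[A, B]" "AB m" "AB n" x "cat r" "cat ys"]
      cat_closed[OF xs(3)] cat_closed[OF Suc.prems(2)] Suc.prems(2)
    by (simp add: tuples_length ab_add)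
qed

lemma cat_single: "x \<in> C [A, B] \<Longrightarrow> cat [x] = x"
  by (simp add: tcat_unit_right)

lemma flat_face:
  assumes z: "z \<in> C (Xs (i + Suc (Suc k)))"
  shows "flat (i + Suc k) (tmap K (Xs (i + Suc (Suc k))) (Xs (i + Suc k)) (face_list X (i + Suc k) i) z) =
    W (AB i) [A, B, A, B] [A, B] (AB k) smash_mult (flat (i + Suc (Suc k)) z)"
proof -
  let ?n = "i + Suc k"
  have n: "i + Suc (Suc k) = Suc ?n" by simp
  have f: "tmap K (Xs (Suc ?n)) (Xs ?n) (face_list X ?n i) \<in> Hom (Xs (Suc ?n)) (Xs ?n)"
    by (rule alg_face(1)[OF smash_algebra]) simp_all
  have w: "W (AB i) [A, B, A, B] [A, B] (AB k) smash_mult \<in> Hom (AB (Suc ?n)) (AB ?n)"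
    by (rule whisker_hom[OF _ _ _ _ smash_mult_hom])
      (use arg_cong[OF ab_add[of i "Suc (Suc k)"], of wd] arg_cong[OF ab_add[of i "Suc k"], of wd] in simp_all)
  have z': "z \<in> C (Xs (Suc ?n))" using z by simp
  have "flat ?n (tmap K (Xs (Suc ?n)) (Xs ?n) (face_list X ?n i) z) = W (AB i) [A, B, A, B] [A, B] (AB k) smash_mult (flat (Suc ?n) z)"
  proof (rule lin_maps_eqI[OF _ _ lin_maps_comp[OF f flat_hom] lin_maps_comp[OF flat_hom w] _ z'])
    fix xs assume xs: "xs \<in> tuples (Xs (Suc ?n))"
    have "Xs (Suc ?n) = Xs i @ [X, X] @ Xs k"
      unfolding n[symmetric] by (simp add: replicate_add replicate_app_Cons_same replicate_append_same)
    then obtain us x y vs where e: "xs = us @ [x, y] @ vs" "us \<in> tuples (Xs i)" "x \<in> C [A, B]" "y \<in> C [A, B]" "vs \<in> tuples (Xs k)"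
      using xs by (auto simp: tuples_append tuples_Cons)
    have c: "cat us \<in> C (AB i)" "cat vs \<in> C (AB k)" using e cat_closed by simp_all
    have xy: "tcat K [A, B] [A, B] x y \<in> C [A, B, A, B]" using e by (simp add: tcat_closed)
    have fl: "face_list X ?n i xs = us @ [x \<otimes>\<^bsub>X\<^esub> y] @ vs"
      using e by (simp add: face_list_def contract_def tuples_length nth_append)
    have t2: "[x, y] @ vs \<in> tuples (Xs (Suc (Suc k)))" "[x \<otimes>\<^bsub>X\<^esub> y] @ vs \<in> tuples (Xs (Suc k))"
      using e by (simp_all add: smash_mult smash_closed)
    have "cat xs = tcat K (AB i) (AB (Suc (Suc k))) (cat us) (cat ([x, y] @ vs))"
      unfolding e(1) by (rule cat_append[OF e(2) t2(1)])
    also have "cat ([x, y] @ vs) = tcat K [A, B, A, B] (AB k) (tcat K [A, B] [A, B] x y) (cat vs)"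
      using e c tcat_assoc[of "[A, B]" "[A, B]" "AB k" x y "cat vs"] by (simp add: tuples_length)
    finally have 1: "cat xs = tcat K (AB i) ([A, B, A, B] @ AB k) (cat us) (tcat K [A, B, A, B] (AB k) (tcat K [A, B] [A, B] x y) (cat vs))"
      by simp
    have "cat (us @ [x \<otimes>\<^bsub>X\<^esub> y] @ vs) = tcat K (AB i) (AB (Suc k)) (cat us) (cat ([x \<otimes>\<^bsub>X\<^esub> y] @ vs))"
      by (rule cat_append[OF e(2) t2(2)])
    then have 2: "cat (us @ [x \<otimes>\<^bsub>X\<^esub> y] @ vs) = tcat K (AB i) ([A, B] @ AB k) (cat us) (tcat K [A, B] (AB k) (smash_mult (tcat K [A, B] [A, B] x y)) (cat vs))"
      using e by (simp add: tuples_length smash_mult)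
    have 3: "W (AB i) [A, B, A, B] [A, B] (AB k) smash_mult (cat xs) = cat (us @ [x \<otimes>\<^bsub>X\<^esub> y] @ vs)"
      unfolding 1 2 by (rule whisker_tcat[OF _ _ _ _ smash_mult_hom c(1) xy c(2)]) simp_all
    have "tmap K (Xs (Suc ?n)) (Xs ?n) (face_list X ?n i) (pure K (Xs (Suc ?n)) xs) = pure K (Xs ?n) (face_list X ?n i xs)"
      by (rule alg_face(2)[OF smash_algebra _ _ xs]) simp_all
    moreover have "face_list X ?n i xs \<in> tuples (Xs ?n)"
      by (rule face_list_closed[OF smash_algebra xs]) simp_all
    ultimately show "flat ?n (tmap K (Xs (Suc ?n)) (Xs ?n) (face_list X ?n i) (pure K (Xs (Suc ?n)) xs)) =
        W (AB i) [A, B, A, B] [A, B] (AB k) smash_mult (flat (Suc ?n) (pure K (Xs (Suc ?n)) xs))"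
      by (simp only: flat_pure[OF xs] flat_pure fl 3)
  qed (simp_all add: tensor_module)
  then show ?thesis by (simp only: n)
qed

lemma unit_pair_hom: "(\<lambda>x. W [A] [] [B] [] uB (uA x)) \<in> Hom [] [A, B]"
  by (rule lin_maps_comp[OF unit_hom]; (rule whisker_hom)?) (simp_all add: unit_hom)

text \<open>The unit of the smash product is inserted letter by letter, so that sorting can be applied to each unit.\<close>

lemma flat_degen:
  assumes z: "z \<in> C (Xs (i + k))"
  shows "flat (Suc (i + k)) (tmap K (Xs (i + k)) (Xs (Suc (i + k))) (insert_one X i) z) =
    W (AB i @ [A]) [] [B] (AB k) uB (W (AB i) [] [A] (AB k) uA (flat (i + k) z))"
proof -
  let ?u = "\<lambda>x. W [A] [] [B] [] uB (uA x)"
  let ?n = "i + k"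
  have uB: "W [A] [] [B] [] uB \<in> Hom [A] [A, B]" by (rule whisker_hom) (simp_all add: unit_hom)
  have f: "tmap K (Xs ?n) (Xs (Suc ?n)) (insert_one X i) \<in> Hom (Xs ?n) (Xs (Suc ?n))"
    by (rule alg_degen(1)[OF smash_algebra]) simp
  have S: "AB (Suc ?n) = AB i @ [A, B] @ AB k"
    using ab_add[of i "Suc k"] by simp
  have w: "W (AB i) [] [A, B] (AB k) ?u \<in> Hom (AB ?n) (AB (Suc ?n))"
    by (rule whisker_hom[OF _ _ _ _ unit_pair_hom _ S]) (simp_all add: ab_add)
  have main: "flat (Suc ?n) (tmap K (Xs ?n) (Xs (Suc ?n)) (insert_one X i) z) = W (AB i) [] [A, B] (AB k) ?u (flat ?n z)"
  proof (rule lin_maps_eqI[OF _ _ lin_maps_comp[OF f flat_hom] lin_maps_comp[OF flat_hom w] _ z])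
    fix xs assume xs: "xs \<in> tuples (Xs ?n)"
    then obtain us vs where e: "xs = us @ vs" "us \<in> tuples (Xs i)" "vs \<in> tuples (Xs k)"
      by (auto simp: tuples_append replicate_add)
    let ?e = "pure K [A, B] [\<one>\<^bsub>A\<^esub>, \<one>\<^bsub>B\<^esub>]"
    have c: "cat us \<in> C (AB i)" "cat vs \<in> C (AB k)" using e cat_closed by simp_all
    have fl: "insert_one X i xs = us @ [?e] @ vs"
      using e by (simp add: insert_one_def tuples_length)
    have t2: "[?e] @ vs \<in> tuples (Xs (Suc k))" using e by simp
    have 1: "cat xs = tcat K (AB i) ([] @ AB k) (cat us) (tcat K [] (AB k) (pure K [] []) (cat vs))"
      using cat_append[OF e(2,3)] e(1) c by (simp add: tcat_unit_left)
    have ue: "?u (pure K [] []) = ?e"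
      using whisker_left[of "[A]" "[]" "[B]" "uB" "pure K [A] [\<one>\<^bsub>A\<^esub>]" "pure K [] []"]
      by (simp add: unit_pure unit_hom tcat_pure)
    have "cat (us @ [?e] @ vs) = tcat K (AB i) (AB (Suc k)) (cat us) (cat ([?e] @ vs))"
      by (rule cat_append[OF e(2) t2])
    then have 2: "cat (us @ [?e] @ vs) = tcat K (AB i) ([A, B] @ AB k) (cat us) (tcat K [A, B] (AB k) (?u (pure K [] [])) (cat vs))"
      unfolding ue using e by (simp add: tuples_length)
    have 3: "W (AB i) [] [A, B] (AB k) ?u (cat xs) = cat (us @ [?e] @ vs)"
      unfolding 1 2 by (rule whisker_tcat[OF _ _ _ _ unit_pair_hom c(1) _ c(2)]) simp_all
    have "tmap K (Xs ?n) (Xs (Suc ?n)) (insert_one X i) (pure K (Xs ?n) xs) = pure K (Xs (Suc ?n)) (insert_one X i xs)"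
      by (rule alg_degen(2)[OF smash_algebra _ xs]) simp
    moreover have "insert_one X i xs \<in> tuples (Xs (Suc ?n))"
      by (rule insert_one_closed[OF smash_algebra xs]) simp
    ultimately show "flat (Suc ?n) (tmap K (Xs ?n) (Xs (Suc ?n)) (insert_one X i) (pure K (Xs ?n) xs)) =
        W (AB i) [] [A, B] (AB k) ?u (flat ?n (pure K (Xs ?n) xs))"
      by (simp only: flat_pure[OF xs] flat_pure fl 3)
  qed (simp_all add: tensor_module)
  have y: "flat ?n z \<in> C (AB i @ [] @ AB k)"
    using lin_maps_closed[OF flat_hom z] by (simp add: ab_add)
  have y1: "W (AB i) [] [A] (AB k) uA (flat ?n z) \<in> C (AB i @ [A] @ AB k)"
    by (rule whisker_closed[OF _ _ _ _ _ y]) (simp_all add: unit_hom)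
  have "W (AB i) [] [A, B] (AB k) ?u (flat ?n z) =
      W (AB i) [A] [A, B] (AB k) (W [A] [] [B] [] uB) (W (AB i) [] [A] (AB k) uA (flat ?n z))"
    by (rule whisker_comp[OF _ _ _ _ _ unit_hom uB y, symmetric]) simp_all
  also have "\<dots> = W (AB i @ [A]) [] [B] (AB k) uB (W (AB i) [] [A] (AB k) uA (flat ?n z))"
    using whisker_whisker[of "AB i" "[A]" "[]" "[B]" "[]" "AB k" "uB" "W (AB i) [] [A] (AB k) uA (flat ?n z)"] y1
    by (simp add: unit_hom)
  finally have "W (AB i) [] [A, B] (AB k) ?u (flat ?n z) = W (AB i @ [A]) [] [B] (AB k) uB (W (AB i) [] [A] (AB k) uA (flat ?n z))" .
  with main show ?thesis by (simp only:)
qed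

lemma flat_cyc:
  assumes z: "z \<in> C (Xs (Suc n))"
  shows "flat (Suc n) (tmap K (Xs (Suc n)) (Xs (Suc n)) rot z) = tflip K (AB n) [A, B] (flat (Suc n) z)"
proof -
  have S: "AB (Suc n) = AB n @ [A, B]" using ab_add[of n "Suc 0"] by simp
  have fl: "tflip K (AB n) [A, B] \<in> Hom (AB (Suc n)) (AB (Suc n))"
    using flip_hom[of "AB n" "[A, B]"] S by simp
  show ?thesis
  proof (rule lin_maps_eqI[OF _ _ lin_maps_comp[OF alg_cyc(1)[OF smash_algebra] flat_hom] lin_maps_comp[OF flat_hom fl] _ z])
    fix xs assume xs: "xs \<in> tuples (Xs (Suc n))"
    have "Xs (Suc n) = Xs n @ [X]" by (simp add: replicate_append_same)
    then obtain us x where e: "xs = us @ [x]" "us \<in> tuples (Xs n)" "x \<in> C [A, B]"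
      using xs by (auto simp: tuples_append tuples_Cons)
    have x: "[x] \<in> tuples (Xs (Suc 0))" using e by simp
    have 1: "cat xs = tcat K (AB n) [A, B] (cat us) x"
      using cat_append[OF e(2) x] e cat_single by simp
    have 2: "cat (rot xs) = tcat K [A, B] (AB n) x (cat us)"
      using e by (simp add: rot_def tuples_length)
    have "tflip K (AB n) [A, B] (cat xs) = cat (rot xs)"
      unfolding 1 2 by (rule flip_tcat) (use e cat_closed in simp_all)
    then show "flat (Suc n) (tmap K (Xs (Suc n)) (Xs (Suc n)) rot (pure K (Xs (Suc n)) xs)) =
        tflip K (AB n) [A, B] (flat (Suc n) (pure K (Xs (Suc n)) xs))"
      by (simp only: alg_cyc(2)[OF smash_algebra xs] flat_pure[OF xs] flat_pure[OF rot_closed[OF smash_algebra xs]])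
  qed (simp_all add: tensor_module)
qed

section \<open>The operators of the diagonal\<close>

lemma rearr_inverse: "rearr u v f \<Longrightarrow> \<exists>g. rearr v u g"
proof (induction rule: rearr.induct)
  case (refl u)
  show ?case using rearr.refl by blast
next
  case (fwd u v)
  show ?case using rearr.bwd by blast
next
  case (bwd u v)
  show ?case using rearr.fwd by blast
next
  case (comp u v f w g)
  then show ?case using rearr.comp by blast
next
  case (ext u v f g)
  then show ?case by blast
qed

text \<open>Sort \<open>u\<close> and undo the sorting of \<open>v\<close>.\<close>

lemma ex_rearr:
  assumes "cA u = cA v" "cB u = cB v" shows "\<exists>f. rearr u v f"
proof -
  obtain g where "rearr (sorted_word v) v g" using rearr_inverse[OF rearr_sort[of v]] by blast
  with rearr_sort[of u] assms show ?thesis using rearr.comp[of u "sorted_word v" "srt u" v g] by auto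
qed

text \<open>The word on which the diagonal lives in degree \<open>n - 1\<close>.\<close>

definition ba :: "nat \<Rightarrow> bool list" where
  "ba n = Fs n @ Ts n"

lemma ba_simps [simp]: "wd (ba n) = Bs n @ As n" "cA (ba n) = n" "cB (ba n) = n"
  by (simp_all add: ba_def)

lemma R_inv_eq: "R_inv = R_back"
  by (simp add: R_inv_def R_back_def)

text \<open>The letters are crossed one at a time, so the operators \<open>Theta\<close> and \<open>Gamma\<close> of the cylindrical module are
  rearrangements.\<close>

lemma rearr_slide_R:
  "j \<le> n \<Longrightarrow> rearr (False # Ts n) (Ts j @ False # Ts (n - j)) (slide K B A R n j)"
proof (induction j)
  case 0
  show ?case using rearr.refl by simp
next
  case (Suc j)
  have "n - j = Suc (n - Suc j)" using Suc by simp
  then have 1: "rearr (False # Ts n) (Ts j @ [False, True] @ Ts (n - Suc j)) (slide K B A R n j)"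
    using Suc by simp
  have 2: "rearr (Ts j @ [False, True] @ Ts (n - Suc j)) (Ts j @ [True, False] @ Ts (n - Suc j))
      (W (As j) [B, A] [A, B] (As (n - Suc j)) R)"
    using rearr.fwd[of "Ts j" "Ts (n - Suc j)"] by simp
  show ?case
    using rearr.comp[OF 1 2] by (simp add: replicate_app_Cons_same)
qed

lemma rearr_slide_R_back:
  "j \<le> n \<Longrightarrow> rearr (True # Fs n) (Fs j @ True # Fs (n - j)) (slide K A B R_back n j)"
proof (induction j)
  case 0
  show ?case using rearr.refl by simp
next
  case (Suc j)
  have "n - j = Suc (n - Suc j)" using Suc by simp
  then have 1: "rearr (True # Fs n) (Fs j @ [True, False] @ Fs (n - Suc j)) (slide K A B R_back n j)"
    using Suc by simp
  have 2: "rearr (Fs j @ [True, False] @ Fs (n - Suc j)) (Fs j @ [False, True] @ Fs (n - Suc j))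
      (W (Bs j) [A, B] [B, A] (Bs (n - Suc j)) R_back)"
    using rearr.bwd[of "Fs j" "Fs (n - Suc j)"] by simp
  show ?case
    using rearr.comp[OF 1 2] by (simp add: replicate_app_Cons_same)
qed

lemma rearr_Theta: "rearr (False # Ts (Suc q)) (Ts (Suc q) @ [False]) (Theta q)"
  using rearr_slide_R[of "Suc q" "Suc q"] by (simp add: Theta_def del: slide.simps)

lemma rearr_Gamma: "rearr (True # Fs (Suc p)) (Fs (Suc p) @ [True]) (Gamma p)"
  using rearr_slide_R_back[of "Suc p" "Suc p"] by (simp add: Gamma_def R_inv_eq del: slide.simps)

lemma factors_eq: "factors p q = Bs (Suc p) @ As (Suc q)"
  by (simp add: factors_def bs_def as_def)

lemma t_op_eq: "t_op p q x = tflip K (Bs p @ As (Suc q)) [B] (W (Bs p) (B # As (Suc q)) (As (Suc q) @ [B]) [] (Theta q) x)"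
  by (simp add: t_op_def bs_def as_def)

lemma tbar_op_eq: "tbar_op p q x = W [] (A # Bs (Suc p)) (Bs (Suc p) @ [A]) (As q) (Gamma p) (tflip K (Bs (Suc p) @ As q) [A] x)"
  by (simp add: tbar_op_def bs_def as_def)

lemma Theta_hom: "Theta q \<in> Hom (B # As (Suc q)) (As (Suc q) @ [B])"
  using rearr_hom[OF rearr_Theta] by simp

lemma Gamma_hom: "Gamma p \<in> Hom (A # Bs (Suc p)) (Bs (Suc p) @ [A])"
  using rearr_hom[OF rearr_Gamma] by simp

lemma Theta_cross: "x \<in> C (B # As (Suc q)) \<Longrightarrow> Theta q x = cross (Suc q) x"
  by (rule rearr_unique[OF rearr_Theta rearr_cross]) simp

lemma t_op_closed: "x \<in> C (Bs (Suc p) @ As (Suc q)) \<Longrightarrow> t_op p q x \<in> C (Bs (Suc p) @ As (Suc q))"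
proof -
  assume x: "x \<in> C (Bs (Suc p) @ As (Suc q))"
  have "W (Bs p) (B # As (Suc q)) (As (Suc q) @ [B]) [] (Theta q) x \<in> C (Bs p @ As (Suc q) @ [B])"
    by (rule whisker_closed[OF _ _ _ _ Theta_hom x]) (simp_all add: replicate_app_Cons_same)
  then show ?thesis
    unfolding t_op_eq by (rule flip_closed[rotated 2]) simp_all
qed

lemma tbar_op_closed: "x \<in> C (Bs (Suc p) @ As (Suc q)) \<Longrightarrow> tbar_op p q x \<in> C (Bs (Suc p) @ As (Suc q))"
proof -
  assume x: "x \<in> C (Bs (Suc p) @ As (Suc q))"
  have y: "tflip K (Bs (Suc p) @ As q) [A] x \<in> C (A # Bs (Suc p) @ As q)"
    by (rule flip_closed[OF _ _ x]) (simp_all add: replicate_append_same)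
  show ?thesis
    unfolding tbar_op_eq
    by (rule whisker_closed[OF _ _ _ _ Gamma_hom y]) (simp_all add: replicate_app_Cons_same)
qed

text \<open>Up to rotation, the two cyclic operators are rearrangements. Write a tensor \<open>x\<close> on the word
  \<open>B\<^sup>n B A\<^sup>n A\<close> as in the diagonal, and first move the last \<open>B\<close> past \<open>A\<^sup>n\<close>, arriving at \<open>B\<^sup>n A\<^sup>n B A\<close>.
  Let \<open>z\<close>, on \<open>B A B\<^sup>n A\<^sup>n\<close>, be the result of rotating the last two letters to the front.
  The rotation of the smash product, applied to the tensor \<open>w\<close> that corresponds to \<open>x\<close>, is a rearrangement
  of \<open>z\<close>. In the diagonal, \<open>tbar_op\<close> moves the last \<open>A\<close> past \<open>B\<^sup>n B\<close> and \<open>t_op\<close> moves the \<open>B\<close> now last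
  past \<open>A A\<^sup>n\<close>. In this sequence the rotated \<open>A\<close> and \<open>B\<close> cross each other and cross back, and what is left
  is again a rearrangement of \<open>z\<close>. So the sorted forms agree.\<close>

lemma srt_rotation:
  assumes x: "x \<in> C (Bs (Suc n) @ As (Suc n))" and w: "w \<in> C (AB (Suc n))"
    and eq: "srt (ba (Suc n)) x = srt (ab (Suc n)) w"
  shows "srt (ba (Suc n)) (t_op n n (tbar_op n n x)) = srt (ab (Suc n)) (tflip K (AB n) [A, B] w)"
proof -
  \<comment> \<open>\<open>\<psi>\<close> is the isomorphism in one degree lower, and \<open>\<gamma>\<close> moves one \<open>A\<close> past \<open>B\<^sup>n\<close> from the left.\<close>
  obtain \<psi> where \<psi>: "rearr (ba n) (ab n) \<psi>" using ex_rearr[of "ba n" "ab n"] by auto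
  obtain \<gamma> where \<gamma>: "rearr (True # Fs n) (Fs n @ [True]) \<gamma>"
    using ex_rearr[of "True # Fs n" "Fs n @ [True]"] by auto
  have \<psi>h: "\<psi> \<in> Hom (Bs n @ As n) (AB n)" using rearr_hom[OF \<psi>] by simp
  have \<gamma>h: "\<gamma> \<in> Hom (A # Bs n) (Bs n @ [A])" using rearr_hom[OF \<gamma>] by simp
  note [simp] = \<psi>h \<gamma>h cross_hom
  define z0 where "z0 = W (Bs n) (B # As n) (As n @ [B]) [A] (cross n) x"
  define x' where "x' = W (Bs n @ As n) [B, A] [A, B] [] R z0"
  define z where "z = tflip K (Bs n @ As n) [B, A] z0"
  define xA where "xA = tflip K (Bs n @ B # As n) [A] x"
  define q where "q = W (A # Bs n) (B # As n) (As n @ [B]) [] (cross n) xA"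
  have x0: "x \<in> C (Bs n @ B # As n @ [A])"
    using x by (simp add: replicate_app_Cons_same replicate_append_same)
  have z0: "z0 \<in> C (Bs n @ As n @ [B, A])"
    unfolding z0_def by (rule whisker_closed[where Ms="B # As n"]) (use x0 in simp_all)
  have x': "x' \<in> C (Bs n @ As n @ [A, B])"
    unfolding x'_def by (rule whisker_closed[where Ms="[B, A]"]) (use z0 in simp_all)
  have z: "z \<in> C (B # A # Bs n @ As n)"
    unfolding z_def by (rule flip_closed[OF _ _ z0]) simp_all
  have xA: "xA \<in> C (A # Bs n @ B # As n)"
    unfolding xA_def by (rule flip_closed[OF _ _ x0]) simp_all
  have q: "q \<in> C (A # Bs n @ As n @ [B])"
    unfolding q_def by (rule whisker_closed[where Ms="B # As n"]) (use xA in simp_all)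
  have ba: "ba (Suc n) = Fs n @ [False] @ Ts n @ [True]"
    by (simp add: ba_def replicate_app_Cons_same replicate_append_same)
  have ab: "ab (Suc n) = ab n @ [True, False]" using ab_add[of n "Suc 0"] by simp

  have w_eq: "w = W [] (Bs n @ As n) (AB n) [A, B] \<psi> x'"
  proof (rule srt_inj[of "ab (Suc n)"])
    have 1: "rearr (ba (Suc n)) (Fs n @ Ts n @ [False, True]) (W (Bs n) (B # As n) (As n @ [B]) [A] (cross n))"
      using rearr_whisker[OF rearr_cross[of n], of "Fs n" "[True]"] by (simp add: ba)
    have 2: "rearr (Fs n @ Ts n @ [False, True]) (Fs n @ Ts n @ [True, False]) (W (Bs n @ As n) [B, A] [A, B] [] R)"
      using rearr.fwd[of "Fs n @ Ts n" "[]"] by simp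
    have 3: "rearr (Fs n @ Ts n @ [True, False]) (ab (Suc n)) (W [] (Bs n @ As n) (AB n) [A, B] \<psi>)"
      using rearr_whisker[OF \<psi>, of "[]" "[True, False]"] by (simp add: ab ba_def del: ab.simps)
    note r = rearr.comp[OF rearr.comp[OF 1 2] 3]
    have "x \<in> C (wd (ba (Suc n)))" using x by simp
    from rearr_srt[OF r this] show "srt (ab (Suc n)) w = srt (ab (Suc n)) (W [] (Bs n @ As n) (AB n) [A, B] \<psi> x')"
      by (simp only: eq x'_def z0_def)
    show "W [] (Bs n @ As n) (AB n) [A, B] \<psi> x' \<in> C (AB (Suc n))"
      unfolding ab by (rule whisker_closed[OF _ _ _ _ \<psi>h]) (use x' in simp_all)
  qed (rule w)
  have "tflip K (AB n) [A, B] w = W [A, B] (Bs n @ As n) (AB n) [] \<psi> (tflip K (Bs n @ As n) [A, B] x')"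
    unfolding w_eq using flip_whisker_left[of "[]" "Bs n @ As n" "AB n" "[]" "[A, B]" \<psi> x'] x' by simp
  also have "tflip K (Bs n @ As n) [A, B] x' = W [] [B, A] [A, B] (Bs n @ As n) R z"
    unfolding x'_def z_def using flip_whisker_right[of "Bs n @ As n" "[B, A]" "[A, B]" R z0] z0 by simp
  finally have rot: "tflip K (AB n) [A, B] w = W [A, B] (Bs n @ As n) (AB n) [] \<psi> (W [] [B, A] [A, B] (Bs n @ As n) R z)" .
  have 1: "rearr (False # True # ba n) (True # False # ba n) (W [] [B, A] [A, B] (Bs n @ As n) R)"
    using rearr.fwd[of "[]" "ba n"] by simp
  have 2: "rearr (True # False # ba n) (ab (Suc n)) (W [A, B] (Bs n @ As n) (AB n) [] \<psi>)"
    using rearr_whisker[OF \<psi>, of "[True, False]" "[]"] by simp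
  have z': "z \<in> C (wd (False # True # ba n))" using z by simp
  have L: "srt (ab (Suc n)) (tflip K (AB n) [A, B] w) = srt (False # True # ba n) z"
    unfolding rot by (rule rearr_srt[OF rearr.comp[OF 1 2] z'])

  \<comment> \<open>Uniqueness replaces the crossings of \<open>Gamma\<close> and \<open>Theta\<close> by those that avoid the pair of rotated letters.\<close>
  have "t_op n n (tbar_op n n x) = tflip K (Bs n @ As (Suc n)) [B]
      (W [] (A # Bs n) (Bs n @ [A]) (As n @ [B]) \<gamma> q)"
  proof -
    have 1: "rearr (True # Fs (Suc n) @ Ts n) (Fs (Suc n) @ True # Ts n) (W [] (A # Bs (Suc n)) (Bs (Suc n) @ [A]) (As n) (Gamma n))"
      using rearr_whisker[OF rearr_Gamma[of n], of "[]" "Ts n"] by (simp add: replicate_app_Cons_same)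
    have 2: "rearr (Fs (Suc n) @ True # Ts n) (Fs n @ Ts (Suc n) @ [False]) (W (Bs n) (B # As (Suc n)) (As (Suc n) @ [B]) [] (Theta n))"
      using rearr_whisker[OF rearr_Theta[of n], of "Fs n" "[]"] by (simp add: replicate_app_Cons_same)
    have 3: "rearr (True # Fs (Suc n) @ Ts n) (True # Fs n @ Ts n @ [False]) (W (A # Bs n) (B # As n) (As n @ [B]) [] (cross n))"
      using rearr_whisker[OF rearr_cross[of n], of "True # Fs n" "[]"] by (simp add: replicate_app_Cons_same)
    have 4: "rearr (True # Fs n @ Ts n @ [False]) (Fs n @ Ts (Suc n) @ [False]) (W [] (A # Bs n) (Bs n @ [A]) (As n @ [B]) \<gamma>)"
      using rearr_whisker[OF \<gamma>, of "[]" "Ts n @ [False]"] by simp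
    have "xA \<in> C (wd (True # Fs (Suc n) @ Ts n))" using xA by (simp add: replicate_app_Cons_same)
    from rearr_unique[OF rearr.comp[OF 1 2] rearr.comp[OF 3 4] this]
    have "W (Bs n) (B # As (Suc n)) (As (Suc n) @ [B]) [] (Theta n) (W [] (A # Bs (Suc n)) (Bs (Suc n) @ [A]) (As n) (Gamma n) xA) =
      W [] (A # Bs n) (Bs n @ [A]) (As n @ [B]) \<gamma> q" unfolding q_def .
    moreover have "tflip K (Bs (Suc n) @ As n) [A] x = xA"
      by (simp add: xA_def replicate_app_Cons_same)
    ultimately show ?thesis unfolding t_op_eq tbar_op_eq by (simp only:)
  qed
  also have "\<dots> = W [B] (A # Bs n) (Bs n @ [A]) (As n) \<gamma> (tflip K (A # Bs n @ As n) [B] q)"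
    using flip_whisker_left[of "[]" "A # Bs n" "Bs n @ [A]" "As n" "[B]" \<gamma> q] q by simp
  also have "q = tflip K (Bs n @ As n @ [B]) [A] z0"
    unfolding q_def xA_def z0_def
    using flip_whisker_left[of "Bs n" "B # As n" "As n @ [B]" "[]" "[A]" "cross n" x] x0 by simp
  also have "tflip K (A # Bs n @ As n) [B] (tflip K (Bs n @ As n @ [B]) [A] z0) = z"
    unfolding z_def using flip_comp[of "Bs n @ As n" "[B]" "[A]" z0] z0 by simp
  finally have t: "t_op n n (tbar_op n n x) = W [B] (A # Bs n) (Bs n @ [A]) (As n) \<gamma> z" .
  have r: "rearr (False # True # ba n) (ba (Suc n)) (W [B] (A # Bs n) (Bs n @ [A]) (As n) \<gamma>)"
    using rearr_whisker[OF \<gamma>, of "[False]" "Ts n"] by (simp add: ba_def)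
  show ?thesis
    unfolding t L by (rule rearr_srt[OF r z'])
qed

text \<open>The right-hand side is the one that \<open>srt_smash_mult\<close> yields for the words \<open>ab i\<close> and \<open>ab k\<close>.\<close>

lemma srt_diag_face:
  assumes x: "x \<in> C (Bs (Suc n) @ As (Suc n))" and n: "n = i + Suc k"
  shows "face diagonal n i x \<in> C (Bs n @ As n)"
    and "srt (ba n) (face diagonal n i x) =
      W (As i @ A # As k @ Bs i) [B, B] [B] (Bs k) mB
        (W (As i) [A, A] [A] (As k @ Bs i @ B # B # Bs k) mA (srt (ba (Suc n)) x))"
proof -
  note [simp] = mult_hom
  have Sn: "Suc (n - 1) = n" using n by simp
  have Bn: "Bs (Suc n) = Bs i @ [B, B] @ Bs k" and An: "As (Suc n) = As i @ [A, A] @ As k"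
    and An': "As n = As i @ [A] @ As k" and Bn': "Bs n = Bs i @ [B] @ Bs k"
    by (simp_all add: n replicate_add replicate_app_Cons_same)
  have Fn: "Fs (Suc n) = Fs i @ [False, False] @ Fs k" "Ts (Suc n) = Ts i @ [True, True] @ Ts k"
    "Fs n = Fs i @ [False] @ Fs k" "Ts n = Ts i @ [True] @ Ts k"
    by (simp_all add: n replicate_add replicate_app_Cons_same)
  have xA: "x \<in> C ((Bs (Suc n) @ As i) @ [A, A] @ As k)" using x unfolding An by simp
  let ?y = "W (Bs (Suc n) @ As i) [A, A] [A] (As k) mA x"
  have y: "?y \<in> C (Bs (Suc n) @ As n)"
    by (rule whisker_closed[OF _ _ _ _ _ xA]) (simp_all add: An')
  have d1: "dbar_op n n i x = ?y"
    unfolding dbar_op_def Let_def factors_eq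
    using tmap_contract[of A "Bs (Suc n) @ As i" "As k" "n + 1 + i" "Bs (Suc n) @ As (Suc n)" "Bs (Suc n) @ As n" x]
      n x An An' Sn by (simp del: replicate_Suc)
  have yB: "?y \<in> C (Bs i @ [B, B] @ (Bs k @ As n))" using y unfolding Bn by simp
  let ?z = "W (Bs i) [B, B] [B] (Bs k @ As n) mB ?y"
  have z: "?z \<in> C (Bs n @ As n)"
    by (rule whisker_closed[OF _ _ _ _ _ yB]) (simp_all add: Bn')
  have d2: "d_op n (n - 1) i ?y = ?z"
    unfolding d_op_def Let_def factors_eq
    using tmap_contract[of B "Bs i" "Bs k @ As n" i "Bs (Suc n) @ As n" "Bs n @ As n" ?y]
      n y Bn Bn' Sn by (simp del: replicate_Suc)
  have f: "face diagonal n i x = ?z"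
    by (simp add: diagonal_def d1 d2[unfolded One_nat_def] del: replicate_Suc)
  show "face diagonal n i x \<in> C (Bs n @ As n)" unfolding f by (rule z)
  have "?y \<in> C (wd (Fs i @ [False, False] @ (Fs k @ Ts n)))" using yB by simp
  note s2 = srt_mult_B[OF this]
  have "x \<in> C (wd ((Fs (Suc n) @ Ts i) @ [True, True] @ Ts k))" using xA by simp
  note s1 = srt_mult_A[OF this]
  have e1: "ba n = Fs i @ [False] @ (Fs k @ Ts n)" "Fs i @ [False, False] @ (Fs k @ Ts n) = (Fs (Suc n) @ Ts i) @ [True] @ Ts k"
    "(Fs (Suc n) @ Ts i) @ [True, True] @ Ts k = ba (Suc n)"
    by (simp_all add: ba_def Fn del: replicate_Suc)
  have r2: "srt (ba n) ?z = W (As n @ Bs i) [B, B] [B] (Bs k) mB (srt ((Fs (Suc n) @ Ts i) @ [True] @ Ts k) ?y)"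
    using s2 unfolding e1(2) e1(1)[symmetric] by (simp del: replicate_Suc srt.simps)
  have r1: "srt ((Fs (Suc n) @ Ts i) @ [True] @ Ts k) ?y =
      W (As i) [A, A] [A] (As k @ Bs (Suc n)) mA (srt (ba (Suc n)) x)"
    using s1 unfolding e1(3) by (simp del: replicate_Suc srt.simps)
  show "srt (ba n) (face diagonal n i x) =
      W (As i @ A # As k @ Bs i) [B, B] [B] (Bs k) mB
        (W (As i) [A, A] [A] (As k @ Bs i @ B # B # Bs k) mA (srt (ba (Suc n)) x))"
    using r2[unfolded r1] unfolding f An' Bn by (simp del: srt.simps)
qed

lemma srt_diag_degen:
  assumes x: "x \<in> C (Bs (Suc n) @ As (Suc n))" and n: "n = i + k"
  shows "degen diagonal n i x \<in> C (Bs (Suc (Suc n)) @ As (Suc (Suc n)))"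
    and "srt (ba (Suc (Suc n))) (degen diagonal n i x) =
      W (As (Suc (Suc n)) @ Bs (Suc i)) [] [B] (Bs k) uB
        (W (As (Suc i)) [] [A] (As k @ Bs (Suc n)) uA (srt (ba (Suc n)) x))"
proof -
  note [simp] = unit_hom
  have Bn: "Bs (Suc n) = Bs (Suc i) @ Bs k" and An: "As (Suc n) = As (Suc i) @ As k"
    and An': "As (Suc (Suc n)) = As (Suc i) @ [A] @ As k" and Bn': "Bs (Suc (Suc n)) = Bs (Suc i) @ [B] @ Bs k"
    by (simp_all add: n replicate_add replicate_app_Cons_same)
  have Fn: "Fs (Suc n) = Fs (Suc i) @ Fs k" "Ts (Suc n) = Ts (Suc i) @ Ts k"
    "Fs (Suc (Suc n)) = Fs (Suc i) @ [False] @ Fs k" "Ts (Suc (Suc n)) = Ts (Suc i) @ [True] @ Ts k"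
    by (simp_all add: n replicate_add replicate_app_Cons_same)
  have xA: "x \<in> C ((Bs (Suc n) @ As (Suc i)) @ [] @ As k)" using x unfolding An by simp
  let ?y = "W (Bs (Suc n) @ As (Suc i)) [] [A] (As k) uA x"
  have y: "?y \<in> C (Bs (Suc n) @ As (Suc (Suc n)))"
    by (rule whisker_closed[OF _ _ _ _ _ xA]) (simp_all only: An' append_assoc, simp_all)
  have d1: "sbar_op n n i x = ?y"
    unfolding sbar_op_def factors_eq
    by (rule tmap_insert_one) (use x in \<open>simp_all add: An An' del: replicate_Suc\<close>)
  have yB: "?y \<in> C (Bs (Suc i) @ [] @ (Bs k @ As (Suc (Suc n))))" using y unfolding Bn by simp
  let ?z = "W (Bs (Suc i)) [] [B] (Bs k @ As (Suc (Suc n))) uB ?y"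
  have z: "?z \<in> C (Bs (Suc (Suc n)) @ As (Suc (Suc n)))"
    by (rule whisker_closed[OF _ _ _ _ _ yB]) (simp_all only: Bn' append_assoc, simp_all)
  have d2: "s_op n (n + 1) i ?y = ?z"
    unfolding s_op_def factors_eq
    by (rule tmap_insert_one) (use y in \<open>simp_all add: Bn Bn' del: replicate_Suc\<close>)
  have f: "degen diagonal n i x = ?z"
    by (simp add: diagonal_def d1 d2[unfolded Suc_eq_plus1[symmetric]] del: replicate_Suc)
  show "degen diagonal n i x \<in> C (Bs (Suc (Suc n)) @ As (Suc (Suc n)))" unfolding f by (rule z)
  have "?y \<in> C (wd (Fs (Suc i) @ (Fs k @ Ts (Suc (Suc n)))))" using yB by (simp del: replicate_Suc)
  note s2 = srt_unit_B[OF this]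
  have "x \<in> C (wd ((Fs (Suc n) @ Ts (Suc i)) @ Ts k))" using xA by (simp del: replicate_Suc)
  note s1 = srt_unit_A[OF this]
  have e1: "Fs (Suc i) @ [False] @ (Fs k @ Ts (Suc (Suc n))) = ba (Suc (Suc n))"
    "Fs (Suc i) @ (Fs k @ Ts (Suc (Suc n))) = (Fs (Suc n) @ Ts (Suc i)) @ [True] @ Ts k"
    "(Fs (Suc n) @ Ts (Suc i)) @ Ts k = ba (Suc n)"
    by (simp_all only: ba_def Fn append_assoc)
  have r2: "srt (ba (Suc (Suc n))) ?z = W (As (Suc (Suc n)) @ Bs (Suc i)) [] [B] (Bs k) uB
      (srt ((Fs (Suc n) @ Ts (Suc i)) @ [True] @ Ts k) ?y)"
    using s2 unfolding e1(1) e1(2) by (simp del: replicate_Suc srt.simps)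
  have r1: "srt ((Fs (Suc n) @ Ts (Suc i)) @ [True] @ Ts k) ?y =
      W (As (Suc i)) [] [A] (As k @ Bs (Suc n)) uA (srt (ba (Suc n)) x)"
    using s1 unfolding e1(3) by (simp del: replicate_Suc srt.simps)
  show "srt (ba (Suc (Suc n))) (degen diagonal n i x) =
      W (As (Suc (Suc n)) @ Bs (Suc i)) [] [B] (Bs k) uB
        (W (As (Suc i)) [] [A] (As k @ Bs (Suc n)) uA (srt (ba (Suc n)) x))"
    unfolding f r2 r1 ..
qed

text \<open>The last face of the diagonal is \<open>d\<^sub>0 t dbar\<^sub>0 tbar\<close>, whereas the face with index \<open>0\<close> after the cyclic
  operator is \<open>d\<^sub>0 dbar\<^sub>0 t tbar\<close>. So \<open>t\<close> has to commute with the product of the first two letters \<open>A\<close>.\<close>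

lemma t_op_mult_A:
  assumes y: "y \<in> C (Bs (Suc p) @ As (Suc (Suc m)))"
  shows "t_op p m (W (Bs (Suc p)) [A, A] [A] (As m) mA y) =
    W (Bs (Suc p)) [A, A] [A] (As m) mA (t_op p (Suc m) y)"
proof -
  note [simp] = mult_hom
  have y': "y \<in> C (Bs p @ B # A # A # As m)" using y by (simp add: replicate_app_Cons_same)
  have Th: "Theta m \<in> Hom (B # A # As m) (A # As m @ [B])" "Theta (Suc m) \<in> Hom (B # A # A # As m) (A # A # As m @ [B])"
    using Theta_hom[of m] Theta_hom[of "Suc m"] by simp_all
  have h: "W [B] [A, A] [A] (As m) mA \<in> Hom (B # A # A # As m) (B # A # As m)"
    "W [] [A, A] [A] (As m @ [B]) mA \<in> Hom (A # A # As m @ [B]) (A # As m @ [B])"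
    by (rule whisker_hom; simp)+
  have nat: "Theta m (W [B] [A, A] [A] (As m) mA v) = W [] [A, A] [A] (As m @ [B]) mA (Theta (Suc m) v)"
    if v: "v \<in> C (B # A # A # As m)" for v
  proof -
    have m2: "mA \<in> Hom (As (Suc (Suc 0))) (As (Suc 0))" by simp
    have "W [B] [A, A] [A] (As m) mA v \<in> C (B # As (Suc m))"
      using lin_maps_closed[OF h(1) v] by simp
    moreover have "cross (Suc m) (W [B] [A, A] [A] (As m) mA v) = W [] [A, A] [A] (As m @ [B]) mA (cross (Suc (Suc m)) v)"
      using cross_natural[OF m2 mult_A_slide, of v 0 m] v by (simp del: cross.simps)
    ultimately show ?thesis using v by (simp add: Theta_cross del: cross.simps)
  qed
  let ?v = "W (Bs p) (B # A # A # As m) (A # A # As m @ [B]) [] (Theta (Suc m)) y"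
  have v: "?v \<in> C (Bs p @ A # A # As m @ [B])"
    by (rule whisker_closed[OF _ _ _ _ Th(2)]) (use y' in simp_all)
  have 1: "W (Bs (Suc p)) [A, A] [A] (As m) mA y = W (Bs p) (B # A # A # As m) (B # A # As m) [] (W [B] [A, A] [A] (As m) mA) y"
    using whisker_whisker[of "Bs p" "[B]" "[A, A]" "[A]" "As m" "[]" mA y] y' by (simp add: replicate_append_same)
  have 2: "W (Bs p) (B # A # As m) (A # As m @ [B]) [] (Theta m)
      (W (Bs p) (B # A # A # As m) (B # A # As m) [] (W [B] [A, A] [A] (As m) mA) y) =
      W (Bs p) (A # A # As m @ [B]) (A # As m @ [B]) [] (W [] [A, A] [A] (As m @ [B]) mA) ?v"
    by (rule whisker_square[OF _ _ _ _ _ _ h(1) Th(1) Th(2) h(2) nat]) (use y' in simp_all)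
  have 3: "W (Bs p) (A # A # As m @ [B]) (A # As m @ [B]) [] (W [] [A, A] [A] (As m @ [B]) mA) ?v =
      W (Bs p) [A, A] [A] (As m @ [B]) mA ?v"
    using whisker_whisker[of "Bs p" "[]" "[A, A]" "[A]" "As m @ [B]" "[]" mA ?v] v by simp
  have 4: "tflip K (Bs p @ A # As m) [B] (W (Bs p) [A, A] [A] (As m @ [B]) mA ?v) =
      W (Bs (Suc p)) [A, A] [A] (As m) mA (tflip K (Bs p @ A # A # As m) [B] ?v)"
    using flip_whisker_left[of "Bs p" "[A, A]" "[A]" "As m" "[B]" mA ?v] v by simp
  show ?thesis
    unfolding t_op_eq using 1 2 3 4 by simp
qed

lemma cyc_diagonal: "cyc diagonal n x = t_op n n (tbar_op n n x)"
  by (simp add: diagonal_def)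

lemma obj_diagonal: "obj diagonal n = T (Bs (Suc n) @ As (Suc n))"
  by (simp add: diagonal_def factors_eq)

lemma last_face_diagonal:
  assumes x: "x \<in> C (Bs (Suc n) @ As (Suc n))" and n: "1 \<le> n"
  shows "face diagonal n n x = face diagonal n 0 (cyc diagonal n x)"
proof -
  obtain m where m: "n = Suc m" using n by (cases n) auto
  let ?y = "tbar_op n n x"
  have y: "?y \<in> C (Bs (Suc n) @ As (Suc n))" by (rule tbar_op_closed[OF x])
  have c: "tmap K (factors n n) (factors n m) (contract A (n + 1)) v = W (Bs (Suc n)) [A, A] [A] (As m) mA v"
    if "v \<in> C (Bs (Suc n) @ As (Suc n))" for v
    unfolding factors_eq by (rule tmap_contract) (use that m in simp_all)
  have "face diagonal n n x = tmap K (factors n m) (factors m m) (contract B 0)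
      (t_op n m (W (Bs (Suc n)) [A, A] [A] (As m) mA ?y))"
    using c[OF y] by (simp add: diagonal_def d_op_def dbar_op_def Let_def m del: replicate_Suc)
  also have "t_op n m (W (Bs (Suc n)) [A, A] [A] (As m) mA ?y) =
      W (Bs (Suc n)) [A, A] [A] (As m) mA (t_op n n ?y)"
    using t_op_mult_A[of ?y n m] y m by (simp del: replicate_Suc)
  also have "tmap K (factors n m) (factors m m) (contract B 0) \<dots> = face diagonal n 0 (cyc diagonal n x)"
    using c[OF t_op_closed[OF y]] by (simp add: diagonal_def d_op_def dbar_op_def Let_def m del: replicate_Suc)
  finally show ?thesis .
qed

section \<open>The isomorphism\<close>

text \<open>The map \<open>\<theta>\<close> from the cyclic module of the smash product to the diagonal is characterised by having the
  same sorted form as the flattened argument (facts \<open>\<theta>\<close> and \<open>\<theta>_eq\<close>). Compatibility with an operator is the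
  statement that the operator has the same effect on sorted forms on both sides.\<close>

theorem diagonal_isomorphic: "isomorphic_cyclic_modules K diagonal (algebra_cyclic K X)"
proof -
  let ?D = "algebra_cyclic K X"
  \<comment> \<open>\<open>g n\<close> undoes the sorting of the word of the diagonal.\<close>
  define g where "g n = inv_into (C (wd (ba n))) (srt (ba n))" for n
  define \<theta> where "\<theta> n z = g (Suc n) (srt (ab (Suc n)) (flat (Suc n) z))" for n z
  note alg = algebra_cyclic_simps[OF smash_algebra]
  interpret Alg: cyclic_module K ?D
    by (rule algebra_cyclic_module[OF smash_algebra])
  have g_bij: "bij_betw (g n) (C (As n @ Bs n)) (C (Bs n @ As n))" for n
    using bij_betw_inv_into[OF srt_bij[of "ba n"]] by (simp add: g_def)
  have g: "srt (ba n) (g n y) = y" "g n y \<in> C (Bs n @ As n)" if "y \<in> C (As n @ Bs n)" for n y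
    using srt_bij[of "ba n"] g_bij[of n] that by (auto simp: g_def bij_betw_def f_inv_into_f)
  have g_srt: "g n (srt (ba n) x) = x" if "x \<in> C (Bs n @ As n)" for n x
    using srt_bij[of "ba n"] that by (simp add: g_def bij_betw_def)
  have g_lin: "g n \<in> Hom (As n @ Bs n) (Bs n @ As n)" for n
    using lin_maps_inverse[OF srt_hom srt_bij, of "ba n" "g n"] g_srt by (simp add: tensor_module)
  have fl: "flat n z \<in> C (AB n)" if "z \<in> C (Xs n)" for n z
    using lin_maps_closed[OF flat_hom that] .
  have sl: "srt (ab n) w \<in> C (As n @ Bs n)" if "w \<in> C (AB n)" for n w
    using srt_closed[OF that] by simp
  have \<theta>: "\<theta> n z \<in> C (Bs (Suc n) @ As (Suc n))" "srt (ba (Suc n)) (\<theta> n z) = srt (ab (Suc n)) (flat (Suc n) z)"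
    if "z \<in> C (Xs (Suc n))" for n z
    unfolding \<theta>_def using g[OF sl[OF fl[OF that]]] by blast+
  have \<theta>_eq: "\<theta> n z = x" if "x \<in> C (Bs (Suc n) @ As (Suc n))" "srt (ba (Suc n)) x = srt (ab (Suc n)) (flat (Suc n) z)" for n z x
    unfolding \<theta>_def that(2)[symmetric] by (rule g_srt[OF that(1)])
  have cyc: "\<theta> n (cyc ?D n z) = cyc diagonal n (\<theta> n z)" if z: "z \<in> C (Xs (Suc n))" for n z
  proof (rule \<theta>_eq)
    show "cyc diagonal n (\<theta> n z) \<in> C (Bs (Suc n) @ As (Suc n))"
      unfolding cyc_diagonal by (intro t_op_closed tbar_op_closed \<theta> z)
    show "srt (ba (Suc n)) (cyc diagonal n (\<theta> n z)) = srt (ab (Suc n)) (flat (Suc n) (cyc ?D n z))"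
      unfolding cyc_diagonal alg flat_cyc[OF z] by (rule srt_rotation[OF \<theta>(1)[OF z] fl[OF z] \<theta>(2)[OF z]])
  qed
  have face_less: "\<theta> (n - 1) (face ?D n i z) = face diagonal n i (\<theta> n z)"
    if z: "z \<in> C (Xs (Suc n))" and i: "i < n" for n i z
  proof -
    define k where "k = n - Suc i"
    with i have n: "n = i + Suc k" and Sn: "Suc (i + k) = n" "n - 1 = i + k" by simp_all
    have z': "z \<in> C (Xs (i + Suc (Suc k)))" using z by (simp only: n add_Suc_right)
    have "\<theta> (i + k) (face ?D n i z) = face diagonal n i (\<theta> n z)"
    proof (rule \<theta>_eq)
      show "face diagonal n i (\<theta> n z) \<in> C (Bs (Suc (i + k)) @ As (Suc (i + k)))"
        unfolding Sn by (rule srt_diag_face(1)[OF \<theta>(1)[OF z] n])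
      have S: "ab n = ab i @ [True, False] @ ab k" "ab (Suc n) = ab i @ [True, False, True, False] @ ab k"
        using ab_add[of i "Suc k"] ab_add[of i "Suc (Suc k)"] by (simp_all add: n)
      have w: "flat (Suc n) z \<in> C (wd (ab i @ [True, False, True, False] @ ab k))"
        using fl[OF z] unfolding S(2) .
      have "face ?D n i z = tmap K (Xs (i + Suc (Suc k))) (Xs (i + Suc k)) (face_list X (i + Suc k) i) z"
        using alg(2)[of "i + k" i] by (simp only: n add_Suc_right)
      then have "flat n (face ?D n i z) = W (AB i) [A, B, A, B] [A, B] (AB k) smash_mult (flat (Suc n) z)"
        using flat_face[OF z'] by (simp only: n add_Suc_right)
      then have "srt (ab n) (flat n (face ?D n i z)) =
        W (As i @ A # As k @ Bs i) [B, B] [B] (Bs k) mB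
          (W (As i) [A, A] [A] (As k @ Bs i @ B # B # Bs k) mA (srt (ab (Suc n)) (flat (Suc n) z)))"
        unfolding S using srt_smash_mult[OF w] by (simp only: count_ab)
      then show "srt (ba (Suc (i + k))) (face diagonal n i (\<theta> n z)) =
          srt (ab (Suc (i + k))) (flat (Suc (i + k)) (face ?D n i z))"
        unfolding Sn using srt_diag_face(2)[OF \<theta>(1)[OF z] n] \<theta>(2)[OF z] by (simp only:)
    qed
    then show ?thesis by (simp only: Sn)
  qed
  show ?thesis
  proof (rule isomorphic_cyclic_modules_transport[where \<theta> = \<theta>])
    show "cyclic_module K ?D" by (rule Alg.cyclic_module_axioms)
    show "module K (obj diagonal n)" for n
      unfolding obj_diagonal by (rule tensor_module) simp
    show "\<theta> n \<in> lin_maps K (obj ?D n) (obj diagonal n)" for n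
      unfolding obj_diagonal alg \<theta>_def[abs_def]
      by (rule lin_maps_comp[OF lin_maps_comp[OF flat_hom srt_hom[of "ab (Suc n)", unfolded count_ab]] g_lin])
    show "bij_betw (\<theta> n) (carrier (obj ?D n)) (carrier (obj diagonal n))" for n
      unfolding obj_diagonal alg \<theta>_def[abs_def]
      using bij_betw_trans[OF bij_betw_trans[OF flat_bij srt_bij[of "ab (Suc n)", unfolded count_ab]] g_bij] by (simp add: comp_def)
    show "\<theta> n (cyc ?D n z) = cyc diagonal n (\<theta> n z)" if "z \<in> carrier (obj ?D n)" for n z
      using cyc that unfolding alg .
    show "\<theta> (n - 1) (face ?D n i z) = face diagonal n i (\<theta> n z)"
      if "1 \<le> n" "i \<le> n" and z': "z \<in> carrier (obj ?D n)" for n i z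
    proof (cases "i < n")
      case True
      then show ?thesis using face_less z' unfolding alg by blast
    next
      case False
      with that have i: "i = n" by simp
      have z: "z \<in> C (Xs (Suc n))" using z' unfolding alg .
      have cz: "cyc ?D n z \<in> C (Xs (Suc n))"
        using lin_maps_closed[OF Alg.cyc_linear z'] unfolding alg .
      have "\<theta> (n - 1) (face ?D n n z) = \<theta> (n - 1) (face ?D n 0 (cyc ?D n z))"
        using Alg.face_0_cyc[OF that(1) z'] by simp
      also have "\<dots> = face diagonal n 0 (\<theta> n (cyc ?D n z))"
        by (rule face_less[OF cz]) (use that in simp)
      also have "\<dots> = face diagonal n n (\<theta> n z)"
        using last_face_diagonal[OF \<theta>(1)[OF z] that(1)] by (simp only: cyc[OF z])
      finally show ?thesis by (simp only: i)
    qed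
    show "\<theta> (n + 1) (degen ?D n i z) = degen diagonal n i (\<theta> n z)"
      if i: "i \<le> n" and z': "z \<in> carrier (obj ?D n)" for n i z
    proof -
      define k where "k = n - i"
      with i have n: "n = i + k" by simp
      have z: "z \<in> C (Xs (Suc n))" using z' unfolding alg .
      have z'': "z \<in> C (Xs (Suc i + k))" using z by (simp only: n add_Suc)
      have "\<theta> (Suc n) (degen ?D n i z) = degen diagonal n i (\<theta> n z)"
      proof (rule \<theta>_eq)
        show "degen diagonal n i (\<theta> n z) \<in> C (Bs (Suc (Suc n)) @ As (Suc (Suc n)))"
          by (rule srt_diag_degen(1)[OF \<theta>(1)[OF z] n])
        let ?w = "flat (Suc n) z"
        let ?v = "W (AB (Suc i)) [] [A] (AB k) uA ?w"
        have S: "ab (Suc n) = ab (Suc i) @ ab k" "ab (Suc (Suc n)) = (ab (Suc i) @ [True]) @ [False] @ ab k"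
          using ab_add[of "Suc i" k] ab_add[of "Suc i" "Suc k"] by (simp_all add: n)
        have w: "?w \<in> C (wd (ab (Suc i) @ ab k))" using fl[OF z] unfolding S(1) .
        have v: "?v \<in> C (wd ((ab (Suc i) @ [True]) @ ab k))"
          by (rule whisker_closed[OF _ _ _ _ _ w]) (simp_all add: unit_hom)
        have "flat (Suc (Suc n)) (degen ?D n i z) = W (AB (Suc i) @ [A]) [] [B] (AB k) uB ?v"
          using flat_degen[OF z''] unfolding alg by (simp only: n add_Suc)
        then have "srt (ab (Suc (Suc n))) (flat (Suc (Suc n)) (degen ?D n i z)) =
          srt ((ab (Suc i) @ [True]) @ [False] @ ab k) (W (wd (ab (Suc i) @ [True])) [] [B] (AB k) uB ?v)"
          unfolding S by (simp only: wd_simps)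
        also have "\<dots> = W (As (cA (ab (Suc i) @ [True])) @ As (cA (ab k)) @ Bs (cB (ab (Suc i) @ [True]))) [] [B] (Bs (cB (ab k))) uB
            (srt ((ab (Suc i) @ [True]) @ ab k) ?v)"
          by (rule srt_unit_B[OF v])
        also have "srt ((ab (Suc i) @ [True]) @ ab k) ?v = W (As (Suc i)) [] [A] (As k @ Bs (Suc i) @ Bs k) uA (srt (ab (Suc n)) ?w)"
          using srt_unit_A[OF w] unfolding S(1) by (simp only: count_ab append_assoc)
        also have "As k @ Bs (Suc i) @ Bs k = As k @ Bs (Suc n)"
          by (simp add: n replicate_add)
        also have "As (cA (ab (Suc i) @ [True])) @ As (cA (ab k)) @ Bs (cB (ab (Suc i) @ [True])) = As (Suc (Suc n)) @ Bs (Suc i)"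
          by (simp add: n replicate_add replicate_app_Cons_same del: ab.simps)
        also have "cB (ab k) = k" by simp
        finally show "srt (ba (Suc (Suc n))) (degen diagonal n i (\<theta> n z)) =
            srt (ab (Suc (Suc n))) (flat (Suc (Suc n)) (degen ?D n i z))"
          using srt_diag_degen(2)[OF \<theta>(1)[OF z] n] \<theta>(2)[OF z] by (simp only:)
      qed
      then show ?thesis by simp
    qed
  qed
qed

end

theorem proposition2p6:
  fixes K :: "'k ring" and A :: "('k, 'a) module" and B :: "('k, 'b) module"
    and R :: "('a + 'b, 'k) tens \<Rightarrow> ('a + 'b, 'k) tens"
  assumes "field K" and "contains_rat K"
    and "assoc_algebra K A" and "assoc_algebra K B"
    and "strong_smash K (in_left A) (in_right B) R"
  shows "isomorphic_cyclic_modules K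
           (natural_data.diagonal K (in_left A) (in_right B) R)
           (algebra_cyclic K (smash_product K (in_left A) (in_right B) R))"
  by (rule strong_smash.diagonal_isomorphic[OF assms(5)])

end
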